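(* If $K$ is a convex disc (a planar convex body), then for any $p\geq 1$ we have $\mathbb{E}^p_*(K)\leq\mathbb{E}^p_*(T^2)$, with equality if and only if $K$ is a triangle.
   Context: A convex disc is a compact convex set in $\mathbb{R}^2$ with nonempty interior. $T^2$ denotes a triangle (the quantity below is invariant under non-singular affine maps, so the choice is irrelevant). $V$ is area, $[x,y,z]$ denotes the convex hull of the points $x,y,z$, and $\gamma(K)$ is the centroid of $K$. For a convex disc $K$ and $p>0$, set $$\mathbb{E}^p_*(K)=V(K)^{-2-p}\int_K\int_K V([\gamma(K),x_1,x_2])^p\,dx_1dx_2.$$ *)

theory Defs
  imports "HOL-Analysis.Analysis"
begin

definition convex_disc :: "(real^2) set \<Rightarrow> bool" where
  "convex_disc K \<longleftrightarrow> compact K \<and> convex K \<and> interior K \<noteq> {}"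

definition area :: "(real^2) set \<Rightarrow> real" where
  "area K = measure lebesgue K"

definition centroid :: "(real^2) set \<Rightarrow> real^2" where
  "centroid K = (1 / area K) *\<^sub>R (LINT x:K|lebesgue. x)"

(* The exponent p is real, hence powr. Degenerate triangles contribute 0,
   since 0 powr p = 0. *)
definition E_star :: "real \<Rightarrow> (real^2) set \<Rightarrow> real" where
  "E_star p K = area K powr (-2 - p) *
     (LINT x2:K|lebesgue. (LINT x1:K|lebesgue.
        area (convex hull {centroid K, x1, x2}) powr p))"

end

theory Submission
  imports Defs
begin

text \<open>
  Split \<open>K\<close> by a chord and shear the part above it by \<open>t\<close> parallel to the chord. The centroid moves
  linearly in \<open>t\<close> and so does every determinant \<open>det (x - \<gamma>, y - \<gamma>)\<close>, so the functional, being an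
  integral of \<open>p\<close>-th powers of absolute values of affine functions of \<open>t\<close>, is convex in \<open>t\<close>.
  For a polygon and a diagonal, \<open>t\<close> can be pushed in both directions until an end of the diagonal
  stops being a vertex, so by convexity some polygon with fewer vertices is at least as good; this
  ends at a triangle. General convex discs follow by approximation from inside.

  For strictness, a disc that is not a triangle has four points in convex position at each of which
  it is touched from outside by a circle. Shear along a diagonal of these four points. The mean of
  the values at \<open>t\<close> and \<open>-t\<close> exceeds the value at 0 by at least a constant times \<open>t\<^sup>2\<close>. The sheared
  disc may fail to be convex, but the touching circles (parabolas, after an affine map) force its
  convex hull to add only area \<open>O(t\<^sup>3)\<close>, so for small \<open>t\<close> one of the two hulls beats \<open>K\<close>.
\<close>

section \<open>Moments of the determinant\<close>

text \<open>Existence of a maximiser plays no part: strictness comes from improving \<open>K\<close>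
  to another disc and applying the non-strict inequality to that one. The obstacle is that a shear
  of a curved disc can leave the class of convex discs. If the boundary is flat at an end of the
  chord, the shear makes a reentrant corner there, and filling it can add area of order t, which
  would swallow a gain of order t^2. Contact with a circle at both ends of the chord cures this: the
  dent then has length O(t) and depth O(t^2). This is also why the functional is studied on compact
  sets and not just on convex ones: a single Lipschitz bound in the area, for nested compact sets,
  serves both the passage from polygons to discs and the cost of taking the hull of a sheared
  disc.\<close>

definition cross2 :: "real^2 \<Rightarrow> real^2 \<Rightarrow> real" where
  "cross2 x y = x$1 * y$2 - x$2 * y$1"

lemma cross2_minus_commute: "cross2 x y = - cross2 y x"
  by (simp add: cross2_def)

lemma abs_cross2_commute: "\<bar>cross2 x y\<bar> = \<bar>cross2 y x\<bar>"
  by (subst cross2_minus_commute) simp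

lemma abs_cross2_le: "\<bar>cross2 x y\<bar> \<le> 2 * norm x * norm y"
proof -
  have "\<bar>cross2 x y\<bar> \<le> \<bar>x$1\<bar> * \<bar>y$2\<bar> + \<bar>x$2\<bar> * \<bar>y$1\<bar>"
    unfolding cross2_def by (metis abs_mult abs_triangle_ineq4)
  also have "\<dots> \<le> norm x * norm y + norm x * norm y"
    by (intro add_mono mult_mono component_le_norm_cart) auto
  finally show ?thesis by simp
qed

lemma continuous_on_cross2 [continuous_intros]:
  "continuous_on S f \<Longrightarrow> continuous_on S g \<Longrightarrow> continuous_on S (\<lambda>x. cross2 (f x) (g x))"
  unfolding cross2_def by (intro continuous_intros)

lemma continuous_on_abs_powr [continuous_intros]:
  fixes f :: "'a::topological_space \<Rightarrow> real"
  shows "continuous_on S f \<Longrightarrow> p \<ge> 1 \<Longrightarrow> continuous_on S (\<lambda>x. \<bar>f x\<bar> powr p)"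
  by (intro continuous_on_powr' continuous_intros) auto

lemma convex_on_abs_powr:
  fixes p :: real
  assumes "p \<ge> 1"
  shows "convex_on UNIV (\<lambda>x::real. \<bar>x\<bar> powr p)"
proof (intro convex_onI)
  fix t x y :: real
  assume t: "0 < t" "t < 1"
  have *: "((1 - t) * a + t * b) powr p \<le> (1 - t) * a powr p + t * b powr p"
    if ab: "a \<ge> 0" "b \<ge> 0" for a b
  \<comment> \<open>With both endpoints positive this is the convexity of \<open>powr\<close>. With
    an endpoint 0 it becomes \<open>s powr p \<le> s\<close> for a weight \<open>s\<close> in (0,1),
    which is where \<open>p \<ge> 1\<close> enters.\<close>
  proof (cases "a = 0 \<or> b = 0")
    case False
    with ab show ?thesis
      using convex_onD[OF powr_convex[OF assms], of t a b] t by simp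
  next
    case True
    have le: "s powr p \<le> s" if "0 < s" "s < 1" for s
      using powr_mono'[of 1 p s] assms that by simp
    from True show ?thesis
      using le[of t] le[of "1 - t"] t ab assms
      by (auto simp: powr_mult intro!: mult_right_mono)
  qed
  have "\<bar>(1 - t) *\<^sub>R x + t *\<^sub>R y\<bar> powr p \<le> ((1 - t) * \<bar>x\<bar> + t * \<bar>y\<bar>) powr p"
    using t assms
    by (intro powr_mono2) (auto intro!: order_trans[OF abs_triangle_ineq] simp: abs_mult)
  also have "\<dots> \<le> (1 - t) * \<bar>x\<bar> powr p + t * \<bar>y\<bar> powr p"
    by (rule *) auto
  finally show "\<bar>(1 - t) *\<^sub>R x + t *\<^sub>R y\<bar> powr p \<le> (1 - t) * \<bar>x\<bar> powr p + t * \<bar>y\<bar> powr p" .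
qed auto

lemma area_triangle: "area (convex hull {g, x, y}) = \<bar>cross2 (x - g) (y - g)\<bar> / 2"
  proof -
  have "area (convex hull {g, x, y}) = \<bar>(y$1 - g$1) * (x$2 - g$2) - (x$1 - g$1) * (y$2 - g$2)\<bar> / 2"
    unfolding area_def content_triangle[symmetric]
    by (intro measure_completion) (simp add: finite_imp_compact_convex_hull borel_compact)
  also have "\<dots> = \<bar>cross2 (x - g) (y - g)\<bar> / 2"
    by (subst abs_cross2_commute) (simp add: cross2_def mult.commute)
  finally show ?thesis .
qed

text \<open>The base point is a separate argument so that the Lipschitz estimate can vary the domain
  and the centroid one at a time.\<close>

definition moment :: "real \<Rightarrow> (real^2) set \<Rightarrow> real^2 \<Rightarrow> real" where
  "moment p K g = (LINT z:K\<times>K|lborel. \<bar>cross2 (fst z - g) (snd z - g)\<bar> powr p)"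

lemma set_integrable_compact:
  fixes f :: "'a::euclidean_space \<Rightarrow> 'b::{banach, second_countable_topology}"
  shows "compact C \<Longrightarrow> continuous_on C f \<Longrightarrow> set_integrable lborel C f"
  using borel_integrable_compact[of C f] by (simp add: set_integrable_def indicator_scaleR_eq_if)

lemma integrable_indicator_compact:
  fixes C :: "'a::euclidean_space set"
  shows "compact C \<Longrightarrow> integrable lborel (indicator C :: 'a \<Rightarrow> real)"
  using set_integrable_compact[of C "\<lambda>_. 1 :: real"] by (simp add: set_integrable_def)

lemma set_integral_const_compact:
  fixes C :: "'a::euclidean_space set" and b :: "'b::{banach, second_countable_topology}"
  shows "compact C \<Longrightarrow> (LINT x:C|lborel. b) = measure lborel C *\<^sub>R b"
  by (simp add: set_lebesgue_integral_def integrable_indicator_compact)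

lemma set_integral_Times:
  fixes f :: "'a::euclidean_space \<times> 'b::euclidean_space \<Rightarrow> real"
  assumes A: "compact A" and B: "compact B" and f: "continuous_on (A \<times> B) f"
  shows "(LINT z:A\<times>B|lborel. f z) = (LINT x:A|lborel. LINT y:B|lborel. f (x, y))"
proof -
  have "integrable lborel (\<lambda>z. indicator (A \<times> B) z *\<^sub>R f z)"
    using set_integrable_compact[of "A \<times> B" f] compact_Times[OF A B] f by (simp add: set_integrable_def)
  then have "(LINT z:A\<times>B|lborel. f z) = (LINT x|lborel. LINT y|lborel. indicator (A \<times> B) (x, y) *\<^sub>R f (x, y))"
    unfolding set_lebesgue_integral_def
    by (subst lborel_pair.integral_fst') (simp_all add: lborel_prod)
  then show ?thesis
    by (simp add: set_lebesgue_integral_def indicator_times mult.assoc)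
qed

lemma set_integral_lebesgue:
  fixes f :: "'a::euclidean_space \<Rightarrow> 'b::{banach, second_countable_topology}"
  assumes K: "compact K" and f: "continuous_on K f"
  shows "(LINT x:K|lebesgue. f x) = (LINT x:K|lborel. f x)"
proof -
  have "(\<lambda>x. indicator K x *\<^sub>R f x) \<in> borel_measurable lborel"
    using set_integrable_compact[OF assms] unfolding set_integrable_def by (rule borel_measurable_integrable)
  then show ?thesis
    unfolding set_lebesgue_integral_def by (rule integral_completion)
qed

lemma area_compact: "compact K \<Longrightarrow> area K = measure lborel K"
  by (simp add: area_def measure_completion borel_compact)

lemma E_star_compact:
  assumes K: "compact K" and p: "p \<ge> 1"
  shows "E_star p K = area K powr (-2 - p) * 2 powr (-p) * moment p K (centroid K)"
proof -
  let ?g = "centroid K"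
  let ?f = "\<lambda>z. \<bar>cross2 (fst z - ?g) (snd z - ?g)\<bar> powr p"
  have c: "continuous_on UNIV ?f"
    using p by (intro continuous_intros)
  have "area (convex hull {?g, x1, x2}) powr p = 2 powr (-p) * ?f (x2, x1)" for x1 x2
    by (simp add: area_triangle powr_divide powr_minus field_simps abs_cross2_commute)
  then have "(LINT x2:K|lebesgue. (LINT x1:K|lebesgue. area (convex hull {?g, x1, x2}) powr p))
     = 2 powr (-p) * (LINT x2:K|lebesgue. (LINT x1:K|lebesgue. ?f (x2, x1)))"
    by simp
  also have "(LINT x2:K|lebesgue. (LINT x1:K|lebesgue. ?f (x2, x1)))
     = (LINT x2:K|lebesgue. (LINT x1:K|lborel. ?f (x2, x1)))"
    using p by (subst set_integral_lebesgue[OF K]) (auto intro!: continuous_intros)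
  \<comment> \<open>The outer integrand is itself an integral; instead of its continuity, its Borel
    measurability is obtained from Fubini, and that suffices to pass from the completed measure to
    \<open>lborel\<close>.\<close>
  also have "\<dots> = (LINT x2:K|lborel. (LINT x1:K|lborel. ?f (x2, x1)))"
  proof -
    have "integrable lborel (\<lambda>z. indicator (K \<times> K) z *\<^sub>R ?f z)"
      using set_integrable_compact[of "K \<times> K" ?f] compact_Times[OF K K] continuous_on_subset[OF c]
      by (auto simp: set_integrable_def)
    then have "(\<lambda>z. indicator (K \<times> K) z *\<^sub>R ?f z) \<in> borel_measurable (lborel \<Otimes>\<^sub>M lborel)"
      unfolding lborel_prod by (rule borel_measurable_integrable)
    then have "(\<lambda>x. LINT y|lborel. indicator (K \<times> K) (x, y) *\<^sub>R ?f (x, y)) \<in> borel_measurable lborel"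
      by (intro lborel.borel_measurable_lebesgue_integral) (simp add: case_prod_unfold)
    then show ?thesis
      unfolding set_lebesgue_integral_def
      by (intro integral_completion) (simp add: indicator_times mult.assoc)
  qed
  also have "\<dots> = moment p K ?g"
    unfolding moment_def using set_integral_Times[OF K K continuous_on_subset[OF c]] by simp
  finally show ?thesis
    by (simp add: E_star_def)
qed

lemma centroid_compact:
  assumes "compact K"
  shows "centroid K = (1 / area K) *\<^sub>R (LINT x:K|lborel. x)"
  unfolding centroid_def using assms by (simp add: set_integral_lebesgue)

section \<open>Volume-scaling maps and affine invariance\<close>

text \<open>Push-forward form of \<open>vol (T ` A) = c * vol A\<close>.\<close>

definition volume_scaling :: "real \<Rightarrow> (real^2 \<Rightarrow> real^2) \<Rightarrow> bool" where
  "volume_scaling c T \<longleftrightarrow> c > 0 \<and> continuous_on UNIV T \<and> inj T \<and>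
     lborel = density (distr lborel borel T) (\<lambda>_. ennreal c)"

lemma volume_scaling_measurable: "volume_scaling c T \<Longrightarrow> T \<in> borel_measurable borel"
  by (auto simp: volume_scaling_def intro: borel_measurable_continuous_onI)

lemma volume_scalingI:
  assumes "c > 0" "continuous_on UNIV T" "inj T"
    and "\<And>A. A \<in> sets borel \<Longrightarrow> emeasure lborel A = ennreal c * emeasure lborel (T -` A)"
  shows "volume_scaling c T"
proof -
  have [measurable]: "T \<in> borel_measurable borel"
    using assms(2) by (intro borel_measurable_continuous_onI)
  have "lborel = density (distr lborel borel T) (\<lambda>_. ennreal c)"
    by (intro measure_eqI) (auto simp: emeasure_density_const emeasure_distr assms(4))
  with assms show ?thesis by (simp add: volume_scaling_def)
qed

lemma volume_scaling_emeasure: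
  assumes T: "volume_scaling c T" and A: "A \<in> sets borel"
  shows "emeasure lborel A = ennreal c * emeasure lborel (T -` A)"
proof -
  note [measurable] = volume_scaling_measurable[OF T]
  have "emeasure lborel A = emeasure (density (distr lborel borel T) (\<lambda>_. ennreal c)) A"
    using T by (simp add: volume_scaling_def)
  then show ?thesis
    using A by (simp add: emeasure_density_const emeasure_distr)
qed

lemma volume_scaling_compose:
  assumes S: "volume_scaling c S" and T: "volume_scaling d T"
  shows "volume_scaling (c * d) (S \<circ> T)"
proof (rule volume_scalingI)
  fix A :: "(real^2) set" assume A: "A \<in> sets borel"
  have "S -` A \<in> sets borel"
    using measurable_sets[OF volume_scaling_measurable[OF S] A] by simp
  then show "emeasure lborel A = ennreal (c * d) * emeasure lborel ((S \<circ> T) -` A)"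
    using S T A
    by (simp add: volume_scaling_emeasure[OF S A] volume_scaling_emeasure[OF T] volume_scaling_def
        ennreal_mult mult.assoc vimage_comp)
qed (use S T in \<open>auto simp: volume_scaling_def intro: continuous_on_compose2 inj_compose\<close>)

text \<open>Change of variables read off the push-forward, with injectivity turning the indicator of
  the image into that of \<open>K\<close>. No derivative occurs, so the shear with its kink on the
  axis is covered together with the affine maps.\<close>

lemma volume_scaling_set_integral:
  fixes f :: "real^2 \<Rightarrow> 'b::{banach, second_countable_topology}"
  assumes T: "volume_scaling c T" and K: "compact K" and f [measurable]: "f \<in> borel_measurable borel"
  shows "(LINT x:T ` K|lborel. f x) = c *\<^sub>R (LINT x:K|lborel. f (T x))"
proof -
  note [measurable] = volume_scaling_measurable[OF T]
  have "compact (T ` K)"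
    using T K by (auto simp: volume_scaling_def intro: compact_continuous_image continuous_on_subset)
  then have [measurable]: "T ` K \<in> sets borel"
    by (rule borel_compact)
  have "(LINT x:T ` K|lborel. f x)
      = (LINT x|density (distr lborel borel T) (\<lambda>_. ennreal c). indicator (T ` K) x *\<^sub>R f x)"
    using T unfolding set_lebesgue_integral_def volume_scaling_def by metis
  also have "\<dots> = c *\<^sub>R (LINT x|lborel. indicator (T ` K) (T x) *\<^sub>R f (T x))"
    using T by (subst integral_density) (auto simp: volume_scaling_def integral_distr simp flip: scaleR_scaleR)
  also have "(\<lambda>x. indicator (T ` K) (T x) :: real) = indicator K"
    using T by (auto simp: volume_scaling_def indicator_def inj_image_mem_iff fun_eq_iff)
  finally show ?thesis
    by (simp add: set_lebesgue_integral_def)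
qed

lemma volume_scaling_compact:
  "volume_scaling c T \<Longrightarrow> compact K \<Longrightarrow> compact (T ` K)"
  by (auto simp: volume_scaling_def intro: compact_continuous_image continuous_on_subset)

lemma volume_scaling_area:
  assumes T: "volume_scaling c T" and K: "compact K"
  shows "area (T ` K) = c * area K"
proof -
  have "emeasure lborel (T ` K) = ennreal c * emeasure lborel (T -` T ` K)"
    using volume_scaling_compact[OF T K] by (intro volume_scaling_emeasure[OF T]) (rule borel_compact)
  also have "T -` T ` K = K"
    using T by (auto simp: volume_scaling_def inj_vimage_image_eq)
  finally show ?thesis
    using T K volume_scaling_compact[OF T K]
    by (simp add: area_compact measure_def enn2real_mult volume_scaling_def)
qed

lemma volume_scaling_centroid:
  assumes T: "volume_scaling c T" and K: "compact K"
  shows "centroid (T ` K) = (1 / area K) *\<^sub>R (LINT x:K|lborel. T x)"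
  using T volume_scaling_compact[OF T K]
  by (simp add: centroid_compact volume_scaling_area[OF T K]
      volume_scaling_set_integral[OF T K] volume_scaling_def)

lemma volume_scaling_moment:
  assumes T: "volume_scaling c T" and K: "compact K" and p: "p \<ge> 1"
  shows "moment p (T ` K) g
    = c\<^sup>2 * (LINT z:K\<times>K|lborel. \<bar>cross2 (T (fst z) - g) (T (snd z) - g)\<bar> powr p)"
proof -
  let ?h = "\<lambda>x y. \<bar>cross2 (x - g) (y - g)\<bar> powr p"
  have TK: "compact (T ` K)" by (rule volume_scaling_compact[OF T K])
  have cT [continuous_intros]: "continuous_on S (\<lambda>z::(real^2)\<times>(real^2). T (f z))"
    if "continuous_on S f" for f S
    using T that by (auto simp: volume_scaling_def intro: continuous_on_compose2)
  have "moment p (T ` K) g = (LINT x:T ` K|lborel. LINT y:T ` K|lborel. ?h x y)"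
    unfolding moment_def using p
    by (subst set_integral_Times[OF TK TK]) (auto intro!: continuous_intros)
  also have "\<dots> = (LINT x:T ` K|lborel. c * (LINT y:K|lborel. ?h x (T y)))"
    using p by (subst volume_scaling_set_integral[OF T K])
      (auto intro!: continuous_intros borel_measurable_continuous_onI)
  also have "\<dots> = c * (LINT x:T ` K|lborel. (LINT y:K|lborel. ?h x (T y)))"
    by simp
  also have "(LINT x:T ` K|lborel. (LINT y:K|lborel. ?h x (T y)))
     = c * (LINT x:K|lborel. (LINT y:K|lborel. ?h (T x) (T y)))"
  proof (subst volume_scaling_set_integral[OF T K])
    have [measurable]: "K \<in> sets borel" using K by (rule borel_compact)
    have "continuous_on UNIV (\<lambda>z. ?h (fst z) (T (snd z)))"
      using p by (intro continuous_intros)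
    then have [measurable]: "(\<lambda>z. ?h (fst z) (T (snd z))) \<in> borel_measurable (lborel \<Otimes>\<^sub>M lborel)"
      unfolding lborel_prod by (simp add: borel_measurable_continuous_onI)
    have "(\<lambda>z. indicator K (snd z) *\<^sub>R ?h (fst z) (T (snd z))) \<in> borel_measurable (lborel \<Otimes>\<^sub>M lborel)"
      by measurable
    then have "(\<lambda>x. LINT y|lborel. indicator K y *\<^sub>R ?h x (T y)) \<in> borel_measurable lborel"
      by (intro lborel.borel_measurable_lebesgue_integral) (simp add: case_prod_unfold)
    then show "(\<lambda>x. LINT y:K|lborel. ?h x (T y)) \<in> borel_measurable borel"
      by (simp add: set_lebesgue_integral_def)
  qed simp
  also have "(LINT x:K|lborel. (LINT y:K|lborel. ?h (T x) (T y)))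
     = (LINT z:K\<times>K|lborel. ?h (T (fst z)) (T (snd z)))"
    using p
    by (subst set_integral_Times[OF K K]) (auto intro!: continuous_intros)
  finally show ?thesis by (simp add: power2_eq_square)
qed

section \<open>Translations and linear maps\<close>

lemma volume_scaling_translation: "volume_scaling 1 ((+) b)"
proof (rule volume_scalingI)
  fix A :: "(real^2) set" assume "A \<in> sets borel"
  then show "emeasure lborel A = ennreal 1 * emeasure lborel ((+) b -` A)"
    by (subst lborel_distr_plus[of b, symmetric]) (simp add: emeasure_distr)
qed (auto intro!: continuous_intros)

lemma cross2_linear:
  assumes "linear A"
  shows "cross2 (A x) (A y) = det (matrix A) * cross2 x y"
proof -
  have "A x = matrix A *v x" "A y = matrix A *v y"
    using assms by (simp_all add: matrix_works)
  then show ?thesis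
    by (simp add: cross2_def det_2 matrix_vector_mult_def sum_2 algebra_simps)
qed

lemma volume_scaling_linear:
  assumes A: "linear A" "inj A"
  shows "volume_scaling \<bar>det (matrix A)\<bar> A"
proof -
  have cA: "continuous_on UNIV A"
    using A(1) by (simp add: linear_continuous_on linear_linear)
  have surj: "surj A"
    using A by (simp add: linear_injective_imp_surjective)
  have d: "\<bar>det (matrix A)\<bar> > 0"
    using A det_nz_iff_inj[OF A(1)] by simp
  have "lborel = density (distr lborel borel A) (\<lambda>_. ennreal \<bar>det (matrix A)\<bar>)"
  proof (rule lborel_eqI)
    have [measurable]: "A \<in> borel_measurable borel"
      using cA by (rule borel_measurable_continuous_onI)
    fix l u :: "real^2" assume le: "\<And>b. b \<in> Basis \<Longrightarrow> l \<bullet> b \<le> u \<bullet> b"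
    let ?B = "A -` box l u"
    have im: "A ` ?B = box l u" using surj by simp
    have "open ?B" using open_vimage[OF open_box cA] .
    moreover have "bounded ?B"
    proof -
      obtain A' where A': "linear A'" "\<And>x. A' (A x) = x"
        using linear_injective_left_inverse[OF A] by (auto simp: fun_eq_iff)
      have "?B \<subseteq> A' ` box l u"
        using A'(2) by (metis image_eqI image_vimage_subset subsetI vimageE)
      then show ?thesis
        using bounded_linear_image[OF bounded_box] A'(1) bounded_subset linear_linear by blast
    qed
    ultimately have B: "?B \<in> lmeasurable" "?B \<in> sets borel"
      by (auto intro: lmeasurable_open)
    have fin: "emeasure lborel ?B < \<infinity>"
      using \<open>bounded ?B\<close> by (rule emeasure_bounded_finite)
    have "(\<Prod>b\<in>Basis. (u - l) \<bullet> b) = measure lborel (box l u)"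
      using le by (simp add: measure_lborel_box_eq)
    also have "\<dots> = measure lebesgue (A ` ?B)" unfolding im by simp
    also have "\<dots> = \<bar>det (matrix A)\<bar> * measure lborel ?B"
      using measure_linear_image[OF A(1) B(1)] B(2) by (simp add: measure_completion del: image_vimage_eq)
    finally show "emeasure (density (distr lborel borel A) (\<lambda>_. ennreal \<bar>det (matrix A)\<bar>)) (box l u)
        = ennreal (\<Prod>b\<in>Basis. (u - l) \<bullet> b)"
      using B(2) emeasure_eq_ennreal_measure[of lborel ?B] fin
      by (simp add: emeasure_density_const emeasure_distr ennreal_mult')
  qed simp
  with d cA A(2) show ?thesis by (simp add: volume_scaling_def)
qed

text \<open>The identity below the first axis and a linear shear above it, in one continuous
  formula. A chord in general position is first moved onto this axis by an affine map.\<close>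

definition shear :: "real \<Rightarrow> real^2 \<Rightarrow> real^2" where
  "shear t x = x + (t * max (x$2) 0) *\<^sub>R axis 1 1"

lemma shear_nth [simp]: "shear t x $ 1 = x$1 + t * max (x$2) 0" "shear t x $ 2 = x$2"
  by (simp_all add: shear_def axis_def)

section \<open>Plane Lebesgue measure by horizontal slices\<close>

lemma vec2_eqI: "x$1 = y$1 \<Longrightarrow> x$2 = y$2 \<Longrightarrow> x = y" for x y :: "real^2"
  by (simp add: vec_eq_iff forall_2)

definition vec2 :: "real \<times> real \<Rightarrow> real^2" where
  "vec2 z = fst z *\<^sub>R axis 1 1 + snd z *\<^sub>R axis 2 1"

lemma vec2_nth [simp]: "vec2 z $ 1 = fst z" "vec2 z $ 2 = snd z"
  by (simp_all add: vec2_def axis_def)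

lemma continuous_on_vec2: "continuous_on S vec2"
  unfolding vec2_def by (intro continuous_intros)

lemma measurable_vec2 [measurable]: "vec2 \<in> borel_measurable (lborel \<Otimes>\<^sub>M lborel)"
  unfolding lborel_prod using borel_measurable_continuous_onI[OF continuous_on_vec2] by simp

lemma prod_Basis_vec2: "(\<Prod>b\<in>Basis. f b) = f (axis (1::2) (1::real)) * f (axis 2 1)"
proof -
  have "Basis = {axis (1::2) 1, axis 2 (1::real)} " "axis (1::2) (1::real) \<noteq> axis 2 1"
    by (auto simp: Basis_vec_def axis_eq_axis UNIV_2)
  then show ?thesis by (subst \<open>Basis = _\<close>) (subst prod.insert; simp)
qed

text \<open>Transfers Fubini from the product type to \<open>real^2\<close>; both measures agree on
  boxes.\<close>

lemma lborel_vec2: "(lborel :: (real^2) measure) = distr (lborel \<Otimes>\<^sub>M lborel) borel vec2"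
proof (rule lborel_eqI)
  fix l u :: "real^2" assume le: "\<And>b. b \<in> Basis \<Longrightarrow> l \<bullet> b \<le> u \<bullet> b"
  have le': "l$1 \<le> u$1" "l$2 \<le> u$2"
    using le[of "axis 1 1"] le[of "axis 2 1"] by (auto simp: inner_axis)
  have "vec2 -` box l u = {l$1<..<u$1} \<times> {l$2<..<u$2}"
    by (auto simp: mem_box_cart forall_2)
  then have "emeasure (distr (lborel \<Otimes>\<^sub>M lborel) borel vec2) (box l u)
     = emeasure (lborel \<Otimes>\<^sub>M lborel) ({l$1<..<u$1} \<times> {l$2<..<u$2})"
    by (subst emeasure_distr) (auto simp: space_pair_measure)
  also have "\<dots> = ennreal ((u$1 - l$1) * (u$2 - l$2))"
    using le' by (simp add: lborel.emeasure_pair_measure_Times ennreal_mult)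
  also have "(u$1 - l$1) * (u$2 - l$2) = (\<Prod>b\<in>Basis. (u - l) \<bullet> b)"
    by (simp add: prod_Basis_vec2 inner_axis)
  finally show "emeasure (distr (lborel \<Otimes>\<^sub>M lborel) borel vec2) (box l u)
     = ennreal (\<Prod>b\<in>Basis. (u - l) \<bullet> b)" .
qed simp

lemma emeasure_vec2_slices:
  assumes "A \<in> sets borel"
  shows "emeasure lborel A = (\<integral>\<^sup>+y. emeasure lborel {x. vec2 (x, y) \<in> A} \<partial>lborel)"
proof -
  have m: "vec2 -` A \<in> sets (lborel \<Otimes>\<^sub>M lborel)"
    using measurable_sets[OF measurable_vec2 assms] by (simp add: space_pair_measure)
  have "emeasure lborel A = emeasure (lborel \<Otimes>\<^sub>M lborel) (vec2 -` A)"
    using assms by (subst lborel_vec2) (simp add: emeasure_distr space_pair_measure)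
  also have "\<dots> = (\<integral>\<^sup>+y. emeasure lborel ((\<lambda>x. (x, y)) -` (vec2 -` A)) \<partial>lborel)"
    by (rule lborel_pair.emeasure_pair_measure_alt2[OF m])
  finally show ?thesis by (simp add: vimage_def)
qed

lemma continuous_on_shear [continuous_intros]:
  "continuous_on S f \<Longrightarrow> continuous_on S (\<lambda>x. shear t (f x))"
  unfolding shear_def by (intro continuous_intros)

text \<open>Cavalieri's principle: at height \<open>y\<close> the map is a translation by
  \<open>t * max y 0\<close>, which preserves the length of the slice.\<close>

lemma volume_scaling_shear: "volume_scaling 1 (shear t)"
proof (rule volume_scalingI)
  show c: "continuous_on UNIV (shear t)" by (intro continuous_intros)
  show "inj (shear t)"
    by (rule injI) (metis add_right_cancel shear_nth vec2_eqI)
  fix A :: "(real^2) set" assume A: "A \<in> sets borel"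
  have A': "shear t -` A \<in> sets borel"
    using measurable_sets[OF borel_measurable_continuous_onI[OF c] A] by simp
  have "emeasure lborel {x. vec2 (x, y) \<in> shear t -` A} = emeasure lborel {x. vec2 (x, y) \<in> A}" for y
  proof -
    have "(\<lambda>x. vec2 (x, y)) \<in> borel_measurable borel"
      unfolding vec2_def by (intro borel_measurable_continuous_onI continuous_intros)
    from measurable_sets[OF this A] have m: "{x. vec2 (x, y) \<in> A} \<in> sets borel"
      by (simp add: vimage_def)
    have "{x. vec2 (x, y) \<in> shear t -` A} = (+) (t * max y 0) -` {x. vec2 (x, y) \<in> A}"
    proof -
      have "shear t (vec2 (x, y)) = vec2 (t * max y 0 + x, y)" for x
        by (rule vec2_eqI) simp_all
      then show ?thesis by auto
    qed
    then show ?thesis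
      using m by (subst (2) lborel_distr_plus[of "t * max y 0", symmetric]) (simp add: emeasure_distr)
  qed
  then show "emeasure lborel A = ennreal 1 * emeasure lborel (shear t -` A)"
    using A A' by (simp add: emeasure_vec2_slices)
qed simp

section \<open>Affine invariance and the centroid of a sheared set\<close>

lemma set_integral_linear:
  fixes A :: "real^2 \<Rightarrow> real^2"
  assumes "linear A" "compact K" "continuous_on K f"
  shows "(LINT x:K|lborel. A (f x)) = A (LINT x:K|lborel. f x)"
proof -
  have "bounded_linear A" using assms(1) by (simp add: linear_linear)
  from integral_bounded_linear[OF this set_integrable_compact[OF assms(2,3), unfolded set_integrable_def]]
  show ?thesis
    using linear_scale[OF assms(1)] by (simp add: set_lebesgue_integral_def)
qed

lemma volume_scaling_affine:
  assumes "linear A" "inj A"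
  shows "volume_scaling \<bar>det (matrix A)\<bar> (\<lambda>x. b + A x)"
  using volume_scaling_compose[OF volume_scaling_translation volume_scaling_linear[OF assms], of b]
  by (simp add: o_def)

lemma centroid_affine:
  assumes A: "linear A" "inj A" and K: "compact K" "area K > 0"
  shows "centroid ((\<lambda>x. b + A x) ` K) = b + A (centroid K)"
proof -
  note T = volume_scaling_affine[OF A, of b]
  have cA: "continuous_on K A"
    using A(1) by (simp add: linear_continuous_on linear_linear)
  have "(LINT x:K|lborel. b + A x) = area K *\<^sub>R b + A (LINT x:K|lborel. x)"
    using K cA set_integral_linear[OF A(1) K(1), of "\<lambda>x. x"]
    by (subst set_integral_add) (auto intro!: set_integrable_compact simp: set_integral_const_compact area_compact)
  then show ?thesis
    unfolding volume_scaling_centroid[OF T K(1)] centroid_compact[OF K(1)]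
    using K(2) by (simp add: scaleR_add_right linear_scale[OF A(1)])
qed

text \<open>With d the absolute determinant, the two integrations give d^2 and the integrand gives
  d^p; the prefactor contributes d^(-2-p) and cancels both.\<close>

lemma E_star_affine:
  assumes A: "linear A" "inj A" and K: "compact K" "area K > 0" and p: "p \<ge> 1"
  shows "E_star p ((\<lambda>x. b + A x) ` K) = E_star p K"
proof -
  let ?d = "\<bar>det (matrix A)\<bar>" and ?T = "\<lambda>x. b + A x"
  note T = volume_scaling_affine[OF A, of b]
  have d: "?d > 0" using T by (simp add: volume_scaling_def)
  have "moment p (?T ` K) (centroid (?T ` K))
      = ?d\<^sup>2 * (LINT z:K\<times>K|lborel. ?d powr p * \<bar>cross2 (fst z - centroid K) (snd z - centroid K)\<bar> powr p)"
    unfolding volume_scaling_moment[OF T K(1) p] centroid_affine[OF A K]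
    by (simp add: linear_diff[OF A(1), symmetric] cross2_linear[OF A(1)] abs_mult powr_mult)
  also have "\<dots> = ?d powr (2 + p) * moment p K (centroid K)"
    using d by (simp add: moment_def powr_add)
  finally have "E_star p (?T ` K) = (?d powr (-2 - p) * ?d powr (2 + p)) * E_star p K"
    using d K volume_scaling_compact[OF T K(1)] p
    by (simp add: E_star_compact volume_scaling_area[OF T K(1)] powr_mult)
  also have "?d powr (-2 - p) * ?d powr (2 + p) = 1"
    using d by (simp flip: powr_add)
  finally show ?thesis by simp
qed

lemma shear_centroid:
  assumes K: "compact K" "area K > 0"
  shows "centroid (shear t ` K)
    = centroid K + (t * ((LINT x:K|lborel. max (x$2) 0) / area K)) *\<^sub>R axis 1 1"
proof -
  have "(LINT x:K|lborel. shear t x)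
      = (LINT x:K|lborel. x) + (LINT x:K|lborel. (t * max (x$2) 0) *\<^sub>R axis 1 1)"
    unfolding shear_def using K(1)
    by (intro set_integral_add set_integrable_compact continuous_intros)
  also have "(LINT x:K|lborel. (t * max (x$2) 0) *\<^sub>R axis 1 1)
      = (t * (LINT x:K|lborel. max (x$2) 0)) *\<^sub>R (axis 1 1 :: real^2)"
  proof -
    have "integrable lborel (\<lambda>x::real^2. indicator K x * (t * max (x$2) 0))"
      using set_integrable_compact[OF K(1), of "\<lambda>x. t * max (x$2) 0"]
      by (simp add: set_integrable_def continuous_intros)
    from integral_scaleR_left[OF this, of "axis 1 1 :: real^2"] show ?thesis
      by (simp add: set_lebesgue_integral_def mult.left_commute)
  qed
  finally show ?thesis
    unfolding volume_scaling_centroid[OF volume_scaling_shear K(1)] centroid_compact[OF K(1)]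
    by (simp add: scaleR_add_right)
qed

section \<open>Convexity along shears\<close>

text \<open>The determinant of two sheared points relative to the sheared centroid is
  \<open>shear_base + t * shear_slope\<close>; the slope depends only on the second coordinates of the points.\<close>

definition shear_const :: "(real^2) set \<Rightarrow> real" where
  "shear_const K = (LINT x:K|lborel. max (x$2) 0) / area K"

definition shear_slope :: "(real^2) set \<Rightarrow> (real^2) \<times> (real^2) \<Rightarrow> real" where
  "shear_slope K z = (max (fst z$2) 0 - shear_const K) * (snd z$2 - centroid K$2)
     - (max (snd z$2) 0 - shear_const K) * (fst z$2 - centroid K$2)"

definition shear_base :: "(real^2) set \<Rightarrow> (real^2) \<times> (real^2) \<Rightarrow> real" where
  "shear_base K z = cross2 (fst z - centroid K) (snd z - centroid K)"

definition shear_moment :: "real \<Rightarrow> (real^2) set \<Rightarrow> real \<Rightarrow> real" where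
  "shear_moment p K t = (LINT z:K\<times>K|lborel. \<bar>shear_base K z + t * shear_slope K z\<bar> powr p)"

lemma continuous_on_shear_base [continuous_intros]:
  "continuous_on S (shear_base K)"
  unfolding shear_base_def by (intro continuous_intros)

lemma continuous_on_shear_slope [continuous_intros]:
  "continuous_on S (shear_slope K)"
  unfolding shear_slope_def by (intro continuous_intros)

text \<open>There is no term of order t^2: the displacements of both points and of the centroid are
  all parallel to \<open>axis 1 1\<close>, so their mutual determinants vanish.\<close>

lemma moment_shear:
  assumes K: "compact K" "area K > 0" and p: "p \<ge> 1"
  shows "moment p (shear t ` K) (centroid (shear t ` K)) = shear_moment p K t"
proof -
  have "cross2 (shear t x - centroid (shear t ` K)) (shear t y - centroid (shear t ` K))
      = shear_base K (x, y) + t * shear_slope K (x, y)" for x y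
    unfolding shear_centroid[OF K] shear_base_def shear_slope_def cross2_def
    by (simp add: axis_def shear_const_def algebra_simps)
  then show ?thesis
    unfolding volume_scaling_moment[OF volume_scaling_shear K(1) p] shear_moment_def
    by simp
qed

lemma area_shear: "compact K \<Longrightarrow> area (shear t ` K) = area K"
  using volume_scaling_area[OF volume_scaling_shear] by simp

lemma compact_shear: "compact K \<Longrightarrow> compact (shear t ` K)"
  by (rule volume_scaling_compact[OF volume_scaling_shear])

lemma E_star_shear:
  assumes K: "compact K" "area K > 0" and p: "p \<ge> 1"
  shows "E_star p (shear t ` K) = area K powr (-2 - p) * 2 powr (-p) * shear_moment p K t"
  using assms by (simp add: E_star_compact compact_shear moment_shear area_shear)

lemma shear_0 [simp]: "shear 0 = id"
  by (simp add: shear_def fun_eq_iff)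

lemma set_integrable_shear_moment:
  assumes "compact K" and p: "p \<ge> 1"
  shows "set_integrable lborel (K\<times>K) (\<lambda>z. \<bar>shear_base K z + t * shear_slope K z\<bar> powr p)"
  using assms by (intro set_integrable_compact compact_Times continuous_intros)

lemma convex_on_shear_moment:
  assumes K: "compact K" and p: "p \<ge> 1"
  shows "convex_on UNIV (shear_moment p K)"
proof (intro convex_onI)
  fix u s t :: real assume u: "0 < u" "u < 1"
  let ?f = "\<lambda>t z. \<bar>shear_base K z + t * shear_slope K z\<bar> powr p"
  note int = set_integrable_shear_moment[OF K p]
  have "shear_moment p K ((1 - u) *\<^sub>R s + u *\<^sub>R t)
      \<le> (LINT z:K\<times>K|lborel. (1 - u) * ?f s z + u * ?f t z)"
    unfolding shear_moment_def
  proof (rule set_integral_mono)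
    fix z
    have "shear_base K z + ((1 - u) *\<^sub>R s + u *\<^sub>R t) * shear_slope K z
      = (1 - u) *\<^sub>R (shear_base K z + s * shear_slope K z) + u *\<^sub>R (shear_base K z + t * shear_slope K z)"
      by (simp add: algebra_simps)
    then show "?f ((1 - u) *\<^sub>R s + u *\<^sub>R t) z \<le> (1 - u) * ?f s z + u * ?f t z"
      using convex_onD[OF convex_on_abs_powr[OF p], of u] u by simp
  qed (use int in \<open>auto intro!: set_integral_add\<close>)
  also have "\<dots> = (1 - u) * shear_moment p K s + u * shear_moment p K t"
    unfolding shear_moment_def using int by (subst set_integral_add) auto
  finally show "shear_moment p K ((1 - u) *\<^sub>R s + u *\<^sub>R t)
     \<le> (1 - u) * shear_moment p K s + u * shear_moment p K t" .
qed auto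

lemma E_star_shear_le_max:
  assumes K: "compact K" "area K > 0" and p: "p \<ge> 1" and t: "s \<le> 0" "0 \<le> t"
  shows "E_star p K \<le> max (E_star p (shear s ` K)) (E_star p (shear t ` K))"
proof -
  have "shear_moment p K 0 \<le> max (shear_moment p K s) (shear_moment p K t)"
  proof (cases "s = t")
    case False
    define u where "u = - s / (t - s)"
    have u: "0 \<le> u" "u \<le> 1" "(1 - u) *\<^sub>R s + u *\<^sub>R t = 0"
      using t False by (auto simp: u_def field_simps)
    have "shear_moment p K 0 \<le> (1 - u) * shear_moment p K s + u * shear_moment p K t"
      using convex_onD[OF convex_on_shear_moment[OF K(1) p] u(1,2), of s t] u(3) by simp
    also have "\<dots> \<le> max (shear_moment p K s) (shear_moment p K t)"
      using u by (intro convex_bound_le) auto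
    finally show ?thesis .
  qed (use t in auto)
  moreover have "E_star p K = area K powr (-2 - p) * 2 powr (-p) * shear_moment p K 0"
    using E_star_shear[OF K p, of 0] by simp
  ultimately show ?thesis
    unfolding E_star_shear[OF K p] by (auto simp: le_max_iff_disj intro!: mult_left_mono)
qed

section \<open>Polygons\<close>

text \<open>The two inequalities say that the segment from \<open>u\<close> to \<open>d\<close> crosses the horizontal axis between
  \<open>0\<close> and \<open>axis 1 1\<close>, cleared of the denominator \<open>u$2 - d$2\<close>.\<close>

lemma convex_glue:
  fixes U D :: "(real^2) set"
  assumes U: "convex U" "0 \<in> U" "axis 1 1 \<in> U" "\<And>u. u \<in> U \<Longrightarrow> u$2 \<ge> 0"
    and D: "convex D" "0 \<in> D" "axis 1 1 \<in> D" "\<And>d. d \<in> D \<Longrightarrow> d$2 \<le> 0"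
    and "\<exists>u\<in>U. u$2 > 0" "\<exists>d\<in>D. d$2 < 0"
    and l: "\<And>u d. u \<in> U \<Longrightarrow> d \<in> D \<Longrightarrow> 0 \<le> u$1 * (- d$2) + d$1 * u$2"
    and r: "\<And>u d. u \<in> U \<Longrightarrow> d \<in> D \<Longrightarrow> (u$1 - 1) * (- d$2) + (d$1 - 1) * u$2 \<le> 0"
  shows "convex (U \<union> D)"
proof -
  have seg: "x \<in> U \<inter> D" if "x$2 = 0" "0 \<le> x$1" "x$1 \<le> 1" for x
  proof -
    have "x = (1 - x$1) *\<^sub>R 0 + (x$1) *\<^sub>R axis 1 1"
      using that by (intro vec2_eqI) (auto simp: axis_def)
    then show ?thesis
      using convexD_alt[OF U(1-3), of "x$1"] convexD_alt[OF D(1-3), of "x$1"] that by auto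
  qed
  \<comment> \<open>Points strictly on either side. Testing \<open>l\<close> and \<open>r\<close>
    against them confines the points of \<open>U\<close> and \<open>D\<close> on the axis to the
    unit segment.\<close>
  obtain u0 d0 where u0: "u0 \<in> U" "u0$2 > 0" and d0: "d0 \<in> D" "d0$2 < 0"
    using assms by blast
  have key: "(1 - s) *\<^sub>R x + s *\<^sub>R y \<in> U \<union> D"
    if x: "x \<in> U" and y: "y \<in> D" and s: "0 \<le> s" "s \<le> 1" for x y s
  proof -
    define h k where "h = x$2" and "k = - y$2"
    have hk: "h \<ge> 0" "k \<ge> 0" using U(4)[OF x] D(4)[OF y] by (auto simp: h_def k_def)
    show ?thesis
    proof (cases "h + k = 0")
      case True
      then have z: "h = 0" "k = 0" using hk by auto
      have "0 \<le> x$1" "x$1 \<le> 1" "0 \<le> y$1" "y$1 \<le> 1"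
        using l[OF x d0(1)] r[OF x d0(1)] l[OF u0(1) y] r[OF u0(1) y] z u0(2) d0(2)
        by (auto simp: h_def k_def zero_le_mult_iff mult_le_0_iff)
      then have "x \<in> U" "y \<in> U"
        using seg[of x] seg[of y] z by (auto simp: h_def k_def)
      then show ?thesis using convexD_alt[OF U(1)] s by auto
    next
      case False
      then have hk0: "h + k > 0" using hk by simp
      \<comment> \<open>The point where the segment from \<open>x\<close> to \<open>y\<close>
        crosses the axis; it lies in both sets, and the segment splits there into a part inside
        \<open>U\<close> and a part inside \<open>D\<close>.\<close>
      define c where "c = (1 / (h + k)) *\<^sub>R (k *\<^sub>R x + h *\<^sub>R y)"
      have "0 \<le> k * x$1 + h * y$1" "k * x$1 + h * y$1 \<le> h + k"
        using l[OF x y] r[OF x y] by (simp_all add: h_def k_def algebra_simps)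
      then have "c$2 = 0" "0 \<le> c$1" "c$1 \<le> 1"
        using hk0 by (auto simp: c_def h_def k_def divide_simps)
      then have c: "c \<in> U" "c \<in> D" using seg by auto
      show ?thesis
      \<comment> \<open>This compares the height \<open>(1 - s) * h - s * k\<close> of the given
        point with 0. In either case \<open>m\<close> is its position along the half segment ending
        at \<open>c\<close>.\<close>
      proof (cases "s * k \<le> (1 - s) * h")
        case True
        show ?thesis
        proof (cases "h = 0")
          case True
          with \<open>s * k \<le> (1 - s) * h\<close> hk hk0 s have "s = 0"
            by (simp add: mult_le_0_iff)
          then show ?thesis using x by simp
        next
          case False
          with hk have h: "h > 0" by simp
          define m where "m = s * (h + k) / h"
          have m: "0 \<le> m" "m \<le> 1"
            using True h hk s by (auto simp: m_def field_simps)
          have "(1 - s) *\<^sub>R x + s *\<^sub>R y = (1 - m) *\<^sub>R x + m *\<^sub>R c"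
            using h hk0 by (intro vec2_eqI) (auto simp: m_def c_def divide_simps, auto simp: algebra_simps)
          then show ?thesis using convexD_alt[OF U(1) x c(1) m] by simp
        qed
      next
        case False
        then have k: "k > 0"
        proof -
          have "s * k > 0" using False s hk by (metis diff_ge_0_iff_ge linorder_not_le mult_nonneg_nonneg order_le_less_trans)
          then show ?thesis using s by (simp add: zero_less_mult_iff)
        qed
        define m where "m = (1 - s) * (h + k) / k"
        have m: "0 \<le> m" "m \<le> 1"
          using False k hk s mult_right_mono[of s 1 "h + k"] by (auto simp: m_def field_simps)
        have "(1 - s) *\<^sub>R x + s *\<^sub>R y = (1 - m) *\<^sub>R y + m *\<^sub>R c"
          using k hk0 by (intro vec2_eqI) (auto simp: m_def c_def divide_simps, auto simp: algebra_simps)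
        then show ?thesis using convexD_alt[OF D(1) y c(2) m] by simp
      qed
    qed
  qed
  show ?thesis
    unfolding convex_alt
  proof (intro ballI allI impI)
    fix x y and s :: real assume xy: "x \<in> U \<union> D" "y \<in> U \<union> D" and s: "0 \<le> s \<and> s \<le> 1"
    consider "x \<in> U" "y \<in> U" | "x \<in> D" "y \<in> D" | "x \<in> U" "y \<in> D" | "x \<in> D" "y \<in> U"
      using xy by auto
    then show "(1 - s) *\<^sub>R x + s *\<^sub>R y \<in> U \<union> D"
    proof cases
      case 1 then show ?thesis using convexD_alt[OF U(1)] s by auto
    next
      case 2 then show ?thesis using convexD_alt[OF D(1)] s by auto
    next
      case 3 then show ?thesis using key s by auto
    next
      case 4 then show ?thesis using key[of y x "1 - s"] s by (auto simp: add.commute)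
    qed
  qed
qed

section \<open>Hulls split along the chord, and their shears\<close>

lemma linear_halfplane_convex:
  "convex {x::real^2. 0 \<le> a * x$1 + b * x$2 + c}"
proof -
  have "{x::real^2. 0 \<le> a * x$1 + b * x$2 + c} = {x. vec2 (a, b) \<bullet> x \<ge> - c}"
    by (auto simp: inner_vec_def sum_2)
  then show ?thesis by (simp add: convex_halfspace_ge)
qed

lemma hull_halfplane:
  fixes S :: "(real^2) set"
  assumes "\<And>x. x \<in> S \<Longrightarrow> 0 \<le> a * x$1 + b * x$2 + c" "x \<in> convex hull S"
  shows "0 \<le> a * x$1 + b * x$2 + c"
proof -
  have "convex hull S \<subseteq> {x. 0 \<le> a * x$1 + b * x$2 + c}"
    using assms(1) by (intro hull_minimal linear_halfplane_convex) auto
  with assms(2) show ?thesis by auto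
qed

text \<open>Each crossing condition is affine in \<open>u\<close> for fixed \<open>d\<close> and
  vice versa, so it passes from the generators to the hulls one variable at a time; then
  \<open>convex_glue\<close> applies.\<close>

lemma convex_hull_glue:
  fixes U D :: "(real^2) set"
  assumes U: "0 \<in> U" "axis 1 1 \<in> U" "\<And>u. u \<in> U \<Longrightarrow> u$2 \<ge> 0"
    and D: "0 \<in> D" "axis 1 1 \<in> D" "\<And>d. d \<in> D \<Longrightarrow> d$2 \<le> 0"
    and s: "\<exists>u\<in>U. u$2 > 0" "\<exists>d\<in>D. d$2 < 0"
    and l: "\<And>u d. u \<in> U \<Longrightarrow> d \<in> D \<Longrightarrow> 0 \<le> u$1 * (- d$2) + d$1 * u$2"
    and r: "\<And>u d. u \<in> U \<Longrightarrow> d \<in> D \<Longrightarrow> (u$1 - 1) * (- d$2) + (d$1 - 1) * u$2 \<le> 0"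
  shows "convex hull (U \<union> D) = convex hull U \<union> convex hull D"
proof -
  have l1: "0 \<le> u$1 * (- d$2) + d$1 * u$2" if "u \<in> convex hull U" "d \<in> D" for u d
    using hull_halfplane[of U "- d$2" "d$1" 0 u] l[OF _ that(2)] that(1) by (simp add: algebra_simps)
  have l2: "0 \<le> u$1 * (- d$2) + d$1 * u$2" if "u \<in> convex hull U" "d \<in> convex hull D" for u d
    using hull_halfplane[of D "u$2" "- u$1" 0 d] l1[OF that(1)] that(2) by (simp add: algebra_simps)
  have r1: "(u$1 - 1) * (- d$2) + (d$1 - 1) * u$2 \<le> 0" if "u \<in> convex hull U" "d \<in> D" for u d
    using hull_halfplane[of U "d$2" "1 - d$1" "- d$2" u] r[OF _ that(2)] that(1) by (simp add: algebra_simps)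
  have r2: "(u$1 - 1) * (- d$2) + (d$1 - 1) * u$2 \<le> 0" if "u \<in> convex hull U" "d \<in> convex hull D" for u d
    using hull_halfplane[of D "- u$2" "u$1 - 1" "u$2" d] r1[OF that(1)] that(2) by (simp add: algebra_simps)
  have "convex (convex hull U \<union> convex hull D)"
  proof (rule convex_glue)
    show "u$2 \<ge> 0" if "u \<in> convex hull U" for u
      using hull_halfplane[of U 0 1 0 u] U(3) that by simp
    show "d$2 \<le> 0" if "d \<in> convex hull D" for d
      using hull_halfplane[of D 0 "-1" 0 d] D(3) that by simp
  qed (use U D s l2 r2 in \<open>auto intro: hull_inc\<close>)
  then have "convex hull (U \<union> D) \<subseteq> convex hull U \<union> convex hull D"
    by (intro hull_minimal) (auto intro: hull_inc)
  then show ?thesis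
    by (auto intro: hull_mono[THEN subsetD, rotated])
qed

lemma shear_lower: "x$2 \<le> 0 \<Longrightarrow> shear t x = x"
  by (simp add: shear_def)

lemma shear_image_lower: "(\<And>x. x \<in> D \<Longrightarrow> x$2 \<le> 0) \<Longrightarrow> shear t ` D = D"
  by (force simp: shear_lower)

lemma shear_image_hull_upper:
  assumes "\<And>x. x \<in> U \<Longrightarrow> x$2 \<ge> 0"
  shows "shear t ` (convex hull U) = convex hull (shear t ` U)"
proof -
  define B where "B = (\<lambda>x::real^2. x + (t * x$2) *\<^sub>R axis 1 1)"
  have B: "linear B"
    by (intro linearI) (auto simp: B_def algebra_simps)
  have eq: "shear t x = B x" if "x$2 \<ge> 0" for x
    using that by (simp add: B_def shear_def)
  have "shear t x = B x" if "x \<in> convex hull U" for x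
    using hull_halfplane[of U 0 1 0 x] assms that by (auto intro: eq)
  then have "shear t ` (convex hull U) = B ` (convex hull U)" by (rule image_cong[OF refl])
  also have "\<dots> = convex hull (B ` U)"
    using B by (simp add: convex_hull_linear_image)
  also have "B ` U = shear t ` U"
    using assms by (intro image_cong) (auto simp: eq)
  finally show ?thesis .
qed

text \<open>The shear is linear on each half-plane only, so it commutes with hulls once both the
  hull before (\<open>r = 0\<close>) and the hull after (\<open>r = t\<close>) split along the
  chord.\<close>

lemma shear_image_hull:
  fixes S :: "(real^2) set"
  assumes S: "0 \<in> S" "axis 1 1 \<in> S" and s: "\<exists>u\<in>S. u$2 > 0" "\<exists>d\<in>S. d$2 < 0"
    and lr: "\<And>u d r. u \<in> S \<Longrightarrow> d \<in> S \<Longrightarrow> u$2 \<ge> 0 \<Longrightarrow> d$2 \<le> 0 \<Longrightarrow> r = 0 \<or> r = t \<Longrightarrow>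
         0 \<le> (u$1 + r * u$2) * (- d$2) + d$1 * u$2 \<and> (u$1 + r * u$2 - 1) * (- d$2) + (d$1 - 1) * u$2 \<le> 0"
  shows "shear t ` (convex hull S) = convex hull (shear t ` S)"
proof -
  define U D where "U = {x\<in>S. x$2 \<ge> 0}" and "D = {x\<in>S. x$2 \<le> 0}"
  have UD: "U \<union> D = S" by (auto simp: U_def D_def)
  have *: "convex hull (shear r ` U \<union> D) = convex hull (shear r ` U) \<union> convex hull D"
    if r: "r = 0 \<or> r = t" for r
  proof (rule convex_hull_glue)
    have "shear r 0 = 0" "shear r (axis 1 1) = axis 1 1" "0 \<in> U" "axis 1 1 \<in> U"
      using S by (simp_all add: shear_lower axis_def U_def)
    then show "0 \<in> shear r ` U" "axis 1 1 \<in> shear r ` U"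
      by (metis image_eqI)+
    show "0 \<le> u$1 * (- d$2) + d$1 * u$2" "(u$1 - 1) * (- d$2) + (d$1 - 1) * u$2 \<le> 0"
      if "u \<in> shear r ` U" "d \<in> D" for u d
      using that lr[OF _ _ _ _ r] by (auto simp: U_def D_def)
  qed (use S s in \<open>auto simp: U_def D_def axis_def\<close>)
  have "convex hull S = convex hull U \<union> convex hull D"
    using *[of 0] unfolding UD[symmetric] by simp
  moreover have "shear t ` (convex hull U) = convex hull (shear t ` U)"
    by (rule shear_image_hull_upper) (simp add: U_def)
  moreover have "shear t ` (convex hull D) = convex hull D"
    using hull_halfplane[of D 0 "-1" 0] by (intro shear_image_lower) (auto simp: D_def)
  ultimately have "shear t ` (convex hull S) = convex hull (shear t ` U) \<union> convex hull D"
    by (simp only: image_Un)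
  also have "\<dots> = convex hull (shear t ` U \<union> D)" using *[of t] by simp
  also have "shear t ` U \<union> D = shear t ` S"
  proof -
    have "shear t ` D = D" by (rule shear_image_lower) (simp add: D_def)
    then show ?thesis unfolding UD[symmetric] image_Un by simp
  qed
  finally show ?thesis .
qed

text \<open>A Radon partition of four points in convex position must be two against two, since a
  singleton part would lie in the hull of the others. The common point \<open>q\<close> of the two
  hulls is then the crossing of the diagonals.\<close>

lemma quadrilateral_diagonal:
  fixes Y :: "(real^2) set"
  assumes Y: "card Y = 4" and ind: "\<And>y. y \<in> Y \<Longrightarrow> y \<notin> convex hull (Y - {y})"
  obtains a b c d where "a \<in> Y" "b \<in> Y" "c \<in> Y" "d \<in> Y" "a \<noteq> c"
    "cross2 (c - a) (b - a) > 0" "cross2 (c - a) (d - a) < 0"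
proof -
  have fin: "finite Y" using Y by (simp add: card_ge_0_finite)
  have "affine_dependent Y"
    by (rule affine_dependent_biggerset[OF fin]) (simp add: Y)
  then obtain M P where MP: "M \<subseteq> Y" "P \<subseteq> Y" "M \<inter> P = {}" "convex hull M \<inter> convex hull P \<noteq> {}"
    by (rule Radon)
  then obtain q where q: "q \<in> convex hull M" "q \<in> convex hull P" by auto
  have large: "card N \<ge> 2"
    if N: "N \<subseteq> Y" "N' \<subseteq> Y" "N \<inter> N' = {}" "q \<in> convex hull N" "q \<in> convex hull N'" for N N'
  proof (rule ccontr)
    assume "\<not> 2 \<le> card N"
    moreover have "N \<noteq> {}" "finite N" using N fin by (auto intro: finite_subset)
    moreover from this have "card N \<noteq> 0" by simp
    ultimately have "card N = 1" by linarith
    then obtain m where "N = {m}" by (auto simp: card_1_singleton_iff)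
    with N have "m \<in> Y" "m \<in> convex hull N'" "N' \<subseteq> Y - {m}" by auto
    then show False using ind[of m] hull_mono[of N' "Y - {m}"] by auto
  qed
  have "card M + card P \<le> 4"
    using MP fin Y card_mono[of Y "M \<union> P"] by (metis Un_least card_Un_disjoint finite_subset)
  moreover have "card M \<ge> 2" by (rule large[of M P]) (use MP q in auto)
  moreover have "card P \<ge> 2" by (rule large[of P M]) (use MP q in auto)
  ultimately have "card M = 2" "card P = 2" by linarith+
  then obtain a c b d where M: "M = {a, c}" "a \<noteq> c" and P: "P = {b, d}" "b \<noteq> d"
    by (metis card_2_iff)
  have in_hull: "z \<notin> convex hull {x, y}" if "z \<in> Y" "x \<in> Y" "y \<in> Y" "z \<noteq> x" "z \<noteq> y" for x y z
    using ind[OF that(1)] hull_mono[of "{x, y}" "Y - {z}"] that by auto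
  have ne: "a \<noteq> b" "a \<noteq> d" "c \<noteq> b" "c \<noteq> d" using MP M P by auto
  have Yabcd: "a \<in> Y" "b \<in> Y" "c \<in> Y" "d \<in> Y" using MP M P by auto
  obtain s where s: "0 \<le> s" "s \<le> 1" "q = (1 - s) *\<^sub>R a + s *\<^sub>R c"
    using q M by (auto simp: segment_convex_hull[symmetric] in_segment)
  obtain r where r: "0 \<le> r" "r \<le> 1" "q = (1 - r) *\<^sub>R b + r *\<^sub>R d"
    using q P by (auto simp: segment_convex_hull[symmetric] in_segment)
  have qn: "q \<noteq> a" "q \<noteq> c" "q \<noteq> b" "q \<noteq> d"
    using in_hull Yabcd ne q unfolding M P by metis+
  then have s': "0 < s" "s < 1" and r': "0 < r" "r < 1"
    using s r by (auto simp: less_le)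
  define B D where "B = cross2 (c - a) (b - a)" and "D = cross2 (c - a) (d - a)"
  have BD: "(1 - r) * B + r * D = 0"
  proof -
    have "(1 - r) * B + r * D = cross2 (c - a) (q - a)"
      unfolding B_def D_def r(3) by (simp add: cross2_def algebra_simps)
    also have "\<dots> = 0" unfolding s(3) by (simp add: cross2_def algebra_simps)
    finally show ?thesis .
  qed
  \<comment> \<open>Otherwise all four points are collinear, with \<open>a\<close>, \<open>c\<close>
    at 0, 1 and \<open>b\<close>, \<open>d\<close> at \<open>kb\<close>, \<open>kd\<close> outside
    [0,1]. Since the average \<open>s\<close> of \<open>kb\<close> and \<open>kd\<close> is in
    [0,1], they lie on opposite sides, which puts \<open>a\<close> between \<open>b\<close> and
    \<open>d\<close>.\<close>
  have "B \<noteq> 0"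
  proof
    assume B: "B = 0"
    with BD r' have D: "D = 0" by simp
    have coll: "\<exists>k. z = a + k *\<^sub>R (c - a)" if "cross2 (c - a) (z - a) = 0" for z
    proof -
      define v where "v = c - a"
      have v: "v \<bullet> v > 0" using M by (simp add: v_def)
      have "z - a = ((z - a) \<bullet> v / (v \<bullet> v)) *\<^sub>R v"
      proof (rule vec2_eqI)
        have c: "v$1 * (z - a)$2 = v$2 * (z - a)$1"
          using that by (simp add: v_def cross2_def)
        have "(v \<bullet> v) * (z - a)$1 - ((z - a) \<bullet> v) * v$1 = - v$2 * (v$1 * (z - a)$2 - v$2 * (z - a)$1)"
          "(v \<bullet> v) * (z - a)$2 - ((z - a) \<bullet> v) * v$2 = v$1 * (v$1 * (z - a)$2 - v$2 * (z - a)$1)"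
          unfolding inner_vec_def sum_2 by (simp_all add: algebra_simps)
        then have "(v \<bullet> v) * (z - a)$1 = ((z - a) \<bullet> v) * v$1" "(v \<bullet> v) * (z - a)$2 = ((z - a) \<bullet> v) * v$2"
          unfolding c by simp_all
        then show "(z - a)$1 = (((z - a) \<bullet> v / (v \<bullet> v)) *\<^sub>R v)$1"
          "(z - a)$2 = (((z - a) \<bullet> v / (v \<bullet> v)) *\<^sub>R v)$2"
          using v by (simp_all add: field_simps)
      qed
      then show ?thesis unfolding v_def by (metis add_diff_cancel_left' diff_add_cancel add.commute)
    qed
    obtain kb kd where kb: "b = a + kb *\<^sub>R (c - a)" and kd: "d = a + kd *\<^sub>R (c - a)"
      using coll B D unfolding B_def D_def by metis
    have out: "k < 0 \<or> k > 1" if "z = a + k *\<^sub>R (c - a)" "z \<in> Y" "z \<noteq> a" "z \<noteq> c" for z k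
    proof (rule ccontr)
      assume "\<not> ?thesis"
      then have "z \<in> convex hull {a, c}"
        unfolding segment_convex_hull[symmetric] in_segment using that(1)
        by (intro exI[of _ k]) (auto simp: algebra_simps)
      then show False using in_hull that Yabcd by metis
    qed
    have sk: "s = (1 - r) * kb + r * kd"
    proof -
      have "s *\<^sub>R (c - a) = ((1 - r) * kb + r * kd) *\<^sub>R (c - a)"
        using s(3) r(3) unfolding kb kd by (simp add: algebra_simps)
      then show ?thesis using M(2) by simp
    qed
    have "kb < 0 \<and> kd > 1 \<or> kd < 0 \<and> kb > 1"
    proof -
      have "s < 0" if "kb < 0" "kd < 0"
        unfolding sk using that r' by (intro add_neg_neg mult_pos_neg) auto
      moreover have "1 < s" if "kb > 1" "kd > 1"
      proof -
        have "(1 - r) * 1 + r * 1 < (1 - r) * kb + r * kd"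
          using that r' by (intro add_strict_mono mult_strict_left_mono) auto
        then show ?thesis using sk by simp
      qed
      moreover have "\<not> s < 0" "\<not> 1 < s" using s by auto
      ultimately show ?thesis using out[OF kb] out[OF kd] Yabcd ne by metis
    qed
    then have kk: "(kb < 0 \<or> kd < 0) \<and> (kb > 0 \<or> kd > 0) \<and> kb * kd < 0"
      by (auto simp: mult_less_0_iff)
    define m where "m = kb / (kb - kd)"
    have "0 \<le> m" "m \<le> 1"
      using kk by (auto simp: m_def divide_simps mult_less_0_iff)
    moreover have "a = (1 - m) *\<^sub>R b + m *\<^sub>R d"
    proof -
      have "(1 - m) * kb + m * kd = 0"
        using kk by (auto simp: m_def divide_simps mult_less_0_iff)
      moreover have "(1 - m) *\<^sub>R b + m *\<^sub>R d = a + ((1 - m) * kb + m * kd) *\<^sub>R (c - a)"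
        unfolding kb kd by (simp add: algebra_simps)
      ultimately show ?thesis by simp
    qed
    ultimately have "a \<in> convex hull {b, d}"
      unfolding segment_convex_hull[symmetric] in_segment by auto
    then show False using in_hull ne Yabcd by metis
  qed
  then consider "B > 0" "D < 0" | "B < 0" "D > 0"
    using BD r' by (smt (verit) mult_pos_pos mult_neg_pos mult_pos_neg mult_eq_0_iff)
  then show thesis
  proof cases
    case 1
    then show thesis
      unfolding B_def D_def by (rule that[OF Yabcd M(2)])
  next
    case 2
    show thesis
      by (rule that[OF Yabcd(1,4,3,2) M(2) 2(2)[unfolded D_def] 2(1)[unfolded B_def]])
  qed
qed

text \<open>The coordinates are the projection onto \<open>c - a\<close>, scaled to length 1, and
  the determinant with \<open>c - a\<close>. The latter is left unscaled, so that the signs given by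
  \<open>quadrilateral_diagonal\<close> are directly signs of second coordinates.\<close>

lemma normalise_segment:
  fixes a c :: "real^2"
  assumes "a \<noteq> c"
  obtains A :: "real^2 \<Rightarrow> real^2" and b where "linear A" "inj A" "b + A a = 0" "b + A c = axis 1 1"
    "\<And>x. (b + A x)$2 = cross2 (c - a) (x - a)"
proof -
  define v where "v = c - a"
  define A where "A = (\<lambda>x. vec2 ((v \<bullet> x) / (v \<bullet> v), cross2 v x))"
  have v: "v \<bullet> v \<noteq> 0" using assms by (simp add: v_def)
  have A: "linear A"
    by (intro linearI vec2_eqI) (auto simp: A_def inner_add_right add_divide_distrib cross2_def algebra_simps)
  have "inj A"
  proof (subst linear_injective_0[OF A], intro allI impI)
    fix x assume "A x = 0"
    then have "(A x)$1 = 0" "(A x)$2 = 0" by simp_all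
    then have "v \<bullet> x = 0" and "v$1 * x$2 - v$2 * x$1 = 0"
      using v by (simp_all add: A_def cross2_def)
    then have 1: "v$1 * x$1 + v$2 * x$2 = 0" and 2: "v$1 * x$2 - v$2 * x$1 = 0"
      by (simp_all add: inner_vec_def sum_2)
    have "(v \<bullet> v) * x$1 = v$1 * (v$1 * x$1 + v$2 * x$2) - v$2 * (v$1 * x$2 - v$2 * x$1)"
      "(v \<bullet> v) * x$2 = v$2 * (v$1 * x$1 + v$2 * x$2) + v$1 * (v$1 * x$2 - v$2 * x$1)"
      unfolding inner_vec_def sum_2 by (simp_all add: algebra_simps)
    then have "(v \<bullet> v) * x$1 = 0" "(v \<bullet> v) * x$2 = 0"
      unfolding 1 2 by simp_all
    then show "x = 0" using v by (intro vec2_eqI) auto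
  qed
  moreover have d: "- A a + A x = A (x - a)" for x
    using linear_diff[OF A] by simp
  moreover have "A (c - a) = axis 1 1"
    using v unfolding v_def[symmetric] by (intro vec2_eqI) (auto simp: A_def axis_def cross2_def)
  ultimately show thesis
    using A by (intro that[of A "- A a"]) (auto simp: A_def v_def)
qed

section \<open>Triangles in standard position\<close>

lemma area_pos_iff_interior:
  assumes "compact K" "convex K"
  shows "area K > 0 \<longleftrightarrow> interior K \<noteq> {}"
proof
  assume "area K > 0"
  then show "interior K \<noteq> {}"
    using negligible_convex_interior[OF assms(2)] negligible_imp_measure0[of K] by (auto simp: area_def)
next
  assume "interior K \<noteq> {}"
  then have "\<not> negligible K"
    using negligible_convex_interior[OF assms(2)] by simp
  then show "area K > 0"
    using assms(1) by (metis area_def lmeasurable_compact measure_nonneg negligible_iff_measure order_le_less)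
qed

lemma simplex2_obtain:
  assumes "2 simplex (T :: (real^2) set)"
  obtains a b c where "T = convex hull {a, b, c}" "a \<noteq> b" "a \<noteq> c" "b \<noteq> c" "\<not> affine_dependent {a, b, c}"
proof -
  obtain C where C: "\<not> affine_dependent C" "int (card C) = 3" "T = convex hull C"
    using assms by (auto simp: simplex_def)
  then have "card C = 3" by simp
  then obtain a b c where "C = {a, b, c}" "a \<noteq> b" "a \<noteq> c" "b \<noteq> c"
    by (auto simp: card_3_iff)
  with C show thesis by (intro that) auto
qed

definition std_triangle :: "(real^2) set" where
  "std_triangle = convex hull {0, axis 1 1, axis 2 1}"

lemma compact_std_triangle: "compact std_triangle"
  by (simp add: std_triangle_def finite_imp_compact_convex_hull)

lemma area_std_triangle: "area std_triangle = 1 / 2"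
  by (simp add: std_triangle_def area_triangle cross2_def axis_def)

lemma E_star_simplex:
  assumes T: "2 simplex T" and p: "p \<ge> 1"
  shows "E_star p T = E_star p std_triangle"
proof -
  from T obtain a b c where T: "T = convex hull {a, b, c}"
    and ne: "a \<noteq> b" "a \<noteq> c" "b \<noteq> c" and ind: "\<not> affine_dependent {a, b, c}"
    by (rule simplex2_obtain)
  define A where "A = (\<lambda>z::real^2. z$1 *\<^sub>R (b - a) + z$2 *\<^sub>R (c - a))"
  have A: "linear A"
    by (intro linearI) (auto simp: A_def algebra_simps)
  have "inj A"
  proof (subst linear_injective_0[OF A], intro allI impI, rule ccontr)
    fix z assume z: "A z = 0" "z \<noteq> 0"
    \<comment> \<open>A kernel vector of \<open>A\<close> is turned into the coefficients of an
      affine dependence of the three vertices.\<close>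
    define u where "u = (\<lambda>x. if x = b then z$1 else if x = c then z$2 else - z$1 - z$2)"
    have "sum u {a, b, c} = 0" "(\<Sum>x\<in>{a, b, c}. u x *\<^sub>R x) = 0"
      using ne z(1) by (auto simp: u_def A_def algebra_simps)
    moreover have "\<exists>v\<in>{a, b, c}. u v \<noteq> 0"
      using z(2) ne vec2_eqI[of z 0] by (auto simp: u_def)
    ultimately show False
      using ind affine_dependent_explicit_finite[of "{a, b, c}"] by blast
  qed
  have "(\<lambda>x. a + A x) ` std_triangle = (+) a ` A ` std_triangle"
    by (simp add: image_image)
  also have "\<dots> = convex hull {a, b, c}"
    unfolding std_triangle_def convex_hull_linear_image[OF A] convex_hull_translation[symmetric]
    by (simp add: A_def axis_def)
  finally show ?thesis
    using E_star_affine[OF A \<open>inj A\<close> compact_std_triangle _ p, of a] T area_std_triangle by simp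
qed

lemma interior_hull_card_3:
  fixes S :: "(real^2) set"
  assumes "finite S" "interior (convex hull S) \<noteq> {}" "card S \<le> 3"
  shows "2 simplex (convex hull S)"
proof -
  have "aff_dim (convex hull S) = 2"
    using aff_dim_nonempty_interior[OF assms(2)] by simp
  then have d: "aff_dim S = 2" using aff_dim_convex_hull[of S] by simp
  then have "card S = 3"
    using aff_dim_le_card[OF assms(1)] assms(3) by simp
  then have "\<not> affine_dependent S"
    using d assms(1) by (simp add: affine_independent_iff_card)
  then show ?thesis
    using \<open>card S = 3\<close> by (auto simp: simplex_def)
qed

section \<open>Removing a vertex by a shear\<close>

lemma convex_hull_affine_image:
  assumes "linear A"
  shows "convex hull ((\<lambda>x. v + A x) ` X) = (\<lambda>x. v + A x) ` (convex hull X)"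
proof -
  have "(\<lambda>x. v + A x) ` (convex hull X) = (+) v ` A ` (convex hull X)"
    by (simp only: image_image)
  also have "\<dots> = convex hull ((+) v ` A ` X)"
    by (simp only: convex_hull_linear_image[OF assms] convex_hull_translation)
  finally show ?thesis by (simp only: image_image)
qed

text \<open>The last hypothesis says that the segment from the sheared \<open>u\<close> to
  \<open>d\<close> passes through \<open>v\<close>. As \<open>v\<close> is fixed by the shear, it
  becomes redundant in the hull.\<close>

lemma shear_drop_vertex:
  fixes S :: "(real^2) set"
  assumes S: "finite S" "0 \<in> S" "axis 1 1 \<in> S" and s: "\<exists>u\<in>S. u$2 > 0" "\<exists>d\<in>S. d$2 < 0"
    and lr: "\<And>u d r. u \<in> S \<Longrightarrow> d \<in> S \<Longrightarrow> u$2 \<ge> 0 \<Longrightarrow> d$2 \<le> 0 \<Longrightarrow> r = 0 \<or> r = t \<Longrightarrow>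
         0 \<le> (u$1 + r * u$2) * (- d$2) + d$1 * u$2 \<and> (u$1 + r * u$2 - 1) * (- d$2) + (d$1 - 1) * u$2 \<le> 0"
    and ud: "u \<in> S" "u$2 > 0" "d \<in> S" "d$2 < 0"
    and v: "v \<in> S" "v$2 = 0" "(u$1 + t * u$2) * (- d$2) + d$1 * u$2 = v$1 * (u$2 - d$2)"
  obtains S' where "finite S'" "card S' < card S" "convex hull S' = shear t ` (convex hull S)"
proof -
  have sv: "shear t v = v" using v by (simp add: shear_lower)
  let ?S' = "shear t ` S - {v}"
  let ?m = "u$2 / (u$2 - d$2)"
  have m: "0 \<le> ?m" "?m \<le> 1" using ud by (auto simp: divide_simps)
  have "v = (1 - ?m) *\<^sub>R shear t u + ?m *\<^sub>R d"
    using ud v(2,3) by (intro vec2_eqI) (auto simp: divide_simps, auto simp: algebra_simps)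
  moreover have "shear t u \<in> ?S'" "d \<in> ?S'"
  proof -
    have "shear t d = d" using ud by (simp add: shear_lower)
    then show "shear t u \<in> ?S'" "d \<in> ?S'"
      using ud v(2) shear_nth(2)[of t u] by (auto, metis image_eqI)
  qed
  ultimately have "v \<in> convex hull ?S'"
    using m convexD_alt[OF convex_convex_hull, of "shear t u" ?S' d ?m] by (auto intro: hull_inc)
  then have "convex hull ?S' = convex hull (insert v ?S')"
    by (metis hull_redundant)
  also have "insert v ?S' = shear t ` S" using v sv by (metis image_eqI insert_Diff)
  also have "convex hull \<dots> = shear t ` (convex hull S)"
    by (rule shear_image_hull[OF S(2,3) s lr, symmetric])
  finally have "convex hull ?S' = shear t ` (convex hull S)" .
  moreover have "card ?S' < card S"
    using S(1) sv v(1) card_image_le[OF S(1), of "shear t"]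
    by (metis card_Diff1_less finite_imageI image_eqI order_less_le_trans)
  ultimately show thesis using S(1) by (intro that[of ?S']) auto
qed

text \<open>Used contrapositively: if \<open>axis 1 1\<close> is not in the hull of the other
  points, 0 among them, then that hull meets the axis only strictly to its left. The next lemma is
  the counterpart at 0.\<close>

lemma hull_axis_right:
  fixes S :: "(real^2) set"
  assumes r: "r \<in> convex hull S" "r$2 = 0" "r$1 \<ge> 1" and S: "0 \<in> S"
  shows "axis 1 1 \<in> convex hull S"
proof -
  have "axis 1 1 = (1 - 1 / r$1) *\<^sub>R 0 + (1 / r$1) *\<^sub>R r"
    using r by (intro vec2_eqI) (auto simp: axis_def)
  then show ?thesis
    using convexD_alt[OF convex_convex_hull, of 0 S r "1 / r$1"] r S by (auto intro: hull_inc)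
qed

lemma hull_axis_left:
  fixes S :: "(real^2) set"
  assumes r: "r \<in> convex hull S" "r$2 = 0" "r$1 \<le> 0" and S: "axis 1 1 \<in> S"
  shows "0 \<in> convex hull S"
proof -
  let ?m = "- r$1 / (1 - r$1)"
  have "0 = (1 - ?m) *\<^sub>R r + ?m *\<^sub>R axis 1 1"
    using r by (intro vec2_eqI) (auto simp: axis_def divide_simps algebra_simps)
  then show ?thesis
    using convexD_alt[OF convex_convex_hull, of r S "axis 1 1" ?m] r S by (auto intro: hull_inc simp: divide_simps)
qed

text \<open>\<open>L\<close> and \<open>R\<close> are the shear parameters at which the segment between a pair of vertices on
  different sides reaches the left and the right end of the diagonal.\<close>

lemma polygon_step_normalised:
  fixes S :: "(real^2) set"
  assumes S: "finite S" "0 \<in> S" "axis 1 1 \<in> S" and s: "\<exists>u\<in>S. u$2 > 0" "\<exists>d\<in>S. d$2 < 0"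
    and ind: "0 \<notin> convex hull (S - {0})" "axis 1 1 \<notin> convex hull (S - {axis 1 1})"
    and area: "area (convex hull S) > 0" and p: "p \<ge> 1"
  obtains S' where "finite S'" "card S' < card S" "area (convex hull S') > 0"
    "E_star p (convex hull S) \<le> E_star p (convex hull S')"
proof -
  define P where "P = {z \<in> S \<times> S. fst z$2 > 0 \<and> snd z$2 < 0}"
  have P: "finite P" "P \<noteq> {}" using S s by (auto simp: P_def)
  define L :: "(real^2) \<times> (real^2) \<Rightarrow> real" where "L = (\<lambda>(u, d). (u$1 * (- d$2) + d$1 * u$2) / (u$2 * (- d$2)))"
  define R :: "(real^2) \<times> (real^2) \<Rightarrow> real" where "R = (\<lambda>(u, d). - ((u$1 - 1) * (- d$2) + (d$1 - 1) * u$2) / (u$2 * (- d$2)))"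
  have ne: "axis 1 1 \<noteq> (0 :: real^2)" by (simp add: axis_eq_0_iff)
  \<comment> \<open>A segment between the two sides crosses the axis strictly inside the diagonal,
    for otherwise an end of the diagonal would lie in the hull of the remaining points. This leaves
    room for shears in both directions.\<close>
  have strict: "0 < u$1 * (- d$2) + d$1 * u$2" "(u$1 - 1) * (- d$2) + (d$1 - 1) * u$2 < 0"
    if ud: "u \<in> S" "u$2 > 0" "d \<in> S" "d$2 < 0" for u d
  proof -
    let ?m = "u$2 / (u$2 - d$2)"
    define r where "r = (1 - ?m) *\<^sub>R u + ?m *\<^sub>R d"
    have m: "0 \<le> ?m" "?m \<le> 1" using ud by (auto simp: divide_simps)
    have "u \<noteq> 0" "d \<noteq> 0" "u \<noteq> axis 1 1" "d \<noteq> axis 1 1" using ud by (auto simp: axis_def)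
    then have r: "r \<in> convex hull (S - {0})" "r \<in> convex hull (S - {axis 1 1})"
      unfolding r_def using ud m by (auto intro!: convexD_alt[OF convex_convex_hull] intro: hull_inc)
    have r2: "r$2 = 0" using ud by (simp add: r_def field_simps)
    have r1: "r$1 * (u$2 - d$2) = u$1 * (- d$2) + d$1 * u$2"
      using ud by (simp add: r_def divide_simps)
    have "r$1 > 0" using hull_axis_left[OF r(1) r2] ind ne S by force
    then show "0 < u$1 * (- d$2) + d$1 * u$2"
      unfolding r1[symmetric] using ud by (intro mult_pos_pos) auto
    have "r$1 < 1" using hull_axis_right[OF r(2) r2] ind ne S by force
    then have "r$1 * (u$2 - d$2) < 1 * (u$2 - d$2)"
      using ud by (intro mult_strict_right_mono) auto
    then show "(u$1 - 1) * (- d$2) + (d$1 - 1) * u$2 < 0"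
      unfolding r1 by (simp add: algebra_simps)
  qed
  have axis: "0 \<le> x$1 \<and> x$1 \<le> 1" if "x \<in> S" "x$2 = 0" for x
  proof -
    have "x \<noteq> 0 \<Longrightarrow> x$1 > 0"
      using hull_axis_left[of x "S - {0}"] that ind ne S by (force intro: hull_inc)
    moreover have "x \<noteq> axis 1 1 \<Longrightarrow> x$1 < 1"
      using hull_axis_right[of x "S - {axis 1 1}"] that ind ne S by (force intro: hull_inc)
    ultimately show ?thesis by (cases "x = 0"; cases "x = axis 1 1") (auto simp: axis_def)
  qed
  have Lpos: "L z > 0" and Rpos: "R z > 0" if "z \<in> P" for z
    using that strict[of "fst z" "snd z"]
    by (auto simp: P_def L_def R_def case_prod_unfold intro!: divide_neg_neg divide_pos_neg mult_pos_neg)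
  have lr: "0 \<le> (u$1 + r * u$2) * (- d$2) + d$1 * u$2 \<and> (u$1 + r * u$2 - 1) * (- d$2) + (d$1 - 1) * u$2 \<le> 0"
    if r: "- Min (L ` P) \<le> r" "r \<le> Min (R ` P)"
      and ud: "u \<in> S" "d \<in> S" "u$2 \<ge> 0" "d$2 \<le> 0" for u d r
  proof (cases "u$2 = 0 \<or> d$2 = 0")
    case True
    then show ?thesis
      using axis[OF ud(1)] axis[OF ud(2)] ud by (auto simp: mult_le_0_iff zero_le_mult_iff)
  next
    case False
    with ud have z: "(u, d) \<in> P" and pos: "u$2 * (- d$2) > 0"
      by (auto simp: P_def mult_pos_neg)
    have "- L (u, d) \<le> r" "r \<le> R (u, d)"
      using r z P Min_le[of "L ` P" "L (u, d)"] Min_le[of "R ` P" "R (u, d)"] by auto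
    then have "- (u$1 * (- d$2) + d$1 * u$2) \<le> r * (u$2 * (- d$2))"
      "r * (u$2 * (- d$2)) \<le> - ((u$1 - 1) * (- d$2) + (d$1 - 1) * u$2)"
      using pos unfolding L_def R_def prod.case
      by (metis minus_divide_left pos_divide_le_eq, metis pos_le_divide_eq)
    then show ?thesis by (simp add: algebra_simps)
  qed
  obtain zl where zl: "zl \<in> P" "L zl = Min (L ` P)" 
    using P by (metis (mono_tags) Min_in finite_imageI image_iff image_is_empty)
  obtain zr where zr: "zr \<in> P" "R zr = Min (R ` P)"
    using P by (metis (mono_tags) Min_in finite_imageI image_iff image_is_empty)
  have nonneg: "Min (L ` P) > 0" "Min (R ` P) > 0"
    using Lpos[OF zl(1)] Rpos[OF zr(1)] zl zr by auto
  \<comment> \<open>The extreme shears for which every crossing stays within the diagonal. For the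
    minimising pairs \<open>zl\<close> and \<open>zr\<close> the crossing has just reached an end,
    and that end is dropped.\<close>
  define l r where "l = - Min (L ` P)" and "r = Min (R ` P)"
  have lreq: "l = - L zl" "r = R zr" using zl zr by (auto simp: l_def r_def)
  have zlP: "fst zl \<in> S" "fst zl$2 > 0" "snd zl \<in> S" "snd zl$2 < 0" using zl by (auto simp: P_def)
  have zrP: "fst zr \<in> S" "fst zr$2 > 0" "snd zr \<in> S" "snd zr$2 < 0" using zr by (auto simp: P_def)
  have lr': "0 \<le> (u$1 + q * u$2) * (- d$2) + d$1 * u$2 \<and> (u$1 + q * u$2 - 1) * (- d$2) + (d$1 - 1) * u$2 \<le> 0"
    if "u \<in> S" "d \<in> S" "u$2 \<ge> 0" "d$2 \<le> 0" "q = 0 \<or> q = l \<or> q = r" for u d q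
    by (rule lr) (use that nonneg in \<open>auto simp: l_def r_def\<close>)
  have "(fst zl $ 1 + l * fst zl $ 2) * - snd zl $ 2 + snd zl $ 1 * fst zl $ 2 =
      (0::real^2) $ 1 * (fst zl $ 2 - snd zl $ 2)"
    using zlP unfolding lreq by (simp add: L_def case_prod_unfold field_simps)
  from shear_drop_vertex[OF S s _ zlP S(2) _ this]
  obtain Sl where Sl: "finite Sl" "card Sl < card S" "convex hull Sl = shear l ` (convex hull S)"
    using lr' by (metis (no_types, lifting) zero_index)
  have "(fst zr $ 1 + r * fst zr $ 2) * - snd zr $ 2 + snd zr $ 1 * fst zr $ 2 =
      (axis 1 1::real^2) $ 1 * (fst zr $ 2 - snd zr $ 2)"
    using zrP unfolding lreq by (simp add: R_def case_prod_unfold field_simps axis_def)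
  moreover have "(axis 1 1 :: real^2)$2 = 0" by (simp add: axis_def)
  ultimately obtain Sr where Sr: "finite Sr" "card Sr < card S" "convex hull Sr = shear r ` (convex hull S)"
    using shear_drop_vertex[OF S s _ zrP S(3), of r] lr' by (metis (no_types, lifting))
  have K: "compact (convex hull S)" using S(1) by (rule finite_imp_compact_convex_hull)
  have "E_star p (convex hull S) \<le> max (E_star p (convex hull Sl)) (E_star p (convex hull Sr))"
    unfolding Sl(3) Sr(3) using nonneg by (intro E_star_shear_le_max K area p) (auto simp: l_def r_def)
  moreover have "area (convex hull Sl) > 0" "area (convex hull Sr) > 0"
    unfolding Sl(3) Sr(3) using area by (auto simp: area_shear[OF K])
  ultimately show thesis
    using Sl Sr that by (meson le_max_iff_disj)
qed

text \<open>\<open>S\<close> is an arbitrary generating set and not the vertex set, because a shear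
  may make further points redundant; these are discarded by a separate case of the induction. If no
  point is redundant, any four of them provide a chord with points on both sides.\<close>

lemma E_star_polygon:
  fixes S :: "(real^2) set"
  assumes "finite S" "area (convex hull S) > 0" and p: "p \<ge> 1"
  shows "E_star p (convex hull S) \<le> E_star p std_triangle"
  using assms(1,2)
proof (induction "card S" arbitrary: S rule: less_induct)
  case (less S)
  have K: "compact (convex hull S)" using less.prems(1) by (rule finite_imp_compact_convex_hull)
  consider "card S \<le> 3" | y where "y \<in> S" "y \<in> convex hull (S - {y})"
    | "card S \<ge> 4" "\<And>y. y \<in> S \<Longrightarrow> y \<notin> convex hull (S - {y})"
    by fastforce
  then show ?case
  proof cases
    case 1
    have "2 simplex (convex hull S)"
      using 1 less.prems area_pos_iff_interior[OF K convex_convex_hull] by (intro interior_hull_card_3) auto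
    from E_star_simplex[OF this p] show ?thesis by simp
  next
    case (2 y)
    have "convex hull (S - {y}) = convex hull S"
      using 2 by (metis hull_redundant insert_Diff)
    moreover have "card (S - {y}) < card S" using less.prems 2 by (intro card_Diff1_less) auto
    ultimately show ?thesis using less.hyps[of "S - {y}"] less.prems by simp
  next
    case 3
    obtain Y where Y: "Y \<subseteq> S" "card Y = 4"
      using 3(1) by (meson obtain_subset_with_card_n)
    have "y \<notin> convex hull (Y - {y})" if "y \<in> Y" for y
      using 3(2)[of y] hull_mono[of "Y - {y}" "S - {y}"] that Y by blast
    from quadrilateral_diagonal[OF Y(2) this] obtain a b c d where
      abcd: "a \<in> Y" "b \<in> Y" "c \<in> Y" "d \<in> Y" "a \<noteq> c"
        "cross2 (c - a) (b - a) > 0" "cross2 (c - a) (d - a) < 0" by metis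
    obtain A :: "real^2 \<Rightarrow> real^2" and v where A: "linear A" "inj A" "v + A a = 0" "v + A c = axis 1 1"
      "\<And>x. (v + A x)$2 = cross2 (c - a) (x - a)"
      using normalise_segment[OF abcd(5)] by metis
    let ?f = "\<lambda>x. v + A x"
    have inj: "inj ?f" using A(2) by (auto simp: inj_def)
    have hull: "convex hull (?f ` X) = ?f ` (convex hull X)" for X
      by (rule convex_hull_affine_image[OF A(1)])
    have eq: "E_star p (convex hull (?f ` S)) = E_star p (convex hull S)"
      unfolding hull by (rule E_star_affine[OF A(1,2) K less.prems(2) p])
    note T = volume_scaling_affine[OF A(1,2), of v]
    have area: "area (convex hull (?f ` S)) > 0"
      unfolding hull volume_scaling_area[OF T K] using T less.prems(2) by (simp add: volume_scaling_def)
    have ind: "?f y \<notin> convex hull (?f ` S - {?f y})" if "y \<in> S" for y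
    proof -
      have "?f ` S - {?f y} = ?f ` (S - {y})" using inj by (auto simp: inj_def)
      then show ?thesis using 3(2)[OF that] inj_image_mem_iff[OF inj, of y] hull by metis
    qed
    obtain S' where S': "finite S'" "card S' < card (?f ` S)" "area (convex hull S') > 0"
      "E_star p (convex hull (?f ` S)) \<le> E_star p (convex hull S')"
    proof (rule polygon_step_normalised[OF _ _ _ _ _ _ _ area p])
      show "0 \<in> ?f ` S" "axis 1 1 \<in> ?f ` S" "\<exists>u\<in>?f ` S. u$2 > 0" "\<exists>d\<in>?f ` S. d$2 < 0"
        using A(3-5)[symmetric] abcd Y by (metis image_eqI subsetD)+
      show "0 \<notin> convex hull (?f ` S - {0})" "axis 1 1 \<notin> convex hull (?f ` S - {axis 1 1})"
        using ind[of a] ind[of c] A(3,4) abcd Y by auto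
    qed (use less.prems in auto)
    have "card (?f ` S) = card S" using inj by (simp add: card_image inj_on_def inj_def)
    then show ?thesis using less.hyps[of S'] S' eq by simp
  qed
qed

section \<open>Lipschitz continuity and approximation\<close>

lemma set_integral_mono_compact:
  fixes f :: "'a::euclidean_space \<Rightarrow> real"
  assumes "compact A" "compact B" "A \<subseteq> B" "continuous_on B f" "\<And>x. x \<in> B \<Longrightarrow> 0 \<le> f x"
  shows "(LINT x:A|lborel. f x) \<le> (LINT x:B|lborel. f x)"
  unfolding set_lebesgue_integral_def
  using set_integrable_compact[OF assms(1) continuous_on_subset[OF assms(4,3)]]
    set_integrable_compact[OF assms(2,4)] assms(3,5)
  by (intro integral_mono) (auto simp: set_integrable_def indicator_def)

lemma set_integral_const_Times:
  assumes "compact K"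
  shows "(LINT z:K\<times>K|lborel. (c::real)) = c * (area K)\<^sup>2"
  using set_integral_Times[OF assms assms, of "\<lambda>_. c"] assms
  by (simp add: set_integral_const_compact area_compact power2_eq_square)

lemma set_integral_abs_le:
  fixes f :: "'a::euclidean_space \<Rightarrow> real"
  assumes "compact A" "continuous_on A f" "continuous_on A g" "\<And>x. x \<in> A \<Longrightarrow> \<bar>f x\<bar> \<le> g x"
  shows "\<bar>LINT x:A|lborel. f x\<bar> \<le> (LINT x:A|lborel. g x)"
proof -
  have "\<bar>LINT x:A|lborel. f x\<bar> \<le> (LINT x|lborel. \<bar>indicator A x *\<^sub>R f x\<bar>)"
    unfolding set_lebesgue_integral_def by (rule integral_abs_bound)
  also have "\<dots> \<le> (LINT x:A|lborel. g x)"
    unfolding set_lebesgue_integral_def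
    using set_integrable_compact[OF assms(1,2)] set_integrable_compact[OF assms(1,3)] assms(4)
    by (intro integral_mono integrable_abs) (auto simp: set_integrable_def indicator_def)
  finally show ?thesis .
qed

lemma abs_powr_diff_le:
  fixes u v p B :: real
  assumes "p \<ge> 1" "0 \<le> u" "u \<le> B" "0 \<le> v" "v \<le> B"
  shows "\<bar>u powr p - v powr p\<bar> \<le> p * B powr (p - 1) * \<bar>u - v\<bar>"
proof -
  have *: "y powr p - x powr p \<le> p * B powr (p - 1) * (y - x)" if xy: "0 \<le> x" "x < y" "y \<le> B" for x y
  proof -
    have "continuous_on {x..y} (\<lambda>s. s powr p)"
      using assms(1) xy by (intro continuous_on_powr' continuous_intros) auto
    moreover have "((\<lambda>s. s powr p) has_real_derivative p * s powr (p - 1)) (at s)" if "x < s" for s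
      using that xy(1) by (auto intro!: derivative_eq_intros)
    ultimately obtain s where s: "x < s" "s < y" "y powr p - x powr p = (y - x) * (p * s powr (p - 1))"
      using MVT[OF xy(2), of "\<lambda>s. s powr p"]
      by (metis DERIV_unique real_differentiable_def)
    have "s powr (p - 1) \<le> B powr (p - 1)"
      using s xy assms(1) by (intro powr_mono2) auto
    then have "(y - x) * (p * s powr (p - 1)) \<le> (y - x) * (p * B powr (p - 1))"
      using xy assms(1) by (intro mult_left_mono) auto
    with s(3) show ?thesis by (simp add: algebra_simps)
  qed
  have mono: "x powr p \<le> y powr p" if "0 \<le> x" "x \<le> y" for x y
    using that assms(1) by (intro powr_mono2) auto
  show ?thesis
    using *[of u v] *[of v u] mono[of u v] mono[of v u] assms
    by (cases u v rule: linorder_cases) (auto simp: abs_if)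
qed

lemma powr_neg_diff_le:
  fixes a b q m :: real
  assumes "q \<le> 0" "0 < m" "m \<le> a" "a \<le> b"
  shows "\<bar>b powr q - a powr q\<bar> \<le> - q * m powr (q - 1) * (b - a)"
proof (cases "a = b")
  case False
  then have ab: "a < b" using assms by simp
  have "((\<lambda>s. s powr q) has_real_derivative q * s powr (q - 1)) (at s)" if "a \<le> s" for s
    using that assms by (auto intro!: derivative_eq_intros)
  then obtain s where s: "a < s" "s < b" "b powr q - a powr q = (b - a) * (q * s powr (q - 1))"
    using MVT2[OF ab, of "\<lambda>s. s powr q" "\<lambda>s. q * s powr (q - 1)"] by auto
  have "s powr (q - 1) \<le> m powr (q - 1)"
    using s assms by (intro powr_mono2') auto
  then have "(b - a) * (- q * s powr (q - 1)) \<le> (b - a) * (- q * m powr (q - 1))"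
    using ab assms by (intro mult_left_mono) auto
  moreover have "(b - a) * (q * s powr (q - 1)) \<le> 0"
    using ab assms(1) by (intro mult_nonneg_nonpos mult_nonpos_nonneg) auto
  ultimately show ?thesis
    unfolding s(3) by (simp add: algebra_simps)
qed simp

lemma norm_set_integral_diff_le:
  assumes W: "compact W" and K: "compact K" and "W \<subseteq> K" and R: "\<And>x. x \<in> K \<Longrightarrow> norm (x - c) \<le> (R::real)"
  shows "norm ((LINT x:K|lborel. x - c) - (LINT x:W|lborel. x - c :: real^2)) \<le> R * (area K - area W)"
proof -
  have int: "integrable lborel (\<lambda>x. indicator A x *\<^sub>R (x - c))" "integrable lborel (indicator A :: _ \<Rightarrow> real)"
    if "compact A" for A :: "(real^2) set"
    using set_integrable_compact[OF that, of "\<lambda>x. x - c"] integrable_indicator_compact[OF that]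
    by (auto simp: set_integrable_def continuous_intros)
  have "(LINT x:K|lborel. x - c) - (LINT x:W|lborel. x - c)
      = (LINT x|lborel. indicator K x *\<^sub>R (x - c) - indicator W x *\<^sub>R (x - c))"
    unfolding set_lebesgue_integral_def using int W K by simp
  also have "norm \<dots> \<le> (LINT x|lborel. norm (indicator K x *\<^sub>R (x - c) - indicator W x *\<^sub>R (x - c)))"
    by (rule integral_norm_bound)
  also have "\<dots> \<le> (LINT x|lborel. R * (indicator K x - indicator W x))"
  proof (intro integral_mono integrable_norm)
    show "norm (indicator K x *\<^sub>R (x - c) - indicator W x *\<^sub>R (x - c)) \<le> R * (indicator K x - indicator W x)" for x
      using assms(3,4) by (auto simp: indicator_def)
  qed (use int W K in simp_all)
  also have "\<dots> = R * (area K - area W)"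
    using int W K by (simp add: area_compact)
  finally show ?thesis .
qed

lemma centroid_integral:
  assumes "compact K" "area K > 0"
  shows "(LINT x:K|lborel. x - c) = area K *\<^sub>R (centroid K - c)"
proof -
  have "(LINT x:K|lborel. x - c) = (LINT x:K|lborel. x) - (LINT x:K|lborel. c)"
    using assms(1) by (intro set_integral_diff set_integrable_compact continuous_intros)
  then show ?thesis
    using assms by (simp add: centroid_compact set_integral_const_compact area_compact scaleR_diff_right)
qed

lemma norm_centroid_diff_le:
  assumes K: "compact K" "area K > 0" and R: "\<And>x. x \<in> K \<Longrightarrow> norm (x - c) \<le> R"
  shows "norm (centroid K - c) \<le> R"
proof -
  \<comment> \<open>The previous estimate with the empty set as the smaller set.\<close>
  have "area K * norm (centroid K - c) \<le> R * (area K - area {})"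
    using norm_set_integral_diff_le[of "{}" K c R] K R centroid_integral[OF K, of c]
    by (simp add: set_lebesgue_integral_def)
  then show ?thesis using K by (simp add: area_def mult.commute)
qed

lemma area_mono: "compact W \<Longrightarrow> compact K \<Longrightarrow> W \<subseteq> K \<Longrightarrow> area W \<le> area K"
  unfolding area_def by (intro measure_mono_fmeasurable) (auto intro: lmeasurable_compact fmeasurableD)

text \<open>The integral of \<open>x - centroid W\<close> over \<open>W\<close> vanishes, so over
  \<open>K\<close> only the part outside \<open>W\<close> contributes.\<close>

lemma centroid_Lipschitz:
  assumes W: "compact W" and K: "compact K" and "W \<subseteq> K" and sub: "K \<subseteq> cball 0 R" and m: "0 < m" "m \<le> area W"
  shows "norm (centroid K - centroid W) \<le> 2 * R / m * (area K - area W)"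
proof -
  have aW: "area W > 0" and aK: "area K > 0" "m \<le> area K" using m area_mono[OF W K assms(3)] by auto
  let ?g = "centroid W"
  have g: "norm ?g \<le> R"
    using norm_centroid_diff_le[OF W aW, of 0 R] assms(3) sub by force
  have "norm (x - ?g) \<le> 2 * R" if "x \<in> K" for x
    using norm_triangle_ineq4[of x ?g] g sub that by auto
  from norm_set_integral_diff_le[OF W K assms(3) this]
  have "area K * norm (centroid K - ?g) \<le> 2 * R * (area K - area W)"
    using aW aK by (simp add: centroid_integral W K)
  moreover have "m * norm (centroid K - ?g) \<le> area K * norm (centroid K - ?g)"
    using aK by (intro mult_right_mono) auto
  ultimately show ?thesis using m by (simp add: field_simps)
qed

lemma abs_cross2_ball:
  assumes "norm x \<le> R" "norm y \<le> R" "norm g \<le> R"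
  shows "\<bar>cross2 (x - g) (y - g)\<bar> \<le> 8 * R\<^sup>2"
proof -
  have "norm (x - g) \<le> 2 * R" "norm (y - g) \<le> 2 * R"
    using norm_triangle_ineq4[of x g] norm_triangle_ineq4[of y g] assms by auto
  then have "2 * norm (x - g) * norm (y - g) \<le> 2 * (2 * R) * (2 * R)"
    using order_trans[OF norm_ge_zero assms(1)] by (intro mult_mono) auto
  then show ?thesis using abs_cross2_le[of "x - g" "y - g"] by (simp add: power2_eq_square)
qed

lemma abs_cross2_diff_ball:
  assumes "norm x \<le> R" "norm y \<le> R" "norm g \<le> R" "norm h \<le> R"
  shows "\<bar>cross2 (x - g) (y - g) - cross2 (x - h) (y - h)\<bar> \<le> 8 * R * norm (g - h)"
proof -
  have n: "norm (x - g) \<le> 2 * R" "norm (y - h) \<le> 2 * R"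
    using norm_triangle_ineq4[of x g] norm_triangle_ineq4[of y h] assms by auto
  have "cross2 (x - g) (y - g) - cross2 (x - h) (y - h) = cross2 (x - g) (h - g) + cross2 (h - g) (y - h)"
    by (simp add: cross2_def algebra_simps)
  moreover have "\<bar>cross2 (x - g) (h - g)\<bar> \<le> 2 * (2 * R) * norm (g - h)"
    using n by (intro order_trans[OF abs_cross2_le])
      (simp add: norm_minus_commute[of h g] mult_right_mono)
  moreover have "\<bar>cross2 (h - g) (y - h)\<bar> \<le> 2 * norm (g - h) * (2 * R)"
    using mult_left_mono[OF n(2), of "norm (g - h)"] by (intro order_trans[OF abs_cross2_le])
      (simp add: norm_minus_commute[of h g] algebra_simps)
  ultimately show ?thesis by (simp add: algebra_simps)
qed

text \<open>From \<open>K\<close> to \<open>W\<close> three things change: the domain of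
  integration, the base point and the power of the area. Each costs a multiple of the lost area,
  uniformly over sets in a fixed ball with area at least \<open>m\<close>.\<close>

lemma E_star_Lipschitz:
  fixes R m p :: real
  assumes R: "R > 0" and m: "m > 0" and p: "p \<ge> 1"
  obtains C where "\<And>W K. compact W \<Longrightarrow> compact K \<Longrightarrow> W \<subseteq> K \<Longrightarrow> K \<subseteq> cball 0 R \<Longrightarrow> m \<le> area W \<Longrightarrow>
      \<bar>E_star p K - E_star p W\<bar> \<le> C * (area K - area W)"
proof -
  \<comment> \<open>\<open>M\<close> bounds all areas and \<open>B\<close> all determinants. In
    \<open>C1\<close> the first summand pays for the domain, with \<open>2 * M\<close> bounding
    \<open>area K + area W\<close>; the second pays for the base point and multiplies the Lipschitz
    constants of the power, of the determinant and of the centroid. The second summand of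
    \<open>C\<close> pays for the prefactor.\<close>
  define M where "M = area (cball (0::real^2) R)"
  define B where "B = 8 * R\<^sup>2"
  define C1 where "C1 = B powr p * (2 * M) + M\<^sup>2 * (p * B powr (p - 1) * (8 * R * (2 * R / m)))"
  define C where "C = 2 powr (-p) * (m powr (-2 - p) * C1 + (2 + p) * m powr (-2 - p - 1) * (B powr p * M\<^sup>2))"
  have B: "B > 0" using R by (simp add: B_def)
  show thesis
  proof (rule that[of C])
    fix W K :: "(real^2) set"
    assume W: "compact W" and K: "compact K" and WK: "W \<subseteq> K" and KR: "K \<subseteq> cball 0 R" and mW: "m \<le> area W"
    let ?g = "centroid K" and ?h = "centroid W"
    let ?f = "\<lambda>g z. \<bar>cross2 (fst z - g) (snd z - g)\<bar> powr p"
    have aWK: "area W \<le> area K" by (rule area_mono[OF W K WK])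
    have aKM: "area K \<le> M" unfolding M_def by (rule area_mono[OF K _ KR]) simp
    have pos: "area W > 0" "area K > 0" using m mW aWK by auto
    define d where "d = area K - area W"
    have d: "d \<ge> 0" using aWK by (simp add: d_def)
    have nK: "norm x \<le> R" if "x \<in> K" for x using KR that by auto
    have ng: "norm ?g \<le> R" "norm ?h \<le> R"
      using norm_centroid_diff_le[OF K pos(2), of 0 R] norm_centroid_diff_le[OF W pos(1), of 0 R] nK WK by auto
    have gh: "norm (?g - ?h) \<le> 2 * R / m * d"
      unfolding d_def by (rule centroid_Lipschitz[OF W K WK KR m mW])
    have f_le: "?f g z \<le> B powr p" if "z \<in> K \<times> K" "norm g \<le> R" for g z
      using abs_cross2_ball[of "fst z" R "snd z" g] that nK p unfolding B_def by (intro powr_mono2) auto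
    have cf: "continuous_on X (?f g)" for g X using p by (intro continuous_intros)
    have mono: "moment p W ?g \<le> moment p K ?g"
      unfolding moment_def using WK by (intro set_integral_mono_compact compact_Times W K cf) auto
    \<comment> \<open>Monotonicity in the domain, applied to the nonnegative complement of the
      integrand, bounds the loss of moment by the loss of measure.\<close>
    have "(LINT z:W\<times>W|lborel. B powr p - ?f ?g z) \<le> (LINT z:K\<times>K|lborel. B powr p - ?f ?g z)"
      using WK f_le ng by (intro set_integral_mono_compact compact_Times W K continuous_intros cf) auto
    then have "moment p K ?g - moment p W ?g \<le> B powr p * ((area K)\<^sup>2 - (area W)\<^sup>2)"
      unfolding moment_def
      using W K by (subst (asm) (1 2) set_integral_diff)
        (auto intro!: set_integrable_compact compact_Times cf continuous_intros
          simp: set_integral_const_Times algebra_simps)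
    also have "(area K)\<^sup>2 - (area W)\<^sup>2 = d * (area K + area W)"
      by (simp add: d_def power2_eq_square algebra_simps)
    also have "B powr p * (d * (area K + area W)) \<le> B powr p * (d * (2 * M))"
      using d aKM aWK by (intro mult_left_mono) auto
    finally have 1: "\<bar>moment p K ?g - moment p W ?g\<bar> \<le> B powr p * (d * (2 * M))"
      using mono by simp
    have "\<bar>?f ?g z - ?f ?h z\<bar> \<le> p * B powr (p - 1) * (8 * R * (2 * R / m * d))" if z: "z \<in> W \<times> W" for z
    proof -
      have n: "norm (fst z) \<le> R" "norm (snd z) \<le> R" using z WK nK by auto
      have "\<bar>?f ?g z - ?f ?h z\<bar> \<le> p * B powr (p - 1) *
          \<bar>\<bar>cross2 (fst z - ?g) (snd z - ?g)\<bar> - \<bar>cross2 (fst z - ?h) (snd z - ?h)\<bar>\<bar>"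
        using abs_cross2_ball[OF n ng(1)] abs_cross2_ball[OF n ng(2)] p
        by (intro abs_powr_diff_le) (auto simp: B_def)
      also have "\<dots> \<le> p * B powr (p - 1) * (8 * R * (2 * R / m * d))"
      proof (intro mult_left_mono)
        have "\<bar>\<bar>cross2 (fst z - ?g) (snd z - ?g)\<bar> - \<bar>cross2 (fst z - ?h) (snd z - ?h)\<bar>\<bar> \<le> 8 * R * norm (?g - ?h)"
          using abs_cross2_diff_ball[OF n ng] by linarith
        also have "\<dots> \<le> 8 * R * (2 * R / m * d)"
          using gh R by (intro mult_left_mono) auto
        finally show "\<bar>\<bar>cross2 (fst z - ?g) (snd z - ?g)\<bar> - \<bar>cross2 (fst z - ?h) (snd z - ?h)\<bar>\<bar>
            \<le> 8 * R * (2 * R / m * d)" .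
      qed (use p in auto)
      finally show ?thesis .
    qed
    then have "\<bar>LINT z:W\<times>W|lborel. ?f ?g z - ?f ?h z\<bar>
        \<le> (LINT z:W\<times>W|lborel. p * B powr (p - 1) * (8 * R * (2 * R / m * d)))"
      by (intro set_integral_abs_le compact_Times W continuous_intros cf) auto
    then have "\<bar>moment p W ?g - moment p W ?h\<bar> \<le> p * B powr (p - 1) * (8 * R * (2 * R / m * d)) * (area W)\<^sup>2"
      unfolding moment_def
      using W by (subst (asm) set_integral_diff)
        (auto intro!: set_integrable_compact compact_Times cf simp: set_integral_const_Times mult_ac)
    also have "\<dots> \<le> p * B powr (p - 1) * (8 * R * (2 * R / m * d)) * M\<^sup>2"
      using aKM aWK pos p R m d by (intro mult_left_mono power_mono) auto
    finally have 2: "\<bar>moment p W ?g - moment p W ?h\<bar> \<le> p * B powr (p - 1) * (8 * R * (2 * R / m * d)) * M\<^sup>2" .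
    have J: "\<bar>moment p K ?g - moment p W ?h\<bar> \<le> C1 * d"
      using 1 2 by (simp add: C1_def algebra_simps)
    have "(LINT z:W\<times>W|lborel. ?f ?h z) \<le> (LINT z:W\<times>W|lborel. B powr p)"
      using f_le ng WK by (intro set_integral_mono set_integrable_compact compact_Times W cf continuous_intros) auto
    then have "moment p W ?h \<le> B powr p * (area W)\<^sup>2"
      using W by (simp add: moment_def set_integral_const_Times)
    also have "\<dots> \<le> B powr p * M\<^sup>2"
      using aKM aWK pos by (intro mult_left_mono power_mono) auto
    finally have JW: "moment p W ?h \<le> B powr p * M\<^sup>2" .
    have JW0: "moment p W ?h \<ge> 0"
      unfolding moment_def set_lebesgue_integral_def by (intro integral_nonneg_AE) auto
    let ?q = "- 2 - p"
    have "\<bar>area K powr ?q * moment p K ?g - area W powr ?q * moment p W ?h\<bar>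
       = \<bar>area K powr ?q * (moment p K ?g - moment p W ?h) + (area K powr ?q - area W powr ?q) * moment p W ?h\<bar>"
      by (simp add: algebra_simps)
    also have "\<dots> \<le> area K powr ?q * \<bar>moment p K ?g - moment p W ?h\<bar> + \<bar>area K powr ?q - area W powr ?q\<bar> * moment p W ?h"
      using JW0 by (intro order_trans[OF abs_triangle_ineq]) (simp add: abs_mult)
    also have "\<dots> \<le> m powr ?q * (C1 * d) + (- ?q * m powr (?q - 1) * d) * (B powr p * M\<^sup>2)"
    proof (intro add_mono mult_mono J JW JW0)
      show "area K powr ?q \<le> m powr ?q" using m mW aWK p by (intro powr_mono2') auto
      show "\<bar>area K powr ?q - area W powr ?q\<bar> \<le> - ?q * m powr (?q - 1) * d"
        unfolding d_def by (intro powr_neg_diff_le) (use m mW aWK p in auto)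
    qed (use p d in auto)
    finally have "2 powr (-p) * \<bar>area K powr ?q * moment p K ?g - area W powr ?q * moment p W ?h\<bar>
       \<le> 2 powr (-p) * (m powr ?q * (C1 * d) + (- ?q * m powr (?q - 1) * d) * (B powr p * M\<^sup>2))"
      by (intro mult_left_mono) auto
    also have "\<dots> = C * d" by (simp add: C_def algebra_simps)
    also have "2 powr (-p) * \<bar>area K powr ?q * moment p K ?g - area W powr ?q * moment p W ?h\<bar>
        = \<bar>E_star p K - E_star p W\<bar>"
      unfolding E_star_compact[OF K p] E_star_compact[OF W p]
      by (simp add: abs_mult[of "2 powr (-p)", symmetric, simplified] algebra_simps)
    finally show "\<bar>E_star p K - E_star p W\<bar> \<le> C * (area K - area W)" by (simp add: d_def)
  qed
qed

text \<open>Take hulls of longer and longer initial pieces of a countable dense subset. Their union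
  is convex with closure containing \<open>K\<close>, so it contains the interior of
  \<open>K\<close>; the rest lies in the frontier, which is a null set.\<close>

lemma convex_disc_approx:
  assumes K: "convex_disc K"
  obtains P :: "nat \<Rightarrow> (real^2) set"
  where "\<And>n. \<exists>S. finite S \<and> P n = convex hull S" "\<And>n. P n \<subseteq> K" "(\<lambda>n. area (P n)) \<longlonglongrightarrow> area K"
proof -
  from K have cK: "compact K" "convex K" and iK: "interior K \<noteq> {}"
    by (auto simp: convex_disc_def)
  obtain D where D: "countable D" "D \<subseteq> K" "K \<subseteq> closure D"
    using separable by metis
  have "D \<noteq> {}"
    using D(3) iK by (metis closure_empty interior_empty subset_empty)
  define d where "d = from_nat_into D"
  have d: "range d = D" unfolding d_def by (rule range_from_nat_into) (use \<open>D \<noteq> {}\<close> D in auto)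
  define P where "P n = convex hull (d ` {..n})" for n
  have PK: "P n \<subseteq> K" for n
  proof -
    have "d ` {..n} \<subseteq> K" using d D(2) by (metis UNIV_I image_subset_iff range_subsetD subset_iff)
    then show ?thesis unfolding P_def by (rule hull_minimal[where S = convex, OF _ cK(2)])
  qed
  have inc: "incseq P"
    unfolding P_def by (intro monoI hull_mono image_mono) auto
  define U where "U = (\<Union>n. P n)"
  have UK: "U \<subseteq> K" using PK by (auto simp: U_def)
  have "convex U"
    unfolding convex_alt
  proof (intro ballI allI impI)
    fix x y and u :: real assume xy: "x \<in> U" "y \<in> U" and u: "0 \<le> u \<and> u \<le> 1"
    then obtain m n where "x \<in> P m" "y \<in> P n" by (auto simp: U_def)
    then have "x \<in> P (max m n)" "y \<in> P (max m n)"
      using incseqD[OF inc, of m "max m n"] incseqD[OF inc, of n "max m n"] by auto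
    then have "(1 - u) *\<^sub>R x + u *\<^sub>R y \<in> P (max m n)"
      using u unfolding P_def by (intro convexD_alt convex_convex_hull) auto
    then show "(1 - u) *\<^sub>R x + u *\<^sub>R y \<in> U" by (auto simp: U_def)
  qed
  have "D \<subseteq> U"
  proof
    fix x assume "x \<in> D"
    then obtain n where "x = d n" using d by auto
    then have "x \<in> P n" unfolding P_def by (intro hull_inc) auto
    then show "x \<in> U" by (auto simp: U_def)
  qed
  then have "K \<subseteq> closure U" using D(3) closure_mono by blast
  then have "interior K \<subseteq> interior (closure U)" by (rule interior_mono)
  also have "\<dots> = interior U" using \<open>convex U\<close> by (rule convex_interior_closure)
  finally have int: "interior K \<subseteq> U" using interior_subset by blast
  have Ps: "P n \<in> sets lebesgue" for n
    unfolding P_def by (intro lmeasurable_compact[THEN fmeasurableD] finite_imp_compact_convex_hull) auto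
  have fU: "emeasure lebesgue U \<noteq> \<infinity>"
    using emeasure_mono[OF UK, of lebesgue] lmeasurable_compact[OF cK(1)]
    by (auto simp: fmeasurable_def top_unique)
  have "(\<lambda>n. measure lebesgue (P n)) \<longlonglongrightarrow> measure lebesgue U"
    unfolding U_def by (rule Lim_measure_incseq) (use inc Ps fU in \<open>auto simp: U_def\<close>)
  moreover have "measure lebesgue U = measure lebesgue K"
  proof (rule measure_negligible_symdiff)
    show "K \<in> lmeasurable" using cK(1) by (rule lmeasurable_compact)
    have "sym_diff K U \<subseteq> frontier K"
      using int UK cK(1) by (auto simp: frontier_def compact_imp_closed)
    then show "negligible (sym_diff K U)"
      using negligible_convex_frontier[OF cK(2)] negligible_subset by blast
  qed
  ultimately show thesis
    using PK by (intro that[of P]) (auto simp: area_def P_def)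
qed

lemma E_star_le_std_triangle:
  assumes K: "convex_disc K" and p: "p \<ge> 1"
  shows "E_star p K \<le> E_star p std_triangle"
proof -
  have cK: "compact K" and aK: "area K > 0"
    using K area_pos_iff_interior[of K] by (auto simp: convex_disc_def)
  obtain P where P: "\<And>n. \<exists>S. finite S \<and> P n = convex hull S" "\<And>n. P n \<subseteq> K"
    "(\<lambda>n. area (P n)) \<longlonglongrightarrow> area K"
    using convex_disc_approx[OF K] by metis
  obtain R where R: "R > 0" "K \<subseteq> cball 0 R"
    using compact_imp_bounded[OF cK] 
    by (metis bounded_pos mem_cball_0 subsetI)
  \<comment> \<open>The lower bound \<open>area K / 2\<close> holds for late approximating polygons,
    so one constant serves all of them.\<close>
  obtain C where C: "\<And>W K'. compact W \<Longrightarrow> compact K' \<Longrightarrow> W \<subseteq> K' \<Longrightarrow> K' \<subseteq> cball 0 R \<Longrightarrow> area K / 2 \<le> area W \<Longrightarrow>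
      \<bar>E_star p K' - E_star p W\<bar> \<le> C * (area K' - area W)"
    using E_star_Lipschitz[OF R(1) _ p, of "area K / 2"] aK by (metis half_gt_zero)
  have "eventually (\<lambda>n. area (P n) > area K / 2) sequentially"
    using P(3) aK by (intro order_tendstoD(1)) auto
  then have "eventually (\<lambda>n. E_star p K \<le> E_star p std_triangle + C * (area K - area (P n))) sequentially"
  proof eventually_elim
    case (elim n)
    obtain S where S: "finite S" "P n = convex hull S" using P(1) by blast
    have "E_star p (P n) \<le> E_star p std_triangle"
      unfolding S(2) using S elim aK by (intro E_star_polygon p) auto
    moreover have "\<bar>E_star p K - E_star p (P n)\<bar> \<le> C * (area K - area (P n))"
      using S elim by (intro C cK P(2) R(2)) (auto intro: finite_imp_compact_convex_hull)
    ultimately show ?case by linarith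
  qed
  moreover have "(\<lambda>n. E_star p std_triangle + C * (area K - area (P n))) \<longlonglongrightarrow> E_star p std_triangle + C * (area K - area K)"
    by (intro tendsto_intros P(3))
  ultimately show ?thesis
    using tendsto_lowerbound[of _ _ sequentially "E_star p K"] by fastforce
qed

section \<open>The quadratic gain of a shear\<close>

lemma powr_ge_tangent:
  fixes r y :: real
  assumes "r \<ge> 1" "y \<ge> 0"
  shows "y powr r \<ge> 1 + r * (y - 1)"
proof (cases "y = 0")
  case False
  have "((\<lambda>s. s powr r) has_real_derivative r * 1 powr (r - 1)) (at 1 within {0<..})"
    by (auto intro!: derivative_eq_intros)
  from convex_on_imp_above_tangent[OF powr_convex[OF assms(1)] _ _ _ this, of y] assms False
  show ?thesis by (auto simp: interior_open)
qed (use assms in auto)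

text \<open>Bernoulli's inequality for \<open>(b + s) powr q = ((b + s)\<^sup>2) powr (q / 2)\<close>.\<close>

lemma powr_second_difference:
  fixes b s q :: real
  assumes q: "q \<ge> 2" and b: "b > 0" and s: "\<bar>s\<bar> \<le> b"
  shows "(b + s) powr q + (b - s) powr q - 2 * b powr q \<ge> q * b powr (q - 2) * s\<^sup>2"
proof -
  have *: "(b + s) powr q \<ge> b powr q * (1 + q / 2 * (2 * s / b + s\<^sup>2 / b\<^sup>2))" if s: "\<bar>s\<bar> \<le> b" for s
  proof -
    have nn: "(b + s) / b \<ge> 0" using b s by auto
    have "((b + s) / b) powr q = (((b + s) / b)\<^sup>2) powr (q / 2)"
    proof (cases "(b + s) / b = 0")
      case False
      then show ?thesis using nn powr_powr[of "(b + s) / b" 2 "q / 2"] by simp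
    next
      case True
      then show ?thesis by (simp only: True power_zero_numeral) simp
    qed
    also have "\<dots> \<ge> 1 + q / 2 * (((b + s) / b)\<^sup>2 - 1)"
      using q by (intro powr_ge_tangent) auto
    also have "((b + s) / b)\<^sup>2 - 1 = 2 * s / b + s\<^sup>2 / b\<^sup>2"
      using b by (simp add: power2_eq_square field_simps)
    finally have "b powr q * ((b + s) / b) powr q \<ge> b powr q * (1 + q / 2 * (2 * s / b + s\<^sup>2 / b\<^sup>2))"
      by (intro mult_left_mono) auto
    also have "b powr q * ((b + s) / b) powr q = (b + s) powr q"
      using b nn by (simp flip: powr_mult)
    finally show ?thesis .
  qed
  \<comment> \<open>Adding the bounds for \<open>s\<close> and \<open>- s\<close> cancels the linear
    terms; the quadratic ones contribute \<open>q / 2\<close> each.\<close>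
  have "b powr q * (1 + q / 2 * (2 * s / b + s\<^sup>2 / b\<^sup>2)) + b powr q * (1 + q / 2 * (2 * (-s) / b + (-s)\<^sup>2 / b\<^sup>2)) - 2 * b powr q
     = q * (b powr q / b\<^sup>2) * s\<^sup>2"
    using b by (simp add: field_simps)
  also have "b powr q / b\<^sup>2 = b powr (q - 2)"
    using b by (simp add: powr_diff)
  finally show ?thesis
    using *[of s] *[of "- s"] s by simp
qed

lemma integral_abs_affine_powr:
  fixes p w e l r :: real
  assumes p: "p \<ge> 1" and w: "w > 0" and lr: "l \<le> r" "e - w * l \<ge> 0" "w * r - e \<ge> 0"
  shows "(LINT x:{l..r}|lborel. \<bar>e - w * x\<bar> powr p) = ((e - w * l) powr (p + 1) + (w * r - e) powr (p + 1)) / (w * (p + 1))"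
proof -
  \<comment> \<open>An antiderivative in one formula for both signs. It is continuous at the zero
    \<open>e / w\<close>, which is passed to the fundamental theorem as an exceptional
    point.\<close>
  define F where "F = (\<lambda>x. - ((e - w * x) * \<bar>e - w * x\<bar> powr p) / (w * (p + 1)))"
  have c: "w * (p + 1) \<noteq> 0" using w p by auto
  have cont: "continuous_on {l..r} F"
    unfolding F_def using p w by (intro continuous_intros) auto
  have "((\<lambda>x. \<bar>e - w * x\<bar> powr p) has_integral (F r - F l)) {l..r}"
  proof (rule fundamental_theorem_of_calculus_interior_strong[of "{e / w}", OF _ lr(1) _ cont])
    fix x assume x: "x \<in> {l<..<r} - {e / w}"
    then have ne: "e - w * x \<noteq> 0" using w by (auto simp: field_simps)
    have "(F has_real_derivative \<bar>e - w * x\<bar> powr p) (at x)"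
    proof (cases "e - w * x > 0")
      case True
      have "((\<lambda>x. - ((e - w * x) powr (p + 1)) / (w * (p + 1))) has_real_derivative \<bar>e - w * x\<bar> powr p) (at x)"
      proof -
        have "((\<lambda>x. (e - w * x) powr (p + 1)) has_real_derivative - (w * (p + 1)) * (e - w * x) powr p) (at x)"
          using True by (auto intro!: derivative_eq_intros)
        from DERIV_cdivide[OF DERIV_minus[OF this], of "w * (p + 1)"] show ?thesis
          using True c by simp
      qed
      then show ?thesis
      proof (rule has_field_derivative_transform_within_open)
        show "open {x. e - w * x > 0}" by (intro open_Collect_less continuous_intros)
      qed (use True in \<open>auto simp: F_def powr_add\<close>)
    next
      case False
      with ne have neg: "w * x - e > 0" by simp
      have "((\<lambda>x. (w * x - e) powr (p + 1) / (w * (p + 1))) has_real_derivative \<bar>e - w * x\<bar> powr p) (at x)"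
      proof -
        have "((\<lambda>x. (w * x - e) powr (p + 1)) has_real_derivative (w * (p + 1)) * (w * x - e) powr p) (at x)"
          using neg by (auto intro!: derivative_eq_intros)
        from DERIV_cdivide[OF this, of "w * (p + 1)"] show ?thesis
          using neg c by simp
      qed
      then show ?thesis
      proof (rule has_field_derivative_transform_within_open)
        show "open {x. w * x - e > 0}" by (intro open_Collect_less continuous_intros)
      qed (use neg in \<open>auto simp: F_def powr_add abs_minus_commute[of e] algebra_simps\<close>)
    qed
    then show "(F has_vector_derivative \<bar>e - w * x\<bar> powr p) (at x)"
      by (simp add: has_real_derivative_iff_has_vector_derivative)
  qed simp
  moreover have "F r - F l = ((e - w * l) powr (p + 1) + (w * r - e) powr (p + 1)) / (w * (p + 1))"
    using lr unfolding F_def by (simp add: powr_add abs_of_nonneg abs_of_nonpos diff_divide_distrib add_divide_distrib algebra_simps)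
  moreover have "(LINT x:{l..r}|lborel. \<bar>e - w * x\<bar> powr p) = integral {l..r} (\<lambda>x. \<bar>e - w * x\<bar> powr p)"
    using p by (intro set_borel_integral_eq_integral set_integrable_compact continuous_intros) auto
  ultimately show ?thesis by (metis integral_unique)
qed

section \<open>Positive integrals and the position of the centroid\<close>

lemma set_integrable_inner:
  fixes f :: "'a::euclidean_space \<times> 'b::euclidean_space \<Rightarrow> real"
  assumes "compact A" "compact B" "continuous_on (A \<times> B) f"
  shows "set_integrable lborel A (\<lambda>x. LINT y:B|lborel. f (x, y))"
proof -
  have "integrable (lborel \<Otimes>\<^sub>M lborel) (\<lambda>z. indicator (A \<times> B) z *\<^sub>R f z)"
    using set_integrable_compact[of "A \<times> B" f] assms
    by (simp add: set_integrable_def lborel_prod compact_Times)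
  from lborel_pair.integrable_fst'[OF this] show ?thesis
    by (simp add: set_integrable_def set_lebesgue_integral_def indicator_times mult.assoc)
qed

lemma set_integral_pos:
  fixes f :: "real^2 \<Rightarrow> real"
  assumes K: "compact K" and f: "continuous_on UNIV f" "\<And>x. x \<in> K \<Longrightarrow> 0 \<le> f x"
    and x: "x \<in> interior K" "f x > 0"
  shows "(LINT x:K|lborel. f x) > 0"
proof -
  have "open {y. f x / 2 < f y}"
    using f(1) by (intro open_Collect_less continuous_intros)
  then have "open (interior K \<inter> {y. f x / 2 < f y})" by blast
  moreover have "x \<in> interior K \<inter> {y. f x / 2 < f y}" using x by auto
  ultimately obtain r where r: "r > 0" "cball x r \<subseteq> interior K \<inter> {y. f x / 2 < f y}"
    by (meson open_contains_cball)
  have "0 < f x / 2 * measure lborel (cball x r)"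
    using x r by (simp add: content_cball_pos)
  also have "\<dots> = (LINT y:cball x r|lborel. f x / 2)"
    by (simp add: set_integral_const_compact)
  also have "\<dots> \<le> (LINT y:cball x r|lborel. f y)"
    using r continuous_on_subset[OF f(1)]
    by (intro set_integral_mono set_integrable_compact) (auto intro: less_imp_le)
  also have "\<dots> \<le> (LINT y:K|lborel. f y)"
    using subset_trans[OF r(2)] interior_subset[of K] continuous_on_subset[OF f(1)] f(2)
    by (intro set_integral_mono_compact K) auto
  finally show ?thesis .
qed

lemma set_integral_linear_functional:
  fixes L :: "real^2 \<Rightarrow> real"
  assumes L: "bounded_linear L" and K: "compact K" "area K > 0"
  shows "(LINT x:K|lborel. L (x - c)) = area K * L (centroid K - c)"
proof -
  have "integrable lborel (\<lambda>x. indicator K x *\<^sub>R (x - c))"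
    using set_integrable_compact[OF K(1), of "\<lambda>x. x - c"]
    by (simp add: set_integrable_def continuous_intros)
  from integral_bounded_linear[OF L this]
  have "(LINT x:K|lborel. L (x - c)) = L (LINT x:K|lborel. x - c)"
    unfolding set_lebesgue_integral_def by (simp add: linear_scale[OF bounded_linear.linear[OF L]])
  then show ?thesis
    by (simp add: centroid_integral[OF K] linear_scale[OF bounded_linear.linear[OF L]])
qed

lemma convex_disc_area_pos: "convex_disc K \<Longrightarrow> area K > 0"
  using area_pos_iff_interior[of K] by (auto simp: convex_disc_def)

text \<open>Otherwise a line through the centroid has \<open>K\<close> on one side. The
  corresponding functional is nonnegative on \<open>K\<close> and positive at interior points, yet
  its integral over \<open>K\<close> is zero by the definition of the centroid.\<close>

lemma centroid_in_interior:
  assumes K: "convex_disc K"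
  shows "centroid K \<in> interior K"
proof (rule ccontr)
  assume n: "centroid K \<notin> interior K"
  have cK: "compact K" "convex K" "interior K \<noteq> {}" using K by (auto simp: convex_disc_def)
  let ?g = "centroid K"
  have "convex ((\<lambda>x. x - ?g) ` interior K)" "0 \<notin> (\<lambda>x. x - ?g) ` interior K"
    using cK(2) n by (auto intro: convex_translation_subtract convex_interior)
  from separating_hyperplane_set_0[OF this]
  obtain a where a: "a \<noteq> 0" "\<And>x. x \<in> interior K \<Longrightarrow> 0 \<le> a \<bullet> (x - ?g)" by auto
  have "K \<subseteq> closure (interior K)"
    using convex_closure_interior[OF cK(2,3)] closure_subset by blast
  also have "\<dots> \<subseteq> {x. a \<bullet> (x - ?g) \<ge> 0}"
  proof (rule closure_minimal)
    show "closed {x. 0 \<le> a \<bullet> (x - ?g)}" by (intro closed_Collect_le continuous_intros)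
  qed (use a(2) in auto)
  finally have aK: "a \<bullet> (x - ?g) \<ge> 0" if "x \<in> K" for x using that by auto
  obtain x where x: "x \<in> interior K" using cK(3) by auto
  obtain r where r: "r > 0" "cball x r \<subseteq> interior K"
    using open_interior x open_contains_cball by blast
  \<comment> \<open>Stepping from \<open>x\<close> against \<open>a\<close> inside the interior
    lowers the functional by \<open>r * norm a\<close> and leaves it nonnegative, so it was positive
    at \<open>x\<close>.\<close>
  let ?y = "x - (r / norm a) *\<^sub>R a"
  have "?y \<in> interior K" using r a(1) by (auto simp: dist_norm)
  from a(2)[OF this] have "a \<bullet> (x - ?g) > 0"
    using r(1) a(1) by (simp add: inner_diff_right inner_simps)
     (smt (verit) divide_pos_pos inner_gt_zero_iff mult_pos_pos zero_less_norm_iff)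
  then have "(LINT x:K|lborel. a \<bullet> (x - ?g)) > 0"
    using aK x by (intro set_integral_pos[OF cK(1)] continuous_intros) auto
  moreover have "(LINT x:K|lborel. a \<bullet> (x - ?g)) = 0"
    using set_integral_linear_functional[OF bounded_linear_inner_right cK(1) convex_disc_area_pos[OF K]]
    by simp
  ultimately show False by simp
qed

lemma convex_disc_interior_meets:
  assumes K: "convex_disc K" and U: "open U" "x \<in> K" "x \<in> U"
  obtains y where "y \<in> interior K" "y \<in> U"
proof -
  have "x \<in> closure (interior K)"
    using K U convex_closure_interior[of K] closure_subset by (auto simp: convex_disc_def)
  then show thesis
    using U that by (metis closure_iff_nhds_not_empty disjoint_iff order_refl)
qed

text \<open>\<open>shear_const K\<close> is the mean of \<open>max (x$2) 0\<close>. As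
  \<open>K\<close> has interior points on both sides of the axis, this mean is positive and strictly
  above that of \<open>x$2\<close>, the height of the centroid. The strict gap gives a nonzero slope
  for pairs whose second point is the centroid.\<close>

lemma shear_const_gt:
  assumes K: "convex_disc K" and ud: "\<exists>u\<in>K. u$2 > 0" "\<exists>d\<in>K. d$2 < 0"
  shows "shear_const K > max (centroid K$2) 0"
proof -
  have cK: "compact K" using K by (simp add: convex_disc_def)
  note aK = convex_disc_area_pos[OF K]
  have o: "open {x::real^2. x$2 > 0}" "open {x::real^2. x$2 < 0}"
    by (intro open_Collect_less continuous_intros)+
  obtain u where u: "u \<in> interior K" "u$2 > 0"
    using convex_disc_interior_meets[OF K o(1)] ud(1) by auto
  obtain d where d: "d \<in> interior K" "d$2 < 0"
    using convex_disc_interior_meets[OF K o(2)] ud(2) by auto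
  have 1: "(LINT x:K|lborel. max (x$2) 0) > 0"
    using u by (intro set_integral_pos[OF cK _ _ u(1)] continuous_intros) auto
  have "0 < (LINT x:K|lborel. max (x$2) 0 - x$2)"
    using d by (intro set_integral_pos[OF cK _ _ d(1)] continuous_intros) auto
  also have "\<dots> = (LINT x:K|lborel. max (x$2) 0) - (LINT x:K|lborel. x$2)"
    by (intro set_integral_diff set_integrable_compact cK continuous_intros)
  also have "(LINT x:K|lborel. x$2) = area K * centroid K$2"
  proof -
    have "bounded_linear (\<lambda>x::real^2. x$2)" by (rule bounded_linear_vec_nth)
    from set_integral_linear_functional[OF this cK aK, of 0] show ?thesis by simp
  qed
  finally show ?thesis
    using 1 aK by (simp add: shear_const_def field_simps)
qed

section \<open>Gain from a sign change of the determinant\<close>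

lemma set_integral_rectangle:
  fixes h :: "real^2 \<Rightarrow> real"
  assumes h: "continuous_on UNIV h"
  shows "(LINT x:vec2 ` ({a..b} \<times> {c..d})|lborel. h x)
    = (LINT y:{c..d}|lborel. LINT x:{a..b}|lborel. h (vec2 (x, y)))"
proof -
  let ?R = "vec2 ` ({a..b} \<times> {c..d})"
  have "compact ?R" by (intro compact_continuous_image continuous_on_vec2 compact_Times) auto
  then have [measurable]: "?R \<in> sets borel" by (rule borel_compact)
  have [measurable]: "h \<in> borel_measurable borel" using h by (rule borel_measurable_continuous_onI)
  have "inj vec2"
    by (rule injI) (metis prod_eqI vec2_nth)
  then have mem: "indicator ?R (vec2 (x, y)) = (indicator {c..d} y * indicator {a..b} x :: real)" for x y
    by (auto simp: indicator_def inj_image_mem_iff)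
  have "(LINT x:?R|lborel. h x)
     = (LINT z|(lborel \<Otimes>\<^sub>M lborel). indicator ?R (vec2 z) *\<^sub>R h (vec2 z))"
    unfolding set_lebesgue_integral_def by (subst lborel_vec2, subst integral_distr) auto
  also have "\<dots> = (LINT z|(lborel \<Otimes>\<^sub>M lborel). (case z of (x, y) \<Rightarrow> indicator ?R (vec2 (x, y)) *\<^sub>R h (vec2 (x, y))))"
    by (simp add: case_prod_unfold)
  also have "\<dots> = (LINT y|lborel. LINT x|lborel. indicator ?R (vec2 (x, y)) *\<^sub>R h (vec2 (x, y)))"
  proof (rule lborel_pair.integral_snd[symmetric])
    have "set_integrable lborel ({a..b} \<times> {c..d}) (\<lambda>z. h (vec2 z))"
      by (intro set_integrable_compact compact_Times continuous_on_compose2[OF h continuous_on_vec2]) auto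
    also have "set_integrable lborel ({a..b} \<times> {c..d}) (\<lambda>z. h (vec2 z)) \<longleftrightarrow>
      integrable (lborel \<Otimes>\<^sub>M lborel) (\<lambda>(x, y). indicator ?R (vec2 (x, y)) *\<^sub>R h (vec2 (x, y)))"
      unfolding set_integrable_def lborel_prod
      by (intro arg_cong[where f = "integrable lborel"]) (auto simp: mem fun_eq_iff indicator_times)
    finally show "integrable (lborel \<Otimes>\<^sub>M lborel) (\<lambda>(x, y). indicator ?R (vec2 (x, y)) *\<^sub>R h (vec2 (x, y)))" .
  qed
  finally show ?thesis
    by (simp add: set_lebesgue_integral_def mem mult.assoc)
qed

definition second_difference :: "real \<Rightarrow> real \<Rightarrow> real \<Rightarrow> real" where
  "second_difference p a s = \<bar>a + s\<bar> powr p + \<bar>a - s\<bar> powr p - 2 * \<bar>a\<bar> powr p"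

lemma second_difference_nonneg: "p \<ge> 1 \<Longrightarrow> second_difference p a s \<ge> 0"
  using convex_onD[OF convex_on_abs_powr, of p "1/2" "a + s" "a - s"]
  by (simp add: second_difference_def field_simps)

text \<open>Integrating across the zero raises the exponent to \<open>p + 1 \<ge> 2\<close>, where
  \<open>powr_second_difference\<close> applies. The margin \<open>b\<close> keeps the zero inside
  the interval also after \<open>e\<close> is changed by \<open>s\<close> or
  \<open>- s\<close>.\<close>

lemma integral_second_difference:
  fixes p w e l r s b :: real
  assumes p: "p \<ge> 1" and w: "w > 0" and b: "b > 0" "e - w * l \<ge> b" "w * r - e \<ge> b" and s: "\<bar>s\<bar> \<le> b"
  shows "(LINT x:{l..r}|lborel. second_difference p (e - w * x) s) \<ge> 2 * b powr (p - 1) / w * s\<^sup>2"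
proof -
  have "w * l \<le> w * r" using b by linarith
  then have lr: "l \<le> r" using w by simp
  let ?I = "\<lambda>e. LINT x:{l..r}|lborel. \<bar>e - w * x\<bar> powr p"
  have int: "set_integrable lborel {l..r} (\<lambda>x. \<bar>e - w * x\<bar> powr p)" for e
    using p by (intro set_integrable_compact continuous_intros) auto
  have I: "?I e' = ((e' - w * l) powr (p + 1) + (w * r - e') powr (p + 1)) / (w * (p + 1))"
    if "\<bar>e' - e\<bar> \<le> b" for e'
    using that b by (intro integral_abs_affine_powr p w lr) auto
  have D: "(c + s) powr (p + 1) + (c - s) powr (p + 1) - 2 * c powr (p + 1) \<ge> (p + 1) * b powr (p - 1) * s\<^sup>2"
    if "c \<ge> b" for c
  proof -
    have "(p + 1) * b powr (p - 1) * s\<^sup>2 \<le> (p + 1) * c powr (p - 1) * s\<^sup>2"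
      using that b(1) p by (intro mult_right_mono mult_left_mono powr_mono2) auto
    moreover have "(p + 1) * c powr (p - 1) * s\<^sup>2 \<le> (c + s) powr (p + 1) + (c - s) powr (p + 1) - 2 * c powr (p + 1)"
      using powr_second_difference[of "p + 1" c s] that b(1) p s by simp
    ultimately show ?thesis by (rule order_trans)
  qed
  have "(LINT x:{l..r}|lborel. second_difference p (e - w * x) s)
     = (LINT x:{l..r}|lborel. \<bar>(e + s) - w * x\<bar> powr p + \<bar>(e - s) - w * x\<bar> powr p - 2 * \<bar>e - w * x\<bar> powr p)"
    by (simp add: second_difference_def algebra_simps)
  also have "\<dots> = ?I (e + s) + ?I (e - s) - 2 * ?I e"
    using int by simp
  also have "\<dots> = (((e - w * l + s) powr (p + 1) + (e - w * l - s) powr (p + 1) - 2 * (e - w * l) powr (p + 1))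
      + ((w * r - e + s) powr (p + 1) + (w * r - e - s) powr (p + 1) - 2 * (w * r - e) powr (p + 1))) / (w * (p + 1))"
  proof -
    have "?I (e + s) = ((e - w * l + s) powr (p + 1) + (w * r - e - s) powr (p + 1)) / (w * (p + 1))"
      using I[of "e + s"] s b(1) by (simp add: diff_diff_eq add_diff_eq diff_add_eq)
    moreover have "?I (e - s) = ((e - w * l - s) powr (p + 1) + (w * r - e + s) powr (p + 1)) / (w * (p + 1))"
      using I[of "e - s"] s b(1) by (simp add: algebra_simps)
    moreover have "?I e = ((e - w * l) powr (p + 1) + (w * r - e) powr (p + 1)) / (w * (p + 1))"
      using I[of e] b(1) by simp
    moreover have "x / c + y / c - 2 * (z / c) = (x + y - 2 * z) / c" for x y z c :: real
      by (simp add: add_divide_distrib diff_divide_distrib)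
    ultimately show ?thesis by (simp only:) (simp add: algebra_simps)
  qed
  also have "\<dots> \<ge> ((p + 1) * b powr (p - 1) * s\<^sup>2 + (p + 1) * b powr (p - 1) * s\<^sup>2) / (w * (p + 1))"
    using p w by (intro divide_right_mono add_mono D b) auto
  also have "((p + 1) * b powr (p - 1) * s\<^sup>2 + (p + 1) * b powr (p - 1) * s\<^sup>2) / (w * (p + 1)) = 2 * b powr (p - 1) / w * s\<^sup>2"
  proof -
    have "((p + 1) * x + (p + 1) * x) / (w * (p + 1)) = 2 * x / w" for x
      using p w by (simp add: divide_simps)
    from this[of "b powr (p - 1) * s\<^sup>2"] show ?thesis by (simp add: mult.assoc)
  qed
  finally show ?thesis .
qed

text \<open>Take the second point near the centroid and integrate over its first coordinate: there the slope is
  constant and nonzero, and the base changes sign, which yields a gain even for \<open>p = 1\<close>.\<close>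

lemma shear_moment_gain:
  assumes K: "convex_disc K" and ud: "\<exists>u\<in>K. u$2 > 0" "\<exists>d\<in>K. d$2 < 0" and p: "p \<ge> 1"
  obtains c t0 where "c > 0" "t0 > 0"
    "\<And>t. \<bar>t\<bar> \<le> t0 \<Longrightarrow> shear_moment p K t + shear_moment p K (- t) - 2 * shear_moment p K 0 \<ge> c * t\<^sup>2"
proof -
  have cK: "compact K" using K by (simp add: convex_disc_def)
  let ?g = "centroid K"
  have g: "?g \<in> interior K" by (rule centroid_in_interior[OF K])
  define m where "m = shear_const K - max (?g$2) 0"
  have m: "m > 0" using shear_const_gt[OF K ud] by (simp add: m_def)
  obtain r0 where r0: "r0 > 0" "cball ?g r0 \<subseteq> K"
    using g interior_subset by (metis open_contains_cball open_interior subset_trans)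
  \<comment> \<open>Directly above the centroid, where the slope of the pair \<open>(x1, ?g)\<close>
    is \<open>m * (r0 / 2)\<close>; half of this, \<beta>, remains a lower bound nearby.\<close>
  define x1 where "x1 = ?g + (r0 / 2) *\<^sub>R axis 2 1"
  have x1_2: "x1$2 - ?g$2 = r0 / 2" by (simp add: x1_def axis_def)
  have sx: "shear_slope K (x1, ?g) = m * (r0 / 2)"
    unfolding shear_slope_def m_def by (simp add: x1_2 algebra_simps)
  define \<beta> where "\<beta> = m * (r0 / 2) / 2"
  have \<beta>: "\<beta> > 0" using m r0 by (simp add: \<beta>_def)
  have "open {z. \<beta> < shear_slope K z}"
    by (intro open_Collect_less continuous_intros)
  moreover have "(x1, ?g) \<in> {z. \<beta> < shear_slope K z}"
    using sx mult_pos_pos[OF m r0(1)] by (simp add: \<beta>_def)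
  ultimately obtain r1 where r1: "r1 > 0" "ball (x1, ?g) r1 \<subseteq> {z. \<beta> < shear_slope K z}"
    by (meson openE)
  \<comment> \<open>The bound \<open>r0 / 4\<close> keeps the first point at height at least
    \<open>w0\<close> above the centroid; \<open>r1 / 2\<close> places the product of the two balls
    in the ball where the slope exceeds \<beta>.\<close>
  define r where "r = min (r0 / 4) (r1 / 2)"
  have r: "r > 0" "r \<le> r0 / 4" "r \<le> r1 / 2" using r0 r1 by (auto simp: r_def)
  have slope: "\<beta> < shear_slope K (x, y)" if "x \<in> cball x1 r" "y \<in> cball ?g r" for x y
  proof -
    have "dist (x1, ?g) (x, y) \<le> sqrt (r\<^sup>2 + r\<^sup>2)"
      unfolding dist_Pair_Pair using that by (intro real_sqrt_le_mono add_mono power_mono) auto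
    also have "\<dots> = sqrt 2 * r" using r(1) by (simp add: real_sqrt_mult)
    also have "\<dots> < 2 * r" using r(1) real_sqrt_less_mono[of 2 4] by simp
    also have "\<dots> \<le> r1" using r by simp
    finally show ?thesis using r1(2) by auto
  qed
  define w0 where "w0 = r0 / 4"
  have w0: "w0 > 0" using r0 by (simp add: w0_def)
  have w: "w0 \<le> x$2 - ?g$2" "x$2 - ?g$2 \<le> r0" "\<bar>x$1 - ?g$1\<bar> \<le> r0" if "x \<in> cball x1 r" for x
  proof -
    have d: "norm (x1 - x) \<le> r" using that by (simp add: dist_norm)
    have "\<bar>x1$2 - x$2\<bar> \<le> r" "\<bar>x1$1 - x$1\<bar> \<le> r"
      using component_le_norm_cart[of "x1 - x" 2] component_le_norm_cart[of "x1 - x" 1] d by auto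
    moreover have "x1$1 = ?g$1" by (simp add: x1_def axis_def)
    ultimately show "w0 \<le> x$2 - ?g$2" "x$2 - ?g$2 \<le> r0" "\<bar>x$1 - ?g$1\<bar> \<le> r0"
      using x1_2 r unfolding w0_def by linarith+
  qed
  have B1K: "cball x1 r \<subseteq> K"
  proof -
    have "dist x1 ?g = r0 / 2" using r0 by (simp add: x1_def dist_norm)
    then have "cball x1 r \<subseteq> cball ?g r0"
      using r r0 by (simp add: cball_subset_cball_iff dist_commute)
    then show ?thesis using r0 by blast
  qed
  define \<rho> where "\<rho> = r / 2"
  \<comment> \<open>The rectangle is flat: varying \<open>y\<close> over its height moves the
    determinant by at most \<open>r0 * \<rho>'\<close>, hence by at most the \<open>b\<close>
    defined below. Across the half width it varies by at least \<open>2 * b\<close>, so a margin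
    \<open>b\<close> is left at both ends.\<close>
  define \<rho>' where "\<rho>' = min \<rho> (w0 * \<rho> / (2 * r0))"
  have \<rho>: "\<rho> > 0" "\<rho>' > 0" "\<rho>' \<le> \<rho>" "r0 * \<rho>' \<le> w0 * \<rho> / 2"
    using r r0 w0 by (auto simp: \<rho>_def \<rho>'_def min_def field_simps)
  let ?X = "{?g$1 - \<rho>..?g$1 + \<rho>}" and ?Y = "{?g$2 - \<rho>'..?g$2 + \<rho>'}"
  define B2 where "B2 = vec2 ` (?X \<times> ?Y)"
  have B2: "compact B2"
    unfolding B2_def by (intro compact_continuous_image continuous_on_vec2 compact_Times) auto
  have B2r: "vec2 (x, y) \<in> cball ?g r" if "x \<in> ?X" "y \<in> ?Y" for x y
  proof -
    have "norm (vec2 (x, y) - ?g) \<le> \<bar>x - ?g$1\<bar> + \<bar>y - ?g$2\<bar>"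
      using norm_le_l1_cart[of "vec2 (x, y) - ?g"] by (simp add: sum_2)
    also have "\<dots> \<le> r" using that \<rho> by (auto simp: \<rho>_def abs_le_iff)
    finally show ?thesis by (simp add: dist_norm norm_minus_commute)
  qed
  have "cball ?g r \<subseteq> K" using r r0 by (auto simp: subset_iff)
  then have B2K: "B2 \<subseteq> K" using B2r by (auto simp: B2_def)
  define b where "b = w0 * \<rho> / 2"
  have b: "b > 0" using w0 \<rho> by (simp add: b_def)
  obtain S where S: "S > 0" "\<And>z. z \<in> cball x1 r \<times> cball ?g r \<Longrightarrow> \<bar>shear_slope K z\<bar> \<le> S"
  proof -
    have "bounded (shear_slope K ` (cball x1 r \<times> cball ?g r))"
      by (intro compact_imp_bounded compact_continuous_image continuous_intros compact_Times) auto
    then show thesis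
      using that unfolding bounded_pos by (auto simp: image_iff) 
  qed
  \<comment> \<open>This makes the perturbation \<open>t * shear_slope\<close> at most
    \<open>b\<close>, as \<open>integral_second_difference\<close> demands.\<close>
  define t0 where "t0 = b / S"
  have t0: "t0 > 0" using b S by (simp add: t0_def)
  \<comment> \<open>The gain on one horizontal segment, with the slope bounded below by \<beta> and
    the coefficient \<open>v\<close> above by \<open>r0\<close>. In \<open>c\<close> it is
    multiplied by the height of the rectangle and the area of the ball of first points.\<close>
  define c1 where "c1 = 2 * b powr (p - 1) / r0 * \<beta>\<^sup>2"
  have c1: "c1 > 0" using b r0 \<beta> by (simp add: c1_def)
  define c where "c = measure lborel (cball x1 r) * (2 * \<rho>' * c1)"
  have c: "c > 0" using c1 \<rho> r by (simp add: c_def content_cball_pos)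
  let ?D = "\<lambda>t z. second_difference p (shear_base K z) (t * shear_slope K z)"
  have cD: "continuous_on A (?D t)" for A t
    unfolding second_difference_def using p by (intro continuous_intros)
  have inner: "(LINT y:B2|lborel. ?D t (x, y)) \<ge> 2 * \<rho>' * c1 * t\<^sup>2" if x: "x \<in> cball x1 r" and t: "\<bar>t\<bar> \<le> t0" for x t
  proof -
    have cDx: "continuous_on A (\<lambda>y. ?D t (x, y))" for A
      by (rule continuous_on_compose2[OF cD[of UNIV]]) (auto intro!: continuous_intros)
    define u where "u = x$1 - ?g$1"
    define v where "v = x$2 - ?g$2"
    have uv: "w0 \<le> v" "v \<le> r0" "\<bar>u\<bar> \<le> r0" using w[OF x] by (auto simp: u_def v_def)
    have "(LINT z:?X|lborel. ?D t (x, vec2 (z, y))) \<ge> c1 * t\<^sup>2" if y: "y \<in> ?Y" for y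
    proof -
      define e where "e = u * (y - ?g$2) + v * ?g$1"
      define s where "s = t * shear_slope K (x, vec2 (?g$1, y))"
      have base: "shear_base K (x, vec2 (z, y)) = e - v * z" for z
        by (simp add: shear_base_def cross2_def e_def u_def v_def algebra_simps)
      have sl: "t * shear_slope K (x, vec2 (z, y)) = s" for z
        by (simp add: shear_slope_def s_def)
      have "\<bar>u * (y - ?g$2)\<bar> \<le> r0 * \<rho>'"
        unfolding abs_mult using uv y by (intro mult_mono) auto
      then have uy: "\<bar>u * (y - ?g$2)\<bar> \<le> b" using \<rho>(4) by (simp add: b_def)
      have vr: "v * \<rho> \<ge> 2 * b" using uv \<rho> by (simp add: b_def)
      have g2: "vec2 (?g$1, y) \<in> cball ?g r" using B2r[of "?g$1" y] y \<rho> by auto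
      have "\<bar>s\<bar> \<le> t0 * S"
        unfolding s_def abs_mult using t S(1) S(2)[of "(x, vec2 (?g$1, y))"] x g2 by (intro mult_mono) auto
      also have "\<dots> = b" using S by (simp add: t0_def)
      finally have sb: "\<bar>s\<bar> \<le> b" .
      have "2 * b powr (p - 1) / v * s\<^sup>2 \<le> (LINT z:?X|lborel. second_difference p (e - v * z) s)"
      proof (rule integral_second_difference[OF p _ b _ _ sb])
        show "v > 0" using uv w0 by simp
        show "b \<le> e - v * (?g$1 - \<rho>)" "b \<le> v * (?g$1 + \<rho>) - e"
          using uy vr by (auto simp: e_def algebra_simps)
      qed
      moreover have "c1 * t\<^sup>2 \<le> 2 * b powr (p - 1) / v * s\<^sup>2"
      proof -
        have "(\<beta> * \<bar>t\<bar>)\<^sup>2 \<le> \<bar>s\<bar>\<^sup>2"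
          unfolding s_def abs_mult
          using slope[OF x g2] \<beta> mult_left_mono[of \<beta> "shear_slope K (x, vec2 (?g$1, y))" "\<bar>t\<bar>"]
          by (intro power_mono) (auto simp: mult.commute)
        then have "\<beta>\<^sup>2 * t\<^sup>2 \<le> s\<^sup>2" by (simp add: power_mult_distrib)
        moreover have "2 * b powr (p - 1) / r0 \<le> 2 * b powr (p - 1) / v"
          using uv w0 by (intro divide_left_mono) auto
        ultimately have "2 * b powr (p - 1) / r0 * (\<beta>\<^sup>2 * t\<^sup>2) \<le> 2 * b powr (p - 1) / v * s\<^sup>2"
          using uv w0 by (intro mult_mono) auto
        then show ?thesis by (simp add: c1_def mult.assoc)
      qed
      ultimately show ?thesis by (simp add: base sl)
    qed
    then have "(LINT y:?Y|lborel. c1 * t\<^sup>2) \<le> (LINT y:?Y|lborel. LINT z:?X|lborel. ?D t (x, vec2 (z, y)))"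
    proof (intro set_integral_mono)
      have "continuous_on (?Y \<times> ?X) (\<lambda>z. ?D t (x, vec2 (snd z, fst z)))"
        by (intro continuous_on_compose2[OF cD[of UNIV]] continuous_on_compose2[OF continuous_on_vec2[of UNIV]]
            continuous_intros) auto
      from set_integrable_inner[OF _ _ this]
      show "set_integrable lborel ?Y (\<lambda>y. LINT z:?X|lborel. ?D t (x, vec2 (z, y)))"
        by simp
    qed (auto intro: set_integrable_compact)
    also have "\<dots> = (LINT y:B2|lborel. ?D t (x, y))"
      unfolding B2_def by (rule set_integral_rectangle[OF cDx, symmetric])
    also have "(LINT y:?Y|lborel. c1 * t\<^sup>2) = 2 * \<rho>' * c1 * t\<^sup>2"
      using \<rho> by (simp add: set_lebesgue_integral_def)
    finally show ?thesis .
  qed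
  show thesis
  proof (rule that[OF c t0])
    fix t assume t: "\<bar>t\<bar> \<le> t0"
    have "c * t\<^sup>2 = (LINT x:cball x1 r|lborel. 2 * \<rho>' * c1 * t\<^sup>2)"
      by (simp add: set_integral_const_compact c_def)
    also have "\<dots> \<le> (LINT x:cball x1 r|lborel. LINT y:B2|lborel. ?D t (x, y))"
      using inner t by (intro set_integral_mono set_integrable_inner B2 cD set_integrable_compact) auto
    also have "\<dots> = (LINT z:cball x1 r \<times> B2|lborel. ?D t z)"
      by (rule set_integral_Times[symmetric]) (auto intro: B2 cD)
    \<comment> \<open>All remaining pairs contribute nonnegatively, by convexity.\<close>
    also have "\<dots> \<le> (LINT z:K\<times>K|lborel. ?D t z)"
      using B1K B2K B2 cK by (intro set_integral_mono_compact compact_Times cD second_difference_nonneg p) auto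
    also have "\<dots> = shear_moment p K t + shear_moment p K (- t) - 2 * shear_moment p K 0"
      using set_integrable_shear_moment[OF cK p, of t] set_integrable_shear_moment[OF cK p, of "-t"]
        set_integrable_shear_moment[OF cK p, of 0]
      unfolding second_difference_def shear_moment_def by simp
    finally show "c * t\<^sup>2 \<le> shear_moment p K t + shear_moment p K (- t) - 2 * shear_moment p K 0" .
  qed
qed

section \<open>Ball-exposed points\<close>

text \<open>With \<open>g = 2 *\<^sub>R (z - a)\<close> the inequality reads \<open>norm (x - z) \<le> norm (a - z)\<close>; arbitrary
  \<open>g\<close> make the notion affinely invariant.\<close>

definition ball_exposed :: "(real^2) set \<Rightarrow> real^2 \<Rightarrow> bool" where
  "ball_exposed K a \<longleftrightarrow> a \<in> K \<and> (\<exists>g. \<forall>x\<in>K. (norm (x - a))\<^sup>2 \<le> g \<bullet> (x - a))"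

lemma ball_exposed_farthest:
  assumes "a \<in> K" "\<And>x. x \<in> K \<Longrightarrow> dist z x \<le> dist z a"
  shows "ball_exposed K a"
proof -
  have "(norm (x - a))\<^sup>2 \<le> (2 *\<^sub>R (z - a)) \<bullet> (x - a)" if "x \<in> K" for x
  proof -
    have "(norm (z - x))\<^sup>2 \<le> (norm (z - a))\<^sup>2"
      using assms(2)[OF that] by (intro power_mono) (auto simp: dist_norm)
    then show ?thesis
      unfolding power2_norm_eq_inner by (simp add: inner_simps inner_commute algebra_simps)
  qed
  with assms(1) show ?thesis unfolding ball_exposed_def by blast
qed

text \<open>The image of the touching circle is an ellipse. The norm bound of \<open>A\<close>
  encloses it in a larger circle with the same contact point, and \<open>g\<close> is transported by
  the adjoint of the left inverse.\<close>

lemma ball_exposed_affine: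
  assumes a: "ball_exposed K a" and A: "linear A" "inj A"
  shows "ball_exposed ((\<lambda>x. v + A x) ` K) (v + A a)"
proof -
  obtain g where g: "\<And>x. x \<in> K \<Longrightarrow> (norm (x - a))\<^sup>2 \<le> g \<bullet> (x - a)"
    using a by (auto simp: ball_exposed_def)
  obtain A' where A': "linear A'" "\<And>x. A' (A x) = x"
    using linear_injective_left_inverse[OF A] by (auto simp: fun_eq_iff)
  obtain B where B: "B > 0" "\<And>x. norm (A x) \<le> B * norm x"
    using linear_bounded_pos[OF A(1)] by auto
  have "(norm (v + A x - (v + A a)))\<^sup>2 \<le> (B\<^sup>2 *\<^sub>R adjoint A' g) \<bullet> (v + A x - (v + A a))" if "x \<in> K" for x
  proof -
    have eq: "v + A x - (v + A a) = A (x - a)" using linear_diff[OF A(1)] by simp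
    have "(norm (A (x - a)))\<^sup>2 \<le> (B * norm (x - a))\<^sup>2"
      using B(2) by (intro power_mono) auto
    also have "\<dots> = B\<^sup>2 * (norm (x - a))\<^sup>2" by (simp add: power_mult_distrib)
    also have "\<dots> \<le> B\<^sup>2 * (g \<bullet> (x - a))" using g[OF that] by (intro mult_left_mono) auto
    also have "\<dots> = (B\<^sup>2 *\<^sub>R adjoint A' g) \<bullet> A (x - a)"
      using adjoint_works[OF A'(1), of "A (x - a)" g] A'(2)[of "x - a"] by (simp add: inner_commute)
    finally show ?thesis unfolding eq .
  qed
  with a show ?thesis unfolding ball_exposed_def by blast
qed

text \<open>The functional \<open>g\<close> attains its minimum over \<open>K\<close> at
  \<open>a\<close> alone, so an open half-plane missing \<open>a\<close> contains all other points
  of \<open>K\<close>.\<close>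

lemma ball_exposed_hull:
  assumes a: "ball_exposed K a" and S: "S \<subseteq> K" "a \<in> convex hull S"
  shows "a \<in> S"
proof (rule ccontr)
  assume "a \<notin> S"
  obtain g where g: "\<And>x. x \<in> K \<Longrightarrow> (norm (x - a))\<^sup>2 \<le> g \<bullet> (x - a)"
    using a by (auto simp: ball_exposed_def)
  have "S \<subseteq> {x. g \<bullet> x > g \<bullet> a}"
  proof
    fix x assume "x \<in> S"
    then have "x \<noteq> a" using \<open>a \<notin> S\<close> by auto
    then have "0 < (norm (x - a))\<^sup>2" by simp
    also have "\<dots> \<le> g \<bullet> (x - a)" using \<open>x \<in> S\<close> S(1) by (intro g) auto
    finally show "x \<in> {x. g \<bullet> x > g \<bullet> a}"
      by (simp add: inner_diff_right)
  qed
  then have "convex hull S \<subseteq> {x. g \<bullet> x > g \<bullet> a}"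
    by (intro hull_minimal) (simp_all add: convex_halfspace_gt)
  with S(2) show False by auto
qed

text \<open>The argument of Straszewicz's theorem: a line separates a missed point \<open>z\<close>
  from the closed hull. Seen from a centre far away on the side of the hull, the farthest point of
  \<open>K\<close> is exposed but lies on the side of \<open>z\<close>.\<close>

lemma hull_ball_exposed:
  assumes K: "compact K"
  shows "K \<subseteq> closure (convex hull {a. ball_exposed K a})"
proof
  fix z assume z: "z \<in> K"
  let ?C = "closure (convex hull {a. ball_exposed K a})"
  show "z \<in> ?C"
  proof (rule ccontr)
    assume "z \<notin> ?C"
    then obtain u b where ub: "u \<bullet> z < b" "\<And>x. x \<in> ?C \<Longrightarrow> u \<bullet> x > b"
      using separating_hyperplane_closed_point[of ?C z] by (auto intro: convex_closure)
    obtain D where D: "D > 0" "\<And>x. x \<in> K \<Longrightarrow> norm (x - z) \<le> D"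
    proof -
      obtain e where "\<forall>x\<in>K. dist z x \<le> e"
        using compact_imp_bounded[OF K] bounded_any_center by blast
      then show thesis
        by (intro that[of "max e 1"]) (auto simp: dist_norm norm_minus_commute le_max_iff_disj)
    qed
    \<comment> \<open>Just large enough: \<open>D\<^sup>2 = 2 * R * (b - u \<bullet> z)\<close>, so
      the curvature of the circle cannot carry the farthest point across the separating
      line.\<close>
    define R where "R = D\<^sup>2 / (2 * (b - u \<bullet> z))"
    have R: "R > 0" using ub D by (simp add: R_def)
    obtain a where a: "a \<in> K" "\<And>x. x \<in> K \<Longrightarrow> dist (z + R *\<^sub>R u) x \<le> dist (z + R *\<^sub>R u) a"
      using distance_attains_sup[OF K, of "z + R *\<^sub>R u"] z by blast
    have "a \<in> ?C"
      using ball_exposed_farthest[OF a] by (meson closure_subset hull_inc mem_Collect_eq subsetD)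
    then have "u \<bullet> a > b" by (rule ub)
    have "(norm (R *\<^sub>R u))\<^sup>2 \<le> (norm ((z - a) + R *\<^sub>R u))\<^sup>2"
      using a(2)[OF z] by (intro power_mono) (auto simp: dist_norm algebra_simps)
    then have "2 * R * (u \<bullet> (a - z)) \<le> (norm (a - z))\<^sup>2"
      unfolding power2_norm_eq_inner by (simp add: inner_simps inner_commute algebra_simps)
    also have "\<dots> \<le> D\<^sup>2" using D(2)[OF a(1)] by (intro power_mono) auto
    also have "\<dots> = 2 * R * (b - u \<bullet> z)" using ub by (simp add: R_def field_simps)
    also have "\<dots> < 2 * R * (u \<bullet> (a - z))"
      using \<open>u \<bullet> a > b\<close> R by (intro mult_strict_left_mono) (auto simp: inner_diff_right)
    finally show False by simp
  qed
qed

text \<open>With at most three exposed points their hull is already closed, so it equals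
  \<open>K\<close>, which would then be a triangle.\<close>

lemma not_simplex_obtain_exposed:
  assumes K: "convex_disc K" and n: "\<not> 2 simplex K"
  obtains Y where "card Y = 4" "\<And>y. y \<in> Y \<Longrightarrow> ball_exposed K y" "\<And>y. y \<in> Y \<Longrightarrow> y \<notin> convex hull (Y - {y})"
proof -
  have cK: "compact K" "convex K" "interior K \<noteq> {}" using K by (auto simp: convex_disc_def)
  let ?X = "{a. ball_exposed K a}"
  have XK: "?X \<subseteq> K" by (auto simp: ball_exposed_def)
  have "infinite ?X \<or> card ?X \<ge> 4"
  proof (rule ccontr)
    assume "\<not> ?thesis"
    then have X: "finite ?X" "card ?X \<le> 3" by auto
    have "closed (convex hull ?X)" using X by (intro compact_imp_closed finite_imp_compact_convex_hull)
    then have "K \<subseteq> convex hull ?X" using hull_ball_exposed[OF cK(1)] by simp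
    moreover have "convex hull ?X \<subseteq> K" by (rule hull_minimal[where S = convex, OF XK cK(2)])
    ultimately have eq: "K = convex hull ?X" by simp
    then have "2 simplex (convex hull ?X)"
      using cK(3) X by (intro interior_hull_card_3) auto
    then show False using n eq by simp
  qed
  then obtain Y where Y: "Y \<subseteq> ?X" "card Y = 4"
    by (metis infinite_arbitrarily_large obtain_subset_with_card_n)
  have "y \<notin> convex hull (Y - {y})" if "y \<in> Y" for y
    using ball_exposed_hull[of K y "Y - {y}"] Y XK that by blast
  with Y show thesis by (intro that[of Y]) auto
qed

text \<open>Dropping the square in the first coordinate from each circle inequality leaves a
  parabola. Testing each inequality at the other end of the chord shows that the coefficients
  \<open>m\<close> and \<open>n\<close> divided by are at least 1; \<kappa> is a common lower bound
  of \<open>1 / m\<close> and \<open>1 / n\<close>.\<close>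

lemma exposed_parabolas:
  assumes "ball_exposed K 0" "ball_exposed K (axis 1 1)"
  obtains \<kappa> \<sigma> \<tau> where "\<kappa> > 0" "\<And>x. x \<in> K \<Longrightarrow> x$1 \<le> 1 + \<sigma> * x$2 - \<kappa> * (x$2)\<^sup>2"
    "\<And>x. x \<in> K \<Longrightarrow> x$1 \<ge> \<tau> * x$2 + \<kappa> * (x$2)\<^sup>2"
proof -
  obtain g where g: "\<And>x. x \<in> K \<Longrightarrow> (norm (x - axis 1 1))\<^sup>2 \<le> g \<bullet> (x - axis 1 1)"
    using assms by (auto simp: ball_exposed_def)
  obtain h where h: "\<And>x. x \<in> K \<Longrightarrow> (norm x)\<^sup>2 \<le> h \<bullet> x"
    using assms by (auto simp: ball_exposed_def)
  have in_K: "0 \<in> K" "axis 1 1 \<in> K" using assms by (auto simp: ball_exposed_def)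
  have g': "(x$1 - 1)\<^sup>2 + (x$2)\<^sup>2 \<le> g$1 * (x$1 - 1) + g$2 * x$2" if "x \<in> K" for x
    using g[OF that] unfolding power2_norm_eq_inner
    by (simp add: inner_vec_def sum_2 axis_def power2_eq_square)
  have h': "(x$1)\<^sup>2 + (x$2)\<^sup>2 \<le> h$1 * x$1 + h$2 * x$2" if "x \<in> K" for x
    using h[OF that] unfolding power2_norm_eq_inner
    by (simp add: inner_vec_def sum_2 power2_eq_square)
  define m n where "m = - g$1" and "n = h$1"
  have m: "m \<ge> 1" using g'[OF in_K(1)] by (simp add: m_def)
  have n: "n \<ge> 1" using h'[OF in_K(2)] by (simp add: n_def axis_def)
  define \<kappa> where "\<kappa> = 1 / (m + n)"
  show thesis
  proof (rule that[of \<kappa> "g$2 / m" "- (h$2 / n)"])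
    show "\<kappa> > 0" using m n by (simp add: \<kappa>_def)
    fix x assume x: "x \<in> K"
    have "\<kappa> * (x$2)\<^sup>2 \<le> (1 / m) * (x$2)\<^sup>2" "\<kappa> * (x$2)\<^sup>2 \<le> (1 / n) * (x$2)\<^sup>2"
      using m n by (auto simp: \<kappa>_def intro!: mult_right_mono divide_left_mono)
    moreover have "m * (x$1 - 1) \<le> g$2 * x$2 - (x$2)\<^sup>2"
      using g'[OF x] zero_le_power2[of "x$1 - 1"] unfolding m_def mult_minus_left by linarith
    then have "x$1 - 1 \<le> (g$2 * x$2 - (x$2)\<^sup>2) / m"
      using m by (simp add: pos_le_divide_eq mult.commute)
    moreover have "(x$2)\<^sup>2 - h$2 * x$2 \<le> n * x$1"
      using h'[OF x] zero_le_power2[of "x$1"] unfolding n_def by linarith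
    then have "((x$2)\<^sup>2 - h$2 * x$2) / n \<le> x$1"
      using n by (simp add: pos_divide_le_eq mult.commute)
    ultimately show "x$1 \<le> 1 + g$2 / m * x$2 - \<kappa> * (x$2)\<^sup>2" "x$1 \<ge> - (h$2 / n) * x$2 + \<kappa> * (x$2)\<^sup>2"
      by (simp_all add: diff_divide_distrib)
  qed
qed

section \<open>Strict improvement\<close>

lemma convex_slice:
  fixes W :: "(real^2) set"
  assumes "convex W"
  shows "convex {x. vec2 (x, y) \<in> W}"
  unfolding convex_alt
proof (intro ballI allI impI)
  fix a b u :: real assume ab: "a \<in> {x. vec2 (x, y) \<in> W}" "b \<in> {x. vec2 (x, y) \<in> W}" and u: "0 \<le> u \<and> u \<le> 1"
  have "vec2 ((1 - u) *\<^sub>R a + u *\<^sub>R b, y) = (1 - u) *\<^sub>R vec2 (a, y) + u *\<^sub>R vec2 (b, y)"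
    by (rule vec2_eqI) (auto simp: algebra_simps)
  then show "(1 - u) *\<^sub>R a + u *\<^sub>R b \<in> {x. vec2 (x, y) \<in> W}"
    using convexD_alt[OF assms, of "vec2 (a, y)" "vec2 (b, y)" u] ab u by simp
qed

lemma compact_slice:
  fixes W :: "(real^2) set"
  assumes W: "compact W"
  shows "compact {x. vec2 (x, y) \<in> W}"
proof -
  have "closed ((\<lambda>x. vec2 (x, y)) -` W)"
    using compact_imp_closed[OF W] by (intro closed_vimage) (auto simp: vec2_def intro!: continuous_intros)
  moreover have "bounded ((\<lambda>x. vec2 (x, y)) -` W)"
  proof -
    have "(\<lambda>x. vec2 (x, y)) -` W \<subseteq> (\<lambda>z. z$1) ` W"
      by (auto simp: image_iff) (metis fst_conv vec2_nth(1))
    moreover have "bounded ((\<lambda>z. z$1) ` W)"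
      using compact_imp_bounded[OF W] by (rule bounded_linear_image[OF _ bounded_linear_vec_nth])
    ultimately show ?thesis by (rule bounded_subset[rotated])
  qed
  ultimately show ?thesis by (simp add: compact_eq_bounded_closed vimage_def)
qed

text \<open>Fubini: at heights in \<open>[-\<delta>, \<delta>]\<close> a slice of \<open>K\<close>
  exceeds the interval slice of \<open>W\<close> by at most \<eta> at each end, and at other heights
  by nothing.\<close>

lemma area_diff_le:
  fixes W K :: "(real^2) set"
  assumes W: "compact W" and K: "compact K" and WK: "W \<subseteq> K"
    and conv: "\<And>y. convex {x. vec2 (x, y) \<in> W}" and \<delta>: "\<delta> \<ge> 0" and \<eta>: "\<eta> \<ge> 0"
    and near: "\<And>z. z \<in> K - W \<Longrightarrow> \<bar>z$2\<bar> \<le> \<delta> \<and> (\<exists>w\<in>W. w$2 = z$2 \<and> \<bar>z$1 - w$1\<bar> \<le> \<eta>)"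
  shows "area K - area W \<le> 4 * \<delta> * \<eta>"
proof -
  have m [measurable]: "K \<in> sets borel" "W \<in> sets borel" using W K by (auto intro: borel_compact)
  have slice: "emeasure lborel {x. vec2 (x, y) \<in> K - W} \<le> ennreal (2 * \<eta>) * indicator {-\<delta>..\<delta>} y" for y
  proof -
    obtain l r where lr: "{x. vec2 (x, y) \<in> W} = {l..r}"
      using connected_compact_interval_1[of "{x. vec2 (x, y) \<in> W}"] convex_connected[OF conv] compact_slice[OF W]
      by blast
    have "{x. vec2 (x, y) \<in> K - W} \<subseteq> {l - \<eta>..l} \<union> {r..r + \<eta>}"
    proof
      fix x assume x: "x \<in> {x. vec2 (x, y) \<in> K - W}"
      then obtain w where w: "w \<in> W" "w$2 = y" "\<bar>x - w$1\<bar> \<le> \<eta>"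
        using near[of "vec2 (x, y)"] by auto
      have "vec2 (w$1, y) = w" using w by (intro vec2_eqI) auto
      then have "w$1 \<in> {l..r}" using w lr by auto
      moreover have "x \<notin> {l..r}" using x unfolding lr[symmetric] by simp
      ultimately show "x \<in> {l - \<eta>..l} \<union> {r..r + \<eta>}" using w(3) by auto
    qed
    then have "emeasure lborel {x. vec2 (x, y) \<in> K - W} \<le> emeasure lborel ({l - \<eta>..l} \<union> {r..r + \<eta>})"
      by (intro emeasure_mono) auto
    also have "\<dots> \<le> emeasure lborel {l - \<eta>..l} + emeasure lborel {r..r + \<eta>}"
      by (intro emeasure_subadditive) auto
    also have "\<dots> = ennreal (2 * \<eta>)"
      using \<eta> by (simp flip: ennreal_plus)
    finally have *: "emeasure lborel {x. vec2 (x, y) \<in> K - W} \<le> ennreal (2 * \<eta>)" .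
    show ?thesis
    proof (cases "\<bar>y\<bar> \<le> \<delta>")
      case True
      then show ?thesis using * by (simp add: abs_le_iff minus_le_iff)
    next
      case False
      then have "{x. vec2 (x, y) \<in> K - W} = {}" using near[of "vec2 (_, y)"] by auto
      then show ?thesis by (simp only: emeasure_empty) simp
    qed
  qed
  have "emeasure lborel (K - W) = (\<integral>\<^sup>+y. emeasure lborel {x. vec2 (x, y) \<in> K - W} \<partial>lborel)"
    by (rule emeasure_vec2_slices) simp
  also have "\<dots> \<le> (\<integral>\<^sup>+y. ennreal (2 * \<eta>) * indicator {-\<delta>..\<delta>} y \<partial>lborel)"
    by (intro nn_integral_mono slice)
  also have "\<dots> = ennreal (2 * \<eta>) * ennreal (2 * \<delta>)"
    using \<delta> by (subst nn_integral_cmult_indicator) auto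
  also have "\<dots> = ennreal (4 * \<delta> * \<eta>)"
    using \<delta> \<eta> by (simp add: ennreal_mult[symmetric] mult_ac)
  finally have "emeasure lborel (K - W) \<le> ennreal (4 * \<delta> * \<eta>)" .
  then have "measure lborel (K - W) \<le> 4 * \<delta> * \<eta>"
    unfolding measure_def using \<delta> \<eta> by (intro enn2real_leI) auto
  moreover have "measure lborel (K - W) = measure lborel K - measure lborel W"
    using WK emeasure_bounded_finite[OF compact_imp_bounded[OF K]] by (intro measure_Diff) auto
  ultimately show ?thesis using W K by (simp add: area_compact)
qed

text \<open>A segment between the two parts can leave the sheared disc only across the axis, by at most
  \<open>t\<^sup>2 / (4 * \<kappa>)\<close>, and only if both its ends are within \<open>\<bar>t\<bar> / \<kappa>\<close> of the axis.\<close>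

lemma sheared_hull_near:
  fixes K :: "(real^2) set"
  assumes cK: "convex K" and in_K: "0 \<in> K" "axis 1 1 \<in> K"
    and \<kappa>: "\<kappa> > 0" and r: "\<And>x. x \<in> K \<Longrightarrow> x$1 \<le> 1 + \<sigma> * x$2 - \<kappa> * (x$2)\<^sup>2"
    and l: "\<And>x. x \<in> K \<Longrightarrow> x$1 \<ge> \<tau> * x$2 + \<kappa> * (x$2)\<^sup>2"
    and z: "z \<in> convex hull (shear t ` K) - shear t ` K"
  shows "\<bar>z$2\<bar> \<le> \<bar>t\<bar> / \<kappa> \<and> (\<exists>w\<in>shear t ` K. w$2 = z$2 \<and> \<bar>z$1 - w$1\<bar> \<le> t\<^sup>2 / (4 * \<kappa>))"
proof -
  define U D where "U = K \<inter> {x. x$2 \<ge> 0}" and "D = K \<inter> {x. x$2 \<le> 0}"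
  have hp: "convex {x::real^2. x$2 \<ge> 0}" "convex {x::real^2. x$2 \<le> 0}"
    using linear_halfplane_convex[of 0 1 0] linear_halfplane_convex[of 0 "-1" 0] by simp_all
  have cUD: "convex U" "convex D" unfolding U_def D_def using cK hp by (auto intro: convex_Int)
  have cUt: "convex (shear t ` U)"
  proof -
    have "convex hull U = U" using cUD(1) by (simp only: convex_hull_eq)
    moreover have "shear t ` (convex hull U) = convex hull (shear t ` U)"
      by (rule shear_image_hull_upper) (simp add: U_def)
    ultimately have "shear t ` U = convex hull (shear t ` U)" by simp
    then show ?thesis by (metis convex_convex_hull)
  qed
  have K_UD: "K = U \<union> D" by (auto simp: U_def D_def)
  have sD: "shear t ` D = D" by (rule shear_image_lower) (simp add: D_def)
  have W: "shear t ` K = shear t ` U \<union> D" unfolding K_UD image_Un sD ..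
  have ax: "(1 - c) *\<^sub>R 0 + c *\<^sub>R axis 1 1 \<in> shear t ` U \<inter> D" if "0 \<le> c" "c \<le> 1" for c :: real
  proof -
    have "(1 - c) *\<^sub>R 0 + c *\<^sub>R axis 1 1 \<in> K" using convexD_alt[OF cK in_K] that by blast
    then have "(1 - c) *\<^sub>R 0 + c *\<^sub>R axis 1 1 \<in> U" "(1 - c) *\<^sub>R 0 + c *\<^sub>R axis 1 1 \<in> D"
      by (auto simp: U_def D_def axis_def)
    moreover have "shear t ((1 - c) *\<^sub>R 0 + c *\<^sub>R axis 1 1) = (1 - c) *\<^sub>R 0 + c *\<^sub>R axis 1 1"
      by (rule shear_lower) (simp add: axis_def)
    ultimately show ?thesis by (metis IntI image_eqI)
  qed
  have ne: "shear t ` U \<noteq> {}" "D \<noteq> {}" using ax[of 0] by auto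
  have "z \<in> convex hull (shear t ` U \<union> D)" using z unfolding W by (rule DiffD1)
  then obtain a s u d where as: "0 \<le> a" "0 \<le> s" "a + s = 1" and ud: "u \<in> shear t ` U" "d \<in> D"
    and zas: "z = a *\<^sub>R u + s *\<^sub>R d"
    unfolding convex_hull_union_two[OF cUt ne(1) cUD(2) ne(2)] mem_Collect_eq by (elim exE conjE) rule
  from as have s: "0 \<le> s" "s \<le> 1" and "a = 1 - s" by linarith+
  with zas have zs: "z = (1 - s) *\<^sub>R u + s *\<^sub>R d" by simp
  obtain x where x: "x \<in> U" "u = shear t x" using ud by auto
  define h k where "h = x$2" and "k = - d$2"
  have xK: "x \<in> K" and h: "h \<ge> 0" using x by (auto simp: U_def h_def)
  have dK: "d \<in> K" and k: "k \<ge> 0" using ud by (auto simp: D_def k_def)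
  have u12: "u$1 = x$1 + t * h" "u$2 = h" using h by (auto simp: x h_def)
  have zW: "z \<notin> shear t ` U" "z \<notin> D" using z unfolding W by auto
  have "h \<noteq> 0"
  proof
    assume "h = 0"
    then have "x \<in> D" "u = x" using x by (auto simp: U_def D_def h_def shear_lower)
    then have "z \<in> D" unfolding zs using convexD_alt[OF cUD(2)] ud s by blast
    with zW show False by simp
  qed
  moreover have "k \<noteq> 0"
  proof
    assume "k = 0"
    then have "d \<in> U" "shear t d = d" using ud by (auto simp: U_def D_def k_def shear_lower)
    then have "d \<in> shear t ` U" by (metis image_eqI)
    then have "z \<in> shear t ` U" unfolding zs using convexD_alt[OF cUt] ud s by blast
    with zW show False by simp
  qed
  ultimately have hk: "h > 0" "k > 0" using h k by auto
  \<comment> \<open>The segment from \<open>u\<close> to \<open>d\<close> crosses the axis at first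
    coordinate \<open>c\<close>; \<open>c'\<close> is the nearest point of the unit segment.
    Exchanging the crossing \<open>q\<close> for \<open>q'\<close> in the representation of
    \<open>z\<close> gives a point \<open>w\<close> of the sheared disc at the same height, with
    horizontal error at most \<open>\<bar>c - c'\<bar>\<close>.\<close>
  define c where "c = (k * u$1 + h * d$1) / (h + k)"
  define c' where "c' = max 0 (min 1 c)"
  have c': "0 \<le> c'" "c' \<le> 1" by (auto simp: c'_def)
  define q where "q = vec2 (c, 0)"
  define q' where "q' = (1 - c') *\<^sub>R 0 + c' *\<^sub>R (axis 1 1 :: real^2)"
  have q'12: "q'$1 = c'" "q'$2 = 0" by (auto simp: q'_def axis_def)
  have q'W: "q' \<in> shear t ` U" "q' \<in> D" using ax[OF c'] by (auto simp: q'_def)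
  have q: "(h + k) *\<^sub>R q = k *\<^sub>R u + h *\<^sub>R d"
    using hk by (intro vec2_eqI) (auto simp: q_def c_def u12 k_def)
  have "\<exists>e m. e \<in> {u, d} \<and> 0 \<le> m \<and> m \<le> 1 \<and> z = (1 - m) *\<^sub>R e + m *\<^sub>R q"
  proof (cases "s * (h + k) \<le> h")
    case True
    define m where "m = s * (h + k) / h"
    have "m *\<^sub>R q = (s / h) *\<^sub>R ((h + k) *\<^sub>R q)" by (simp add: m_def)
    also have "\<dots> = (s / h * k) *\<^sub>R u + s *\<^sub>R d" unfolding q using hk by (simp add: scaleR_add_right)
    finally have "(1 - m) *\<^sub>R u + m *\<^sub>R q = ((1 - m) + s / h * k) *\<^sub>R u + s *\<^sub>R d"
      by (simp add: scaleR_add_left)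
    also have "(1 - m) + s / h * k = 1 - s" using hk by (simp add: m_def field_simps)
    finally have "z = (1 - m) *\<^sub>R u + m *\<^sub>R q" by (simp add: zs)
    moreover have "0 \<le> m" "m \<le> 1" using True hk s by (auto simp: m_def)
    ultimately show ?thesis by blast
  next
    case False
    define m where "m = (1 - s) * (h + k) / k"
    have "m *\<^sub>R q = ((1 - s) / k) *\<^sub>R ((h + k) *\<^sub>R q)" by (simp add: m_def)
    also have "\<dots> = (1 - s) *\<^sub>R u + ((1 - s) / k * h) *\<^sub>R d" unfolding q using hk by (simp add: scaleR_add_right)
    finally have "(1 - m) *\<^sub>R d + m *\<^sub>R q = (1 - s) *\<^sub>R u + ((1 - m) + (1 - s) / k * h) *\<^sub>R d"
      by (simp add: scaleR_add_left)
    also have "(1 - m) + (1 - s) / k * h = s" using hk by (simp add: m_def field_simps)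
    finally have "z = (1 - m) *\<^sub>R d + m *\<^sub>R q" by (simp add: zs)
    moreover have "0 \<le> m" "m \<le> 1" using False hk s mult_right_mono[of s 1 "h + k"] by (auto simp: m_def field_simps)
    ultimately show ?thesis by blast
  qed
  then obtain e m where e: "e \<in> {u, d}" and m: "0 \<le> m" "m \<le> 1" and ze: "z = (1 - m) *\<^sub>R e + m *\<^sub>R q"
    by blast
  define w where "w = (1 - m) *\<^sub>R e + m *\<^sub>R q'"
  have wW: "w \<in> shear t ` K"
    unfolding W w_def using e ud q'W convexD_alt[OF cUt _ _ m] convexD_alt[OF cUD(2) _ _ m] by blast
  have w2: "w$2 = z$2" by (simp add: w_def ze q'12 q_def)
  have w1: "\<bar>z$1 - w$1\<bar> \<le> \<bar>c - c'\<bar>"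
  proof -
    have "z$1 - w$1 = m * (c - c')" by (simp add: w_def ze q'12 q_def algebra_simps)
    then have "\<bar>z$1 - w$1\<bar> = m * \<bar>c - c'\<bar>" using m by (simp add: abs_mult)
    also have "\<dots> \<le> 1 * \<bar>c - c'\<bar>" using m by (intro mult_right_mono) auto
    finally show ?thesis by simp
  qed
  have chk: "c * (h + k) = k * (x$1 + t * h) + h * d$1" using hk by (simp add: c_def u12)
  have xb: "x$1 \<le> 1 + \<sigma> * h - \<kappa> * h\<^sup>2" "x$1 \<ge> \<tau> * h + \<kappa> * h\<^sup>2" using r[OF xK] l[OF xK] by (auto simp: h_def)
  have db: "d$1 \<le> 1 - \<sigma> * k - \<kappa> * k\<^sup>2" "d$1 \<ge> - \<tau> * k + \<kappa> * k\<^sup>2" using r[OF dK] l[OF dK] by (auto simp: k_def)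
  \<comment> \<open>In the combination with weights \<open>k\<close> and \<open>h\<close> the tilts
    \<sigma> of the parabola cancel; the curvature terms add up to
    \<open>\<kappa> * h * k * (h + k)\<close> and compete with the shear term
    \<open>t * h * k\<close>. The bound \<open>cl\<close> does the same with \<tau>.\<close>
  have cr: "(c - 1) * (h + k) \<le> h * k * (t - \<kappa> * (h + k))"
    using mult_left_mono[OF xb(1) less_imp_le[OF hk(2)]] mult_left_mono[OF db(1) less_imp_le[OF hk(1)]] chk
    by (simp add: algebra_simps power2_eq_square)
  have cl: "c * (h + k) \<ge> h * k * (t + \<kappa> * (h + k))"
    using mult_left_mono[OF xb(2) less_imp_le[OF hk(2)]] mult_left_mono[OF db(2) less_imp_le[OF hk(1)]] chk
    by (simp add: algebra_simps power2_eq_square)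
  \<comment> \<open>Otherwise the curvature wins at both ends, the crossing stays in the unit
    segment, and \<open>w\<close> coincides with \<open>z\<close>.\<close>
  have small: "\<kappa> * (h + k) < \<bar>t\<bar>"
  proof (rule ccontr)
    assume "\<not> ?thesis"
    then have "h * k * (t - \<kappa> * (h + k)) \<le> 0" "h * k * (t + \<kappa> * (h + k)) \<ge> 0"
      using hk by (auto intro!: mult_nonneg_nonpos mult_nonneg_nonneg)
    with cr cl have "(c - 1) * (h + k) \<le> 0" "c * (h + k) \<ge> 0" by linarith+
    then have "c \<le> 1" "c \<ge> 0" using hk by (auto simp: mult_le_0_iff zero_le_mult_iff)
    then have "c' = c" by (simp add: c'_def)
    then have "w = z" using w1 w2 by (intro vec2_eqI) auto
    with wW z show False by auto
  qed
  have "\<bar>z$2\<bar> \<le> h + k"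
  proof -
    have "z$2 = (1 - s) * h - s * k" by (simp add: zs u12 k_def)
    moreover have "0 \<le> (1 - s) * h" "(1 - s) * h \<le> h" "0 \<le> s * k" "s * k \<le> k"
      using s hk mult_right_mono[of s 1 k] mult_right_mono[of "1 - s" 1 h] by auto
    ultimately show ?thesis using hk by linarith
  qed
  also have "h + k \<le> \<bar>t\<bar> / \<kappa>" using small \<kappa> by (simp add: pos_le_divide_eq mult.commute)
  finally have z2: "\<bar>z$2\<bar> \<le> \<bar>t\<bar> / \<kappa>" .
  have hk4: "h * k * \<bar>t\<bar> \<le> t\<^sup>2 / (4 * \<kappa>) * (h + k)"
  proof -
    have "4 * (h * k) \<le> (h + k)\<^sup>2" using zero_le_power2[of "h - k"] by (simp add: power2_eq_square algebra_simps)
    then have "\<kappa> * (4 * (h * k)) * \<bar>t\<bar> \<le> \<kappa> * (h + k)\<^sup>2 * \<bar>t\<bar>"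
      using \<kappa> by (intro mult_right_mono mult_left_mono) auto
    also have "\<dots> = (\<kappa> * (h + k)) * (\<bar>t\<bar> * (h + k))" by (simp add: power2_eq_square)
    also have "\<dots> \<le> \<bar>t\<bar> * (\<bar>t\<bar> * (h + k))" using small hk by (intro mult_right_mono) auto
    also have "\<dots> = t\<^sup>2 * (h + k)" by (simp add: power2_eq_square)
    finally have "(h * k * \<bar>t\<bar>) * (4 * \<kappa>) \<le> t\<^sup>2 * (h + k)" by (simp add: algebra_simps)
    then have "h * k * \<bar>t\<bar> \<le> t\<^sup>2 * (h + k) / (4 * \<kappa>)"
      using \<kappa> by (subst pos_le_divide_eq) auto
    then show ?thesis by simp
  qed
  have "c - 1 \<le> t\<^sup>2 / (4 * \<kappa>)"
  proof -
    have "h * k * (t - \<kappa> * (h + k)) \<le> h * k * \<bar>t\<bar>" using hk \<kappa> by (intro mult_left_mono) (auto intro: order_trans[OF _ abs_ge_self])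
    then have "(c - 1) * (h + k) \<le> t\<^sup>2 / (4 * \<kappa>) * (h + k)" using cr hk4 by linarith
    then show ?thesis using hk by (intro mult_right_le_imp_le[of "c - 1" "h + k"]) auto
  qed
  moreover have "- c \<le> t\<^sup>2 / (4 * \<kappa>)"
  proof -
    have "0 \<le> \<kappa> * (h + k)" using hk \<kappa> by simp
    then have "- \<bar>t\<bar> \<le> t + \<kappa> * (h + k)" by linarith
    then have "h * k * (- \<bar>t\<bar>) \<le> h * k * (t + \<kappa> * (h + k))"
      using hk by (intro mult_left_mono) auto
    then have "(- c) * (h + k) \<le> t\<^sup>2 / (4 * \<kappa>) * (h + k)" using cl hk4 by (simp only: mult_minus_left mult_minus_right)
    then show ?thesis using hk by (intro mult_right_le_imp_le[of "- c" "h + k"]) auto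
  qed
  moreover have "0 \<le> t\<^sup>2 / (4 * \<kappa>)" using \<kappa> by simp
  ultimately have "\<bar>c - c'\<bar> \<le> t\<^sup>2 / (4 * \<kappa>)" unfolding c'_def by (auto simp: max_def min_def)
  then show ?thesis using z2 wW w2 w1 by (meson order_trans)
qed

text \<open>The sheared disc need not be convex, but its horizontal slices are translates of those
  of \<open>K\<close>, as required for the smaller set in \<open>area_diff_le\<close>.\<close>

lemma convex_slice_shear:
  assumes "convex K"
  shows "convex {x. vec2 (x, y) \<in> shear t ` K}"
proof -
  have sv: "shear t (vec2 (x, y)) = vec2 (t * max y 0 + x, y)" for x
    by (rule vec2_eqI) auto
  have "{x. vec2 (x, y) \<in> shear t ` K} = (+) (t * max y 0) ` {x. vec2 (x, y) \<in> K}"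
  proof (intro equalityI subsetI)
    fix x assume "x \<in> {x. vec2 (x, y) \<in> shear t ` K}"
    then obtain k where k: "k \<in> K" "vec2 (x, y) = shear t k" by auto
    then have "k$2 = y" "x = t * max y 0 + k$1"
      by (metis shear_nth(2) snd_conv vec2_nth(2), metis add.commute fst_conv shear_nth snd_conv vec2_nth)
    moreover from this have "vec2 (k$1, y) = k" by (intro vec2_eqI) auto
    ultimately show "x \<in> (+) (t * max y 0) ` {x. vec2 (x, y) \<in> K}" using k(1) by auto
  next
    fix x assume "x \<in> (+) (t * max y 0) ` {x. vec2 (x, y) \<in> K}"
    then show "x \<in> {x. vec2 (x, y) \<in> shear t ` K}"
      by (auto simp flip: sv)
  qed
  then show ?thesis using convex_slice[OF assms] by (simp add: convex_translation)
qed

lemma E_star_improve: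
  assumes K: "convex_disc K" and e: "ball_exposed K 0" "ball_exposed K (axis 1 1)"
    and ud: "\<exists>u\<in>K. u$2 > 0" "\<exists>d\<in>K. d$2 < 0" and p: "p \<ge> 1"
  obtains K' where "convex_disc K'" "E_star p K < E_star p K'"
proof -
  have cK: "compact K" "convex K" using K by (auto simp: convex_disc_def)
  note aK = convex_disc_area_pos[OF K]
  have in_K: "0 \<in> K" "axis 1 1 \<in> K" using e by (auto simp: ball_exposed_def)
  obtain \<kappa> \<sigma> \<tau> where \<kappa>: "\<kappa> > 0" and r: "\<And>x. x \<in> K \<Longrightarrow> x$1 \<le> 1 + \<sigma> * x$2 - \<kappa> * (x$2)\<^sup>2"
    and l: "\<And>x. x \<in> K \<Longrightarrow> x$1 \<ge> \<tau> * x$2 + \<kappa> * (x$2)\<^sup>2"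
    using exposed_parabolas[OF e] by metis
  obtain c0 t0 where c0: "c0 > 0" "t0 > 0"
    "\<And>t. \<bar>t\<bar> \<le> t0 \<Longrightarrow> shear_moment p K t + shear_moment p K (- t) - 2 * shear_moment p K 0 \<ge> c0 * t\<^sup>2"
    using shear_moment_gain[OF K ud p] by metis
  obtain R0 where R0: "R0 > 0" "\<And>x. x \<in> K \<Longrightarrow> norm x \<le> R0"
    using compact_imp_bounded[OF cK(1)] unfolding bounded_pos by blast
  obtain C where C: "\<And>W K'. compact W \<Longrightarrow> compact K' \<Longrightarrow> W \<subseteq> K' \<Longrightarrow> K' \<subseteq> cball 0 (2 * R0) \<Longrightarrow> area K \<le> area W \<Longrightarrow>
      \<bar>E_star p K' - E_star p W\<bar> \<le> C * (area K' - area W)"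
    using E_star_Lipschitz[of "2 * R0" "area K" p] R0(1) aK p by (metis mult_pos_pos zero_less_numeral)
  define q where "q = area K powr (-2 - p) * 2 powr (-p)"
  have q: "q > 0" using aK by (simp add: q_def)
  \<comment> \<open>The loss from taking the hull is at most \<open>B * t ^ 3\<close>. The absolute
    value is taken because the sign of \<open>C\<close> is unknown, and the added 1 makes
    \<open>B\<close> positive.\<close>
  define B where "B = (\<bar>C\<bar> + 1) / \<kappa>\<^sup>2"
  have B: "B > 0" using \<kappa> by (simp add: B_def)
  \<comment> \<open>The last bound makes the loss at most \<open>q * c0 * t\<^sup>2 / 4\<close>,
    against a gain of \<open>q * c0 * t\<^sup>2 / 2\<close>. The bound 1 keeps the sheared disc in
    the ball of radius \<open>2 * R0\<close> for which \<open>C\<close> was chosen.\<close>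
  define t where "t = min (min 1 t0) (q * c0 / (4 * B))"
  have "t \<le> q * c0 / (4 * B)" by (simp add: t_def)
  then have "t * (4 * B) \<le> q * c0" using B by (subst (asm) pos_le_divide_eq) auto
  moreover have "t > 0" "t \<le> 1" "t \<le> t0" using c0 q B by (simp_all add: t_def)
  ultimately have t: "t > 0" "t \<le> 1" "t \<le> t0" "t * (4 * B) \<le> q * c0" by simp_all
  obtain s where s: "\<bar>s\<bar> = t" "shear_moment p K s \<ge> shear_moment p K 0 + c0 * t\<^sup>2 / 2"
  proof -
    have "shear_moment p K t + shear_moment p K (- t) \<ge> 2 * shear_moment p K 0 + c0 * t\<^sup>2"
      using c0(3)[of t] t by simp
    then consider "shear_moment p K t \<ge> shear_moment p K 0 + c0 * t\<^sup>2 / 2"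
      | "shear_moment p K (- t) \<ge> shear_moment p K 0 + c0 * t\<^sup>2 / 2" by linarith
    then show thesis using that[of t] that[of "- t"] t(1) by cases auto
  qed
  define W where "W = shear s ` K"
  have cW: "compact W" unfolding W_def by (rule compact_shear[OF cK(1)])
  have aW: "area W = area K" unfolding W_def by (rule area_shear[OF cK(1)])
  define K' where "K' = convex hull W"
  have cK': "compact K'" "convex K'" unfolding K'_def using cW by (auto intro: compact_convex_hull)
  have WK': "W \<subseteq> K'" unfolding K'_def by (rule hull_subset)
  have "norm (shear s x) \<le> 2 * R0" if "x \<in> K" for x
  proof -
    have "norm (shear s x) \<le> norm x + \<bar>s * max (x$2) 0\<bar>"
      unfolding shear_def using norm_triangle_ineq[of x "(s * max (x$2) 0) *\<^sub>R axis 1 1"] by simp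
    also have "\<bar>s * max (x$2) 0\<bar> \<le> 1 * \<bar>x$2\<bar>"
      unfolding abs_mult using s(1) t(1,2) by (intro mult_mono) auto
    also have "\<dots> \<le> norm x" using component_le_norm_cart[of x 2] by simp
    finally show ?thesis using R0(2)[OF that] by simp
  qed
  then have "K' \<subseteq> cball 0 (2 * R0)"
    unfolding K'_def W_def by (intro hull_minimal) auto
  then have Lip: "\<bar>E_star p K' - E_star p W\<bar> \<le> C * (area K' - area W)"
    using aW by (intro C cW cK' WK') auto
  have "area K' - area W \<le> 4 * (\<bar>s\<bar> / \<kappa>) * (s\<^sup>2 / (4 * \<kappa>))"
  proof (rule area_diff_le[OF cW cK'(1) WK'])
    show "convex {x. vec2 (x, y) \<in> W}" for y unfolding W_def by (rule convex_slice_shear[OF cK(2)])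
    show "\<bar>z$2\<bar> \<le> \<bar>s\<bar> / \<kappa> \<and> (\<exists>w\<in>W. w$2 = z$2 \<and> \<bar>z$1 - w$1\<bar> \<le> s\<^sup>2 / (4 * \<kappa>))" if "z \<in> K' - W" for z
      using sheared_hull_near[OF cK(2) in_K \<kappa> r l] that unfolding K'_def W_def by blast
  qed (use \<kappa> in auto)
  also have "\<dots> = t ^ 3 / \<kappa>\<^sup>2"
    unfolding s(1)[symmetric] using \<kappa> by (simp add: power2_eq_square power3_eq_cube abs_mult field_simps)
  finally have small: "area K' - area W \<le> t ^ 3 / \<kappa>\<^sup>2" .
  have "C * (area K' - area W) \<le> (\<bar>C\<bar> + 1) * (area K' - area W)"
    using area_mono[OF cW cK'(1) WK'] by (intro mult_right_mono) auto
  also have "\<dots> \<le> (\<bar>C\<bar> + 1) * (t ^ 3 / \<kappa>\<^sup>2)" using small by (intro mult_left_mono) auto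
  also have "\<dots> = t * B * t\<^sup>2" by (simp add: B_def power2_eq_square power3_eq_cube)
  also have "\<dots> \<le> (q * c0 / 4) * t\<^sup>2" using t(4) by (intro mult_right_mono) auto
  also have "\<dots> < q * (c0 * t\<^sup>2 / 2)" using q c0 t by simp
  finally have loss: "E_star p W - E_star p K' < q * (c0 * t\<^sup>2 / 2)" using Lip by linarith
  have "E_star p K = q * shear_moment p K 0" "E_star p W = q * shear_moment p K s"
    unfolding W_def q_def using E_star_shear[OF cK(1) aK p, of 0] E_star_shear[OF cK(1) aK p, of s] by simp_all
  moreover have "q * shear_moment p K s \<ge> q * (shear_moment p K 0 + c0 * t\<^sup>2 / 2)"
    using s(2) q by (intro mult_left_mono) auto
  ultimately have "E_star p K < E_star p K'" using loss by (simp add: distrib_left)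
  moreover have "convex_disc K'"
    using cK' area_pos_iff_interior[OF cK'] area_mono[OF cW cK'(1) WK'] aW aK by (auto simp: convex_disc_def)
  ultimately show thesis by (rule that[rotated])
qed

text \<open>The ends of a diagonal of four exposed points are normalised to 0 and
  \<open>axis 1 1\<close>. The improved disc is again convex, so the non-strict bound applies to it
  and is strict for \<open>K\<close>.\<close>

lemma E_star_less_std_triangle:
  assumes K: "convex_disc K" and n: "\<not> 2 simplex K" and p: "p \<ge> 1"
  shows "E_star p K < E_star p std_triangle"
proof -
  have cK: "compact K" "convex K" using K by (auto simp: convex_disc_def)
  note aK = convex_disc_area_pos[OF K]
  obtain Y where Y: "card Y = 4" "\<And>y. y \<in> Y \<Longrightarrow> ball_exposed K y" "\<And>y. y \<in> Y \<Longrightarrow> y \<notin> convex hull (Y - {y})"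
    using not_simplex_obtain_exposed[OF K n] by metis
  obtain a b c d where abcd: "a \<in> Y" "b \<in> Y" "c \<in> Y" "d \<in> Y" "a \<noteq> c"
    "cross2 (c - a) (b - a) > 0" "cross2 (c - a) (d - a) < 0"
    using quadrilateral_diagonal[OF Y(1,3)] by metis
  obtain A :: "real^2 \<Rightarrow> real^2" and v where A: "linear A" "inj A" "v + A a = 0" "v + A c = axis 1 1"
    "\<And>x. (v + A x)$2 = cross2 (c - a) (x - a)"
    using normalise_segment[OF abcd(5)] by metis
  define K1 where "K1 = (\<lambda>x. v + A x) ` K"
  note T = volume_scaling_affine[OF A(1,2), of v]
  have cK1: "compact K1" "convex K1"
    unfolding K1_def using volume_scaling_compact[OF T cK(1)]
      convex_hull_affine_image[OF A(1), of v K] cK(2) convex_convex_hull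
    by (simp, metis convex_hull_eq)
  have "area K1 > 0"
    unfolding K1_def volume_scaling_area[OF T cK(1)] using T aK by (simp add: volume_scaling_def)
  then have K1: "convex_disc K1"
    using cK1 area_pos_iff_interior by (simp add: convex_disc_def)
  have "ball_exposed K1 0" "ball_exposed K1 (axis 1 1)"
    using ball_exposed_affine[OF Y(2)[OF abcd(1)] A(1,2), of v] ball_exposed_affine[OF Y(2)[OF abcd(3)] A(1,2), of v] A(3,4)
    by (simp_all add: K1_def)
  moreover have "b \<in> K" "d \<in> K" using Y(2) abcd by (auto simp: ball_exposed_def)
  then have "v + A b \<in> K1" "v + A d \<in> K1" by (auto simp: K1_def)
  then have "\<exists>u\<in>K1. u$2 > 0" "\<exists>d\<in>K1. d$2 < 0"
    using A(5)[of b] A(5)[of d] abcd(6,7) by metis+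
  ultimately obtain K' where K': "convex_disc K'" "E_star p K1 < E_star p K'"
    using E_star_improve[OF K1 _ _ _ _ p] by metis
  moreover have "E_star p K1 = E_star p K"
    unfolding K1_def by (rule E_star_affine[OF A(1,2) cK(1) aK p])
  ultimately show ?thesis using E_star_le_std_triangle[OF K'(1) p] by simp
qed

theorem theorem3:
  fixes K T :: "(real^2) set" and p :: real
  assumes "convex_disc K"
    and "2 simplex T"
    and "p \<ge> 1"
  shows "E_star p K \<le> E_star p T \<and> (E_star p K = E_star p T \<longleftrightarrow> 2 simplex K)"
  using E_star_le_std_triangle[OF assms(1,3)] E_star_less_std_triangle[OF assms(1) _ assms(3)]
    E_star_simplex[OF assms(2,3)] E_star_simplex[OF _ assms(3), of K]
  by (cases "2 simplex K") auto

end
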